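(* There is an algorithm which takes as input an $n$-vertex graph $G=(V,E)$ with a linear order $\prec$ of $V$ and computes a page assignment $\sigma$ of $E$ such that $\langle\prec,\sigma\rangle$ is a $\mathrm{fobt}(G,\prec)$-page book embedding of $G$. The algorithm runs in time $n\cdot\kappa^{\mathcal{O}(\kappa^2)}$, where $\kappa$ is the pathwidth of $(G,\prec)$.
   Context: $[k]=\{1,\dots,k\}$. A $k$-page book embedding of a graph $G=(V,E)$ is a pair $\langle \prec,\sigma\rangle$ where $\prec$ is a linear order of $V$ and $\sigma\colon E\to[k]$, such that there are no two edges $uv,wx\in E$ with $\sigma(uv)=\sigma(wx)$ and $u\prec w\prec v\prec x$. The fixed-order book thickness $\mathrm{fobt}(G,\prec)$ is the minimum $k$ such that some $\sigma\colon E\to[k]$ makes $\langle\prec,\sigma\rangle$ a $k$-page book embedding. For the order $v_1\prec\dots\prec v_n$, the guard set of $v_i$ is $P_i=\{v_j\mid j<i,\ \exists q\ge i \text{ with } v_jv_q\in E\}$, and the pathwidth of $(G,\prec)$ is $\max_{i\in[n]}|P_i|$. *)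

theory Defs
  imports Main
begin

section \<open>Graphs, book embeddings, and the pathwidth of an ordered graph\<close>

definition simple_graph :: "'v set \<Rightarrow> 'v set set \<Rightarrow> bool" where
  "simple_graph V E \<longleftrightarrow> finite V \<and> (\<forall>e\<in>E. e \<subseteq> V \<and> card e = 2)"

text \<open>Throughout, \<open>(u, v) \<in> r\<close> stands for \<open>u \<prec> v\<close>; the order is strict.\<close>

definition book_embedding ::
  "nat \<Rightarrow> 'v set \<Rightarrow> 'v set set \<Rightarrow> 'v rel \<Rightarrow> ('v set \<Rightarrow> nat) \<Rightarrow> bool" where
  "book_embedding k V E r \<sigma> \<longleftrightarrow>
     strict_linear_order_on V r \<and>
     (\<forall>e\<in>E. \<sigma> e \<in> {1..k}) \<and>
     \<not> (\<exists>u v w x. {u, v} \<in> E \<and> {w, x} \<in> E \<and> \<sigma> {u, v} = \<sigma> {w, x} \<and>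
           (u, w) \<in> r \<and> (w, v) \<in> r \<and> (v, x) \<in> r)"

definition fobt :: "'v set \<Rightarrow> 'v set set \<Rightarrow> 'v rel \<Rightarrow> nat" where
  "fobt V E r = (LEAST k. \<exists>\<sigma>. book_embedding k V E r \<sigma>)"

definition guard_set :: "'v set \<Rightarrow> 'v set set \<Rightarrow> 'v rel \<Rightarrow> 'v \<Rightarrow> 'v set" where
  "guard_set V E r v =
     {u \<in> V. (u, v) \<in> r \<and> (\<exists>w\<in>V. (w = v \<or> (v, w) \<in> r) \<and> {u, w} \<in> E)}"

text \<open>Meaningful only for nonempty \<open>V\<close>, as the maximum over the empty set is unspecified.\<close>

definition pathwidth :: "'v set \<Rightarrow> 'v set set \<Rightarrow> 'v rel \<Rightarrow> nat" where
  "pathwidth V E r = Max ((\<lambda>v. card (guard_set V E r v)) ` V)"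

section \<open>A uniform-cost random access machine\<close>

text \<open>
  Algorithms are programs of a structured random access machine. The memory consists of named
  arrays of unbounded length whose cells hold natural numbers; a program can mention only finitely
  many of the names, so this is the usual single-memory machine up to interleaving the arrays, and
  cell 0 of an array serves as a register. The arithmetic operations are addition and truncated
  subtraction. There is deliberately no multiplication, which at unit cost would make the machine
  stronger than polynomial-time equivalent to Turing machines.
\<close>

type_synonym mem = "string \<Rightarrow> nat \<Rightarrow> nat"

datatype aexp =
    Const nat
  | Load string aexp
  | Add aexp aexp
  | Sub aexp aexp

datatype bexp =
    Less aexp aexp
  | Not bexp
  | And bexp bexp

datatype com =
    Skip
  | Store string aexp aexp
  | Seq com com
  | Cond bexp com com
  | While bexp com

fun aval :: "aexp \<Rightarrow> mem \<Rightarrow> nat" where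
  "aval (Const n) s = n"
| "aval (Load x i) s = s x (aval i s)"
| "aval (Add e f) s = aval e s + aval f s"
| "aval (Sub e f) s = aval e s - aval f s"

fun bval :: "bexp \<Rightarrow> mem \<Rightarrow> bool" where
  "bval (Less e f) s \<longleftrightarrow> aval e s < aval f s"
| "bval (Not b) s \<longleftrightarrow> \<not> bval b s"
| "bval (And b c) s \<longleftrightarrow> bval b s \<and> bval c s"

fun acost :: "aexp \<Rightarrow> nat" where
  "acost (Const n) = 1"
| "acost (Load x i) = 1 + acost i"
| "acost (Add e f) = 1 + acost e + acost f"
| "acost (Sub e f) = 1 + acost e + acost f"

fun bcost :: "bexp \<Rightarrow> nat" where
  "bcost (Less e f) = 1 + acost e + acost f"
| "bcost (Not b) = 1 + bcost b"
| "bcost (And b c) = 1 + bcost b + bcost c"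

text \<open>\<open>exec p s t s'\<close>: started in memory \<open>s\<close>, program \<open>p\<close> halts after \<open>t\<close> steps in memory \<open>s'\<close>.\<close>

inductive exec :: "com \<Rightarrow> mem \<Rightarrow> nat \<Rightarrow> mem \<Rightarrow> bool" where
  Skip: "exec Skip s 1 s"
| Store: "exec (Store x i e) s (1 + acost i + acost e) (s(x := (s x)(aval i s := aval e s)))"
| Seq: "exec p s t s' \<Longrightarrow> exec q s' t' s'' \<Longrightarrow> exec (Seq p q) s (t + t') s''"
| CondTrue: "bval b s \<Longrightarrow> exec p s t s' \<Longrightarrow> exec (Cond b p q) s (1 + bcost b + t) s'"
| CondFalse: "\<not> bval b s \<Longrightarrow> exec q s t s' \<Longrightarrow> exec (Cond b p q) s (1 + bcost b + t) s'"
| WhileFalse: "\<not> bval b s \<Longrightarrow> exec (While b p) s (1 + bcost b) s"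
| WhileTrue: "bval b s \<Longrightarrow> exec p s t s' \<Longrightarrow> exec (While b p) s' t' s'' \<Longrightarrow>
    exec (While b p) s (1 + bcost b + t + t') s''"

inductive_cases exec_SkipE: "exec Skip s t s'"
inductive_cases exec_StoreE: "exec (Store x i e) s t s'"
inductive_cases exec_SeqE: "exec (Seq p q) s t s'"
inductive_cases exec_CondE: "exec (Cond b p q) s t s'"
inductive_cases exec_WhileE: "exec (While b p) s t s'"

lemma exec_deterministic:
  "exec p s t s' \<Longrightarrow> exec p s u s'' \<Longrightarrow> t = u \<and> s' = s''"
proof (induction arbitrary: u s'' rule: exec.induct)
  case (Skip s)
  then show ?case by (auto elim: exec_SkipE)
next
  case (Store x i e s)
  then show ?case by (auto elim: exec_StoreE)
next
  case (Seq p s t s1 q t' s2)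
  from Seq.prems obtain w w' s1' where
    "exec p s w s1'" "exec q s1' w' s''" "u = w + w'" by (rule exec_SeqE)
  with Seq.IH show ?case by metis
next
  case (CondTrue b s p t s1 q)
  from CondTrue.prems CondTrue.hyps(1) obtain w where
    "exec p s w s''" "u = 1 + bcost b + w" by (auto elim: exec_CondE)
  with CondTrue.IH show ?case by metis
next
  case (CondFalse b s q t s1 p)
  from CondFalse.prems CondFalse.hyps(1) obtain w where
    "exec q s w s''" "u = 1 + bcost b + w" by (auto elim: exec_CondE)
  with CondFalse.IH show ?case by metis
next
  case (WhileFalse b s p)
  from WhileFalse.prems WhileFalse.hyps show ?case by (auto elim: exec_WhileE)
next
  case (WhileTrue b s p t s1 t' s2)
  from WhileTrue.prems obtain w w' s1' where
    "exec p s w s1'" "exec (While b p) s1' w' s''" "u = 1 + bcost b + w + w'"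
    by (rule exec_WhileE) (use WhileTrue.hyps(1) in simp_all)
  with WhileTrue.IH show ?case by metis
qed

section \<open>Presentation of the input in memory\<close>

definition edge :: "'v \<times> 'v \<Rightarrow> 'v set" where
  "edge p = {fst p, snd p}"

text \<open>
  The vertices are listed in the order \<open>\<prec>\<close>. Every edge is listed exactly once, by its two endpoints
  in either order; the order of the list of edges is arbitrary.
\<close>

definition presents ::
  "'v list \<Rightarrow> ('v \<times> 'v) list \<Rightarrow> 'v set \<Rightarrow> 'v set set \<Rightarrow> 'v rel \<Rightarrow> bool" where
  "presents vs es V E r \<longleftrightarrow>
     set vs = V \<and> sorted_wrt (\<lambda>u v. (u, v) \<in> r) vs \<and>
     edge ` set es = E \<and> distinct (map edge es)"

definition array :: "nat list \<Rightarrow> nat \<Rightarrow> nat" where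
  "array xs i = (if i < length xs then xs ! i else 0)"

definition input_mem :: "nat list \<Rightarrow> (nat \<times> nat) list \<Rightarrow> mem" where
  "input_mem vs es = (\<lambda>_ _. 0)
     (''n'' := array [length vs],
      ''order'' := array vs,
      ''m'' := array [length es],
      ''src'' := array (map fst es),
      ''dst'' := array (map snd es))"

end

theory Submission
  imports Defs
begin

text \<open>
  Sweep over the vertices in the order \<open>\<prec>\<close> and fix the page of an edge when its right endpoint \<open>b\<close>
  is reached. Edges \<open>uv\<close> and \<open>wx\<close> with \<open>u \<prec> v \<prec> x\<close> and \<open>w \<prec> x\<close> cross exactly if the earlier edge \<open>uv\<close>
  passes over the left endpoint \<open>w\<close> of the later one. So all that matters about the past is which pairs of a guard
  \<open>w\<close> of \<open>b\<close> and a page are blocked by an edge passing over \<open>w\<close>: with \<open>k\<close> pages there are at most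
  \<open>2 ^ (\<kappa> * k)\<close> such states. Colouring the vertices greedily so that guard sets become rainbow, and giving
  each edge the colour of its left endpoint, shows that \<open>\<kappa>\<close> pages always suffice, so only \<open>k \<le> \<kappa>\<close> need
  be tried. For each \<open>k\<close> a table, filled from right to left, stores for every vertex and every state a
  choice of pages that can be completed. States and choices are both numbers below \<open>2 ^ (\<kappa> * k)\<close> whose
  bits are read off with a table of halves, so a vertex costs \<open>2 ^ (2 * \<kappa>\<^sup>2)\<close> up to a polynomial in \<open>\<kappa>\<close>.
\<close>

section \<open>Reasoning about running times\<close>

text \<open>The machine can neither multiply nor shift, and this shapes the program: besides the
  halves, the multiples of \<open>n + 1\<close> (addresses of matrices with a row for each position)
  and the multiples of the number of codes (addresses of rows of \<open>T\<close>) are tabulated by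
  repeated addition, and powers of two grow by doubling. Time must stay linear in the number of
  vertices, so the matrix \<open>adj\<close>, of quadratic size, is never cleared; the program
  relies on memory being zero outside the input. A choice is an arbitrary set of guard-page pairs
  and not a function from edges to pages. Choices and states thus share one encoding, and no
  validity test beyond admissibility is needed. For this reason the two directions of correctness
  treat states differently: an embedding yields the exact sets of closed pairs, whereas a path
  through the table only yields supersets of them. The claimed bound is a power with base
  \<open>w\<close>, the width, and not 2. For \<open>w\<close> at least 2 this base absorbs all
  other factors; for \<open>w\<close> equal to 0 or 1 the power is 1, and the constant factor has to
  pay for everything.\<close>

definition runs :: "com \<Rightarrow> mem \<Rightarrow> nat \<Rightarrow> (mem \<Rightarrow> bool) \<Rightarrow> bool" where
  "runs p s T Q \<longleftrightarrow> (\<exists>t s'. exec p s t s' \<and> t \<le> T \<and> Q s')"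

lemma runs_mono: "runs p s T Q \<Longrightarrow> T \<le> T' \<Longrightarrow> (\<And>s'. Q s' \<Longrightarrow> Q' s') \<Longrightarrow> runs p s T' Q'"
  unfolding runs_def by (meson le_trans)

lemma runs_Seq:
  assumes "runs p s T R" and "\<And>s'. R s' \<Longrightarrow> runs q s' T' Q"
  shows "runs (Seq p q) s (T + T') Q"
proof -
  obtain t s1 where 1: "exec p s t s1" "t \<le> T" "R s1" using assms(1) unfolding runs_def by blast
  obtain t' s2 where "exec q s1 t' s2" "t' \<le> T'" "Q s2"
    using assms(2)[OF 1(3)] unfolding runs_def by blast
  with 1 exec.Seq show ?thesis unfolding runs_def by (meson add_mono)
qed

lemma runs_Cond:
  assumes "bval b s \<Longrightarrow> runs p s T Q" and "\<not> bval b s \<Longrightarrow> runs q s T Q"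
  shows "runs (Cond b p q) s (1 + bcost b + T) Q"
proof (cases "bval b s")
  case True
  with assms(1) obtain t s' where "exec p s t s'" "t \<le> T" "Q s'" unfolding runs_def by blast
  with exec.CondTrue[OF True] show ?thesis unfolding runs_def by (metis nat_add_left_cancel_le)
next
  case False
  with assms(2) obtain t s' where "exec q s t s'" "t \<le> T" "Q s'" unfolding runs_def by blast
  with exec.CondFalse[OF False] show ?thesis unfolding runs_def by (metis nat_add_left_cancel_le)
qed

text \<open>\<open>N\<close> is the exact number of rounds: the test holds in every round below
  \<open>N\<close> and fails at \<open>I N\<close>, so termination comes from counting and no
  separate measure is needed. The summand outside the product pays for the last, failing
  test.\<close>

lemma runs_While:
  assumes step: "\<And>i s. i < N \<Longrightarrow> I i s \<Longrightarrow> bval b s \<and> runs p s T (I (Suc i))"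
    and stop: "\<And>s. I N s \<Longrightarrow> \<not> bval b s"
    and init: "I 0 s"
  shows "runs (While b p) s ((1 + bcost b) + N * (1 + bcost b + T)) (I N)"
proof -
  \<comment> \<open>Here \<open>j\<close> counts the rounds still to come.\<close>
  have "runs (While b p) s ((1 + bcost b) + j * (1 + bcost b + T)) (I N)"
    if "j \<le> N" "I (N - j) s" for j s
    using that
  proof (induction j arbitrary: s)
    case 0
    then have "\<not> bval b s" using stop by simp
    from exec.WhileFalse[OF this] 0 show ?case unfolding runs_def by fastforce
  next
    case (Suc j)
    have eq: "Suc (N - Suc j) = N - j" using Suc.prems by simp
    have "bval b s \<and> runs p s T (I (N - j))"
      using step[of "N - Suc j" s] Suc.prems eq by simp
    then obtain t s1 where b: "bval b s" and 1: "exec p s t s1" "t \<le> T" "I (N - j) s1"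
      unfolding runs_def by blast
    obtain t' s2 where 2: "exec (While b p) s1 t' s2"
      "t' \<le> (1 + bcost b) + j * (1 + bcost b + T)" "I N s2"
      using Suc.IH[OF _ 1(3)] Suc.prems unfolding runs_def by auto
    have "exec (While b p) s (1 + bcost b + t + t') s2"
      using exec.WhileTrue[OF b 1(1) 2(1)] .
    moreover have "1 + bcost b + t + t' \<le> (1 + bcost b) + Suc j * (1 + bcost b + T)"
      using 1(2) 2(2) by simp
    ultimately show ?case using 2(3) unfolding runs_def by blast
  qed
  from this[of N s] init show ?thesis by simp
qed

section \<open>Frame conditions and symbolic execution of loop-free code\<close>

fun writes :: "com \<Rightarrow> string set" where
  "writes Skip = {}"
| "writes (Store x i e) = {x}"
| "writes (Seq p q) = writes p \<union> writes q"
| "writes (Cond b p q) = writes p \<union> writes q"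
| "writes (While b p) = writes p"

lemma exec_frame: "exec p s t s' \<Longrightarrow> x \<notin> writes p \<Longrightarrow> s' x = s x"
  by (induction rule: exec.induct) auto

fun loop_free :: "com \<Rightarrow> bool" where
  "loop_free (Seq p q) \<longleftrightarrow> loop_free p \<and> loop_free q"
| "loop_free (Cond b p q) \<longleftrightarrow> loop_free p \<and> loop_free q"
| "loop_free (While b p) \<longleftrightarrow> False"
| "loop_free _ \<longleftrightarrow> True"

fun result :: "com \<Rightarrow> mem \<Rightarrow> mem" where
  "result Skip s = s"
| "result (Store x i e) s = s(x := (s x)(aval i s := aval e s))"
| "result (Seq p q) s = result q (result p s)"
| "result (Cond b p q) s = (if bval b s then result p s else result q s)"
| "result (While b p) s = s"

text \<open>A conditional is charged for both branches, which bounds either one by a number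
  independent of the memory. The values of \<open>cost\<close> and \<open>result\<close> at
  \<open>While\<close> are placeholders; both functions are applied to loop-free code only.\<close>

fun cost :: "com \<Rightarrow> nat" where
  "cost Skip = 1"
| "cost (Store x i e) = 1 + acost i + acost e"
| "cost (Seq p q) = cost p + cost q"
| "cost (Cond b p q) = 1 + bcost b + (cost p + cost q)"
| "cost (While b p) = 0"

lemma runs_loop_free_result:
  "loop_free p \<Longrightarrow> runs p s (cost p) (\<lambda>s'. s' = result p s)"
proof (induction p arbitrary: s)
  case Skip
  show ?case unfolding runs_def using exec.Skip[of s] by auto
next
  case (Store x i e)
  show ?case unfolding runs_def using exec.Store[of x i e s] by auto
next
  case (Seq p q)
  then show ?case by (simp, intro runs_Seq[OF Seq.IH(1)]) simp_all
next
  case (Cond b p q)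
  have "runs (Cond b p q) s (1 + bcost b + (cost p + cost q)) (\<lambda>s'. s' = result (Cond b p q) s)"
  proof (rule runs_Cond)
    assume "bval b s"
    with Cond show "runs p s (cost p + cost q) (\<lambda>s'. s' = result (Cond b p q) s)"
      by (intro runs_mono[OF Cond.IH(1)]) simp_all
  next
    assume "\<not> bval b s"
    with Cond show "runs q s (cost p + cost q) (\<lambda>s'. s' = result (Cond b p q) s)"
      by (intro runs_mono[OF Cond.IH(2)]) simp_all
  qed
  then show ?case by simp
next
  case (While b p)
  then show ?case by simp
qed

lemma runs_loop_free:
  "loop_free p \<Longrightarrow> cost p \<le> T \<Longrightarrow> Q (result p s) \<Longrightarrow> runs p s T Q"
  by (rule runs_mono[OF runs_loop_free_result]) simp_all

definition agree :: "string set \<Rightarrow> mem \<Rightarrow> mem \<Rightarrow> bool" where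
  "agree W s s' \<longleftrightarrow> (\<forall>x. x \<notin> W \<longrightarrow> s' x = s x)"

lemma agreeD: "agree W s s' \<Longrightarrow> x \<notin> W \<Longrightarrow> s' x = s x"
  unfolding agree_def by blast

lemma runs_agree:
  "runs p s T Q \<Longrightarrow> runs p s T (\<lambda>s'. Q s' \<and> agree (writes p) s s')"
  unfolding agree_def runs_def using exec_frame by blast

text \<open>The frame condition refers to the memory before the loop, so an invariant
  \<open>I\<close> has to describe only what the body changes; everything else about
  \<open>s\<close> is recovered with \<open>agreeD\<close>.\<close>

lemma runs_While_agree:
  assumes step: "\<And>i s'. i < N \<Longrightarrow> I i s' \<Longrightarrow> agree (writes p) s s' \<Longrightarrow>
      bval b s' \<and> runs p s' T (I (Suc i))"
    and stop: "\<And>s'. I N s' \<Longrightarrow> agree (writes p) s s' \<Longrightarrow> \<not> bval b s'"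
    and init: "I 0 s"
    and time: "(1 + bcost b) + N * (1 + bcost b + T) \<le> T'"
  shows "runs (While b p) s T' (\<lambda>s'. I N s' \<and> agree (writes p) s s')"
proof -
  have "runs (While b p) s ((1 + bcost b) + N * (1 + bcost b + T))
      (\<lambda>s'. I N s' \<and> agree (writes p) s s')"
  proof (rule runs_While[where I = "\<lambda>i s'. I i s' \<and> agree (writes p) s s'"])
    fix i s'
    assume "i < N" and s': "I i s' \<and> agree (writes p) s s'"
    with step have "bval b s'" "runs p s' T (I (Suc i))" by blast+
    moreover from runs_agree[OF this(2)]
    have "runs p s' T (\<lambda>s''. I (Suc i) s'' \<and> agree (writes p) s s'')"
      by (rule runs_mono) (use s' in \<open>auto simp: agree_def\<close>)
    ultimately show "bval b s' \<and> runs p s' T (\<lambda>s''. I (Suc i) s'' \<and> agree (writes p) s s'')"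
      by blast
  next
    fix s' assume "I N s' \<and> agree (writes p) s s'"
    with stop show "\<not> bval b s'" by blast
  qed (use init in \<open>simp add: agree_def\<close>)
  then show ?thesis by (rule runs_mono) (use time in auto)
qed

section \<open>The program\<close>

abbreviation reg :: "string \<Rightarrow> aexp" where
  "reg x \<equiv> Load x (Const 0)"

abbreviation assign :: "string \<Rightarrow> aexp \<Rightarrow> com" (infix ":=\<^sub>r" 61) where
  "x :=\<^sub>r e \<equiv> Store x (Const 0) e"

abbreviation store :: "string \<Rightarrow> aexp \<Rightarrow> aexp \<Rightarrow> com" ("_[_]\<^sub>r :=\<^sub>r _" [62, 0, 62] 61) where
  "x[i]\<^sub>r :=\<^sub>r e \<equiv> Store x i e"

abbreviation incr :: "string \<Rightarrow> com" where
  "incr x \<equiv> x :=\<^sub>r Add (reg x) (Const 1)"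

abbreviation pos_if :: "aexp \<Rightarrow> com \<Rightarrow> com" where
  "pos_if e p \<equiv> Cond (Less (Const 0) e) p Skip"

notation Seq (infixr ";;" 60)

text \<open>Positions count from 1, which leaves 0 free as a default. With the multiples of
  \<open>n + 1\<close> in \<open>mul\<close>, the sum \<open>mul[b] + a\<close> addresses a matrix
  whose columns run from 0 to \<open>n\<close>.\<close>

definition number_vertices :: com where
  "number_vertices =
    While (Less (reg ''i'') (reg ''n''))
      (''pos''[Load ''order'' (reg ''i'')]\<^sub>r :=\<^sub>r Add (reg ''i'') (Const 1) ;;
       ''mul''[Add (reg ''i'') (Const 1)]\<^sub>r :=\<^sub>r
         Add (Load ''mul'' (reg ''i'')) (Add (reg ''n'') (Const 1)) ;;
       incr ''i'')"

text \<open>An entry of \<open>adj\<close> is the index of the edge plus 1, since 0 means no edge.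
  The swap puts the left endpoint into \<open>a\<close>. The rightmost neighbour, kept in
  \<open>last\<close>, alone decides how long a vertex remains a guard.\<close>

definition enter_edges :: com where
  "enter_edges =
    While (Less (reg ''e'') (reg ''m''))
      (''a'' :=\<^sub>r Load ''pos'' (Load ''src'' (reg ''e'')) ;;
       ''b'' :=\<^sub>r Load ''pos'' (Load ''dst'' (reg ''e'')) ;;
       Cond (Less (reg ''b'') (reg ''a''))
         (''x'' :=\<^sub>r reg ''a'' ;; ''a'' :=\<^sub>r reg ''b'' ;; ''b'' :=\<^sub>r reg ''x'') Skip ;;
       ''adj''[Add (Load ''mul'' (reg ''b'')) (reg ''a'')]\<^sub>r :=\<^sub>r Add (reg ''e'') (Const 1) ;;
       Cond (Less (Load ''last'' (reg ''a'')) (reg ''b''))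
         (''last''[reg ''a'']\<^sub>r :=\<^sub>r reg ''b'') Skip ;;
       incr ''e'')"

abbreviation guard_addr :: aexp where
  "guard_addr \<equiv> Add (Load ''mul'' (reg ''b'')) (reg ''s'')"

text \<open>The row of \<open>b + 1\<close> is addressed as \<open>mul[b] + (n + 1)\<close>, because
  for \<open>b = n\<close> the entry \<open>mul[b + 1]\<close> is not tabulated.\<close>

definition filter_guards :: com where
  "filter_guards =
    While (Less (reg ''s'') (Load ''len'' (reg ''b'')))
      (Cond (Less (reg ''b'') (Load ''last'' (Load ''G'' guard_addr)))
         (''G''[Add (Add (Load ''mul'' (reg ''b'')) (Add (reg ''n'') (Const 1))) (reg ''t'')]\<^sub>r :=\<^sub>r
            Load ''G'' guard_addr ;;
          incr ''t'') Skip ;;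
       incr ''s'')"

definition list_guards :: com where
  "list_guards =
    ''b'' :=\<^sub>r Const 1 ;;
    While (Less (reg ''b'') (Add (reg ''n'') (Const 1)))
      ((''s'' :=\<^sub>r Const 0 ;; ''t'' :=\<^sub>r Const 0) ;;
       filter_guards ;;
       (Cond (Less (reg ''b'') (Load ''last'' (reg ''b'')))
         (''G''[Add (Add (Load ''mul'' (reg ''b'')) (Add (reg ''n'') (Const 1))) (reg ''t'')]\<^sub>r :=\<^sub>r
            reg ''b'' ;;
          incr ''t'') Skip ;;
        ''len''[Add (reg ''b'') (Const 1)]\<^sub>r :=\<^sub>r reg ''t'' ;;
        Cond (Less (reg ''K'') (reg ''t'')) (''K'' :=\<^sub>r reg ''t'') Skip ;;
        incr ''b''))"

text \<open>The truncated subtraction makes the increment of \<open>bad\<close> equal to 1 exactly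
  if both bits are set. The new bit is emitted before \<open>seen\<close> is updated, since an edge
  does not pass over its own left endpoint. Guards that retire at \<open>b\<close> emit no bit,
  hence \<open>w\<close> is doubled only under the condition.\<close>

definition scan_bit :: com where
  "scan_bit =
    ''cb'' :=\<^sub>r Sub (reg ''cr'') (Add (Load ''hf'' (reg ''cr'')) (Load ''hf'' (reg ''cr''))) ;;
    ''cr'' :=\<^sub>r Load ''hf'' (reg ''cr'') ;;
    ''db'' :=\<^sub>r Sub (reg ''dr'') (Add (Load ''hf'' (reg ''dr'')) (Load ''hf'' (reg ''dr''))) ;;
    ''dr'' :=\<^sub>r Load ''hf'' (reg ''dr'') ;;
    ''bad'' :=\<^sub>r Add (reg ''bad'') (Sub (Add (reg ''cb'') (reg ''db'')) (Const 1)) ;;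
    pos_if (reg ''db'') (''got''[reg ''s'']\<^sub>r :=\<^sub>r Add (reg ''q'') (Const 1)) ;;
    Cond (Less (reg ''b'') (Load ''last'' (Load ''G'' guard_addr)))
      (pos_if (Add (reg ''cb'') (reg ''seen'')) (''cn'' :=\<^sub>r Add (reg ''cn'') (reg ''w'')) ;;
       ''w'' :=\<^sub>r Add (reg ''w'') (reg ''w'')) Skip ;;
    ''seen'' :=\<^sub>r Add (reg ''seen'') (reg ''db'') ;;
    incr ''s''"

text \<open>The final doubling of \<open>w\<close> emits a 0 bit for \<open>b\<close> itself, the
  last guard of the next row: no edge ending at or before \<open>b\<close> passes over
  \<open>b\<close>.\<close>

definition scan_page :: com where
  "scan_page =
    (''seen'' :=\<^sub>r Const 0 ;; ''s'' :=\<^sub>r Const 0) ;;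
    While (Less (reg ''s'') (Load ''len'' (reg ''b''))) scan_bit ;;
    (Cond (Less (reg ''b'') (Load ''last'' (reg ''b''))) 
      (''w'' :=\<^sub>r Add (reg ''w'') (reg ''w'')) Skip ;;
     incr ''q'')"

text \<open>Removes the offers of the previous choice, which \<open>scan_bit\<close> never
  erases.\<close>

definition clear_pages :: com where
  "clear_pages =
    ''s'' :=\<^sub>r Const 0 ;;
    While (Less (reg ''s'') (Load ''len'' (reg ''b'')))
      (''got''[reg ''s'']\<^sub>r :=\<^sub>r Const 0 ;; incr ''s'')"

definition check_pages :: com where
  "check_pages =
    ''s'' :=\<^sub>r Const 0 ;;
    While (Less (reg ''s'') (Load ''len'' (reg ''b'')))
      (pos_if (Load ''adj'' (Add (Load ''mul'' (reg ''b'')) (Load ''G'' guard_addr)))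
         (Cond (Less (Load ''got'' (reg ''s'')) (Const 1)) (incr ''bad'') Skip) ;;
       incr ''s'')"

text \<open>The same code serves twice: to test a choice while the table is being filled, and to
  replay the stored choice at output.\<close>

definition transition :: com where
  "transition =
    clear_pages ;;
    (''cr'' :=\<^sub>r reg ''c'' ;; ''dr'' :=\<^sub>r reg ''d'' ;; ''bad'' :=\<^sub>r Const 0 ;;
     ''cn'' :=\<^sub>r Const 0 ;; ''w'' :=\<^sub>r Const 1 ;; ''q'' :=\<^sub>r Const 0) ;;
    While (Less (reg ''q'') (reg ''k'')) scan_page ;;
    check_pages"

text \<open>Uses that \<open>(x + 2) div 2\<close> exceeds \<open>x div 2\<close> by 1.\<close>

definition halving_table :: com where
  "halving_table =
    (''hf''[Const 0]\<^sub>r :=\<^sub>r Const 0 ;; ''hf''[Const 1]\<^sub>r :=\<^sub>r Const 0 ;; ''x'' :=\<^sub>r Const 0) ;;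
    While (Less (reg ''x'') (reg ''S''))
      (''hf''[Add (reg ''x'') (Const 2)]\<^sub>r :=\<^sub>r Add (Load ''hf'' (reg ''x'')) (Const 1) ;;
       incr ''x'')"

definition base_table :: com where
  "base_table =
    (''bs''[Const 0]\<^sub>r :=\<^sub>r Const 0 ;; ''x'' :=\<^sub>r Const 0) ;;
    While (Less (reg ''x'') (Add (reg ''n'') (Const 1)))
      (''bs''[Add (reg ''x'') (Const 1)]\<^sub>r :=\<^sub>r Add (Load ''bs'' (reg ''x'')) (reg ''S'') ;;
       incr ''x'')"

abbreviation entry_addr :: aexp where
  "entry_addr \<equiv> Add (Load ''bs'' (reg ''b'')) (reg ''c'')"

text \<open>The cell is reset first because a round with fewer pages, whose rows were spaced more
  narrowly, may have left a value there. A later success overwrites an earlier one; any of them will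
  do.\<close>

definition try_choices :: com where
  "try_choices =
    (''T''[entry_addr]\<^sub>r :=\<^sub>r Const 0 ;; ''d'' :=\<^sub>r Const 0) ;;
    While (Less (reg ''d'') (reg ''S''))
      (transition ;;
       (Cond (And (Less (reg ''bad'') (Const 1))
          (Less (Const 0) (Load ''T''
             (Add (Load ''bs'' (Add (reg ''b'') (Const 1))) (reg ''cn'')))))
         (''T''[entry_addr]\<^sub>r :=\<^sub>r Add (reg ''d'') (Const 1)) Skip ;;
        incr ''d''))"

definition fill_row :: com where
  "fill_row =
    ''c'' :=\<^sub>r Const 0 ;;
    While (Less (reg ''c'') (reg ''S'')) (try_choices ;; incr ''c'')"

text \<open>The row past the last vertex has no guards and hence the single code 0. Its entry 1
  marks success and names no choice.\<close>

definition fill_table :: com where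
  "fill_table =
    halving_table ;; base_table ;;
    (''T''[Load ''bs'' (Add (reg ''n'') (Const 1))]\<^sub>r :=\<^sub>r Const 1 ;; ''b'' :=\<^sub>r reg ''n'') ;;
    While (Less (Const 0) (reg ''b'')) (fill_row ;; ''b'' :=\<^sub>r Sub (reg ''b'') (Const 1))"

text \<open>Doubling \<open>K\<close> times turns \<open>2 ^ (K * k)\<close> into
  \<open>2 ^ (K * (k + 1))\<close>.\<close>

definition more_pages :: com where
  "more_pages =
    (incr ''k'' ;; ''x'' :=\<^sub>r Const 0) ;;
    While (Less (reg ''x'') (reg ''K''))
      (''S'' :=\<^sub>r Add (reg ''S'') (reg ''S'') ;; incr ''x'')"

definition find_pages :: com where
  "find_pages =
    (''k'' :=\<^sub>r Const 0 ;; ''S'' :=\<^sub>r Const 1 ;; ''fin'' :=\<^sub>r Const 0) ;;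
    While (Less (reg ''fin'') (Const 1))
      (fill_table ;;
       Cond (Less (Const 0) (Load ''T'' (Load ''bs'' (Const 1))))
         (''fin'' :=\<^sub>r Const 1) more_pages)"

definition output_vertex :: com where
  "output_vertex =
    ''s'' :=\<^sub>r Const 0 ;;
    While (Less (reg ''s'') (Load ''len'' (reg ''b'')))
      (''e'' :=\<^sub>r Load ''adj'' (Add (Load ''mul'' (reg ''b'')) (Load ''G'' guard_addr)) ;;
       pos_if (reg ''e'') (''page''[Sub (reg ''e'') (Const 1)]\<^sub>r :=\<^sub>r Load ''got'' (reg ''s'')) ;;
       incr ''s'')"

definition output_pages :: com where
  "output_pages =
    (''c'' :=\<^sub>r Const 0 ;; ''b'' :=\<^sub>r Const 1) ;;
    While (Less (reg ''b'') (Add (reg ''n'') (Const 1)))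
      (''d'' :=\<^sub>r Sub (Load ''T'' entry_addr) (Const 1) ;;
       transition ;; output_vertex ;;
       (''c'' :=\<^sub>r reg ''cn'' ;; incr ''b''))"

definition book_program :: com where
  "book_program =
    number_vertices ;; enter_edges ;; list_guards ;; find_pages ;; output_pages"

section \<open>Guards and page assignments on positions\<close>

locale ordered_graph =
  fixes n :: nat and pl :: "(nat \<times> nat) list"
  assumes distinct_pl: "distinct pl"
    and pl_range: "(a, b) \<in> set pl \<Longrightarrow> 1 \<le> a \<and> a < b \<and> b \<le> n"
begin

text \<open>The default 0 lies below every position, so a vertex without later neighbours never
  becomes a guard.\<close>

definition last_nb :: "nat \<Rightarrow> nat" where
  "last_nb a = Max (insert 0 {b. (a, b) \<in> set pl})"

definition row :: "nat \<Rightarrow> nat list" where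
  "row b = filter (\<lambda>a. b \<le> last_nb a) [1..<b]"

text \<open>The index \<open>Suc n\<close> keeps the set nonempty when there are no vertices; its
  row is empty and adds only the value 0.\<close>

definition width :: nat where
  "width = Max ((\<lambda>b. length (row b)) ` {1..Suc n})"

lemma finite_nbs: "finite {b. (a, b) \<in> set pl}"
  by (rule finite_subset[of _ "snd ` set pl"]) force+

lemma last_nb_ge: "(a, b) \<in> set pl \<Longrightarrow> b \<le> last_nb a"
  unfolding last_nb_def using finite_nbs by (intro Max_ge) auto

lemma last_nb_cases: "last_nb a = 0 \<or> (a, last_nb a) \<in> set pl"
proof -
  have "last_nb a \<in> insert 0 {b. (a, b) \<in> set pl}"
    unfolding last_nb_def using finite_nbs by (intro Max_in) auto
  then show ?thesis by auto
qed

lemma last_nb_le: "last_nb a \<le> n"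
  using last_nb_cases[of a] pl_range[of a "last_nb a"] by auto

lemma set_row: "a \<in> set (row b) \<longleftrightarrow> 1 \<le> a \<and> a < b \<and> b \<le> last_nb a"
  unfolding row_def by auto

text \<open>Some neighbour lies at or after \<open>b\<close> just when the last one does. This is
  the form that matches \<open>guard_set\<close>.\<close>

lemma set_row_iff: "a \<in> set (row b) \<longleftrightarrow> a < b \<and> (\<exists>x\<ge>b. (a, x) \<in> set pl)"
  unfolding set_row using last_nb_cases[of a] last_nb_ge pl_range
  by (metis le_trans not_less_zero le_zero_eq)

lemma edge_in_row: "(a, b) \<in> set pl \<Longrightarrow> a \<in> set (row b)"
  unfolding set_row_iff using pl_range by blast

lemma sorted_row: "sorted_wrt (<) (row b)"
  unfolding row_def by (simp add: sorted_wrt_filter)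

lemma distinct_row: "distinct (row b)"
  unfolding row_def by simp

lemma row_nth_less: "i < j \<Longrightarrow> j < length (row b) \<Longrightarrow> row b ! i < row b ! j"
  using sorted_row sorted_wrt_nth_less by blast

lemma row_nth_less_iff:
  "i < length (row b) \<Longrightarrow> j < length (row b) \<Longrightarrow> row b ! i < row b ! j \<longleftrightarrow> i < j"
  using row_nth_less by (metis less_asym' linorder_neqE_nat)

lemma length_row_less: "1 \<le> b \<Longrightarrow> length (row b) < b"
  unfolding row_def using length_filter_le[of "\<lambda>a. b \<le> last_nb a" "[1..<b]"] by simp

lemma row_1: "row (Suc 0) = []"
  unfolding row_def by simp

lemma row_end: "row (Suc n) = []"
  unfolding row_def using last_nb_le by (auto simp: filter_empty_conv not_le less_Suc_eq_le)

text \<open>A guard of \<open>b\<close> survives exactly if its last neighbour lies strictly after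
  \<open>b\<close>. The only possible newcomer is \<open>b\<close>; being the largest, it goes to
  the end. This recurrence is what \<open>list_guards\<close> executes.\<close>

lemma row_Suc:
  assumes "1 \<le> b"
  shows "row (Suc b) = filter (\<lambda>a. b < last_nb a) (row b) @ (if b < last_nb b then [b] else [])"
  unfolding row_def using assms by (auto simp: Suc_le_eq intro: filter_cong)

lemma length_row_le_width: "1 \<le> b \<Longrightarrow> b \<le> Suc n \<Longrightarrow> length (row b) \<le> width"
  unfolding width_def by (intro Max_ge) auto

text \<open>Charge each edge to its right endpoint together with the left one, which is a guard
  there. This is why the pass over the list of edges fits into time linear in the number of
  vertices.\<close>

lemma length_pl_le: "length pl \<le> n * width"
proof -
  let ?R = "SIGMA b:{1..n}. set (row b)"
  have "length pl = card (set pl)" using distinct_pl by (simp add: distinct_card)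
  also have "\<dots> = card (prod.swap ` set pl)" by (simp add: card_image)
  also have "\<dots> \<le> card ?R"
    using pl_range edge_in_row by (intro card_mono) (auto, fastforce+)
  also have "\<dots> = (\<Sum>b\<in>{1..n}. length (row b))"
    by (simp add: distinct_card[OF distinct_row])
  also have "\<dots> \<le> (\<Sum>b\<in>{1..n}. width)"
    by (intro sum_mono length_row_le_width) auto
  finally show ?thesis by simp
qed

section \<open>Page assignments on positions; \<open>width\<close> pages suffice\<close>

definition embeds :: "nat \<Rightarrow> (nat \<times> nat \<Rightarrow> nat) \<Rightarrow> bool" where
  "embeds k col \<longleftrightarrow> (\<forall>e\<in>set pl. col e \<in> {1..k}) \<and>
     (\<forall>a b c d. (a, b) \<in> set pl \<and> (c, d) \<in> set pl \<and> a < c \<and> c < b \<and> b < d \<longrightarrow>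
        col (a, b) \<noteq> col (c, d))"

text \<open>
  Two crossing edges have their left endpoints in a common guard set, so it suffices to colour
  vertices injectively on guard sets; this is greedy colouring of an interval graph.
\<close>

lemma guard_colouring:
  assumes "j \<le> n"
  shows "\<exists>f. (\<forall>b\<in>{1..Suc j}. f ` set (row b) \<subseteq> {1..width} \<and> inj_on f (set (row b)))"
  using assms
proof (induction j)
  case 0
  then show ?case by (auto simp: row_1)
next
  case (Suc j)
  then obtain f :: "nat \<Rightarrow> nat" where
    f: "\<And>b. b \<in> {1..Suc j} \<Longrightarrow> f ` set (row b) \<subseteq> {1..width} \<and> inj_on f (set (row b))"
    by fastforce
  let ?v = "Suc j" and ?A = "set (row (Suc (Suc j))) - {Suc j}"
  \<comment> \<open>Apart from the newcomer, the next row is contained in the current one, on which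
    \<open>f\<close> is already injective.\<close>
  have A: "?A \<subseteq> set (row ?v)" using Suc_leD by (auto simp: set_row)
  \<comment> \<open>If the newcomer is a guard, it shares the row with fewer than
    \<open>width\<close> others, so a colour is free; otherwise any \<open>x\<close> serves.\<close>
  obtain x where x: "?v \<in> set (row (Suc ?v)) \<Longrightarrow> x \<in> {1..width} - f ` ?A"
  proof (cases "?v \<in> set (row (Suc ?v))")
    case True
    have "card (f ` ?A) \<le> card ?A" by (intro card_image_le) simp
    also have "\<dots> < card (set (row (Suc ?v)))" using True by (intro psubset_card_mono) auto
    also have "\<dots> \<le> width"
      using length_row_le_width[of "Suc ?v"] Suc.prems by (simp add: distinct_card[OF distinct_row])
    finally have "card (f ` ?A) < card {1..width}" by simp
    then have "\<not> {1..width} \<subseteq> f ` ?A" by (meson card_mono finite_Diff finite_imageI finite_set not_le)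
    then show ?thesis using that by blast
  qed (use that in blast)
  let ?f = "f(?v := x)"
  have "?f ` set (row b) \<subseteq> {1..width} \<and> inj_on ?f (set (row b))" if b: "b \<in> {1..Suc ?v}" for b
  proof (cases "b = Suc ?v")
    case False
    \<comment> \<open>Earlier rows contain only smaller positions, so recolouring \<open>?v\<close>
      leaves them alone.\<close>
    then have "?v \<notin> set (row b)" using b by (auto simp: set_row)
    then have "\<And>a. a \<in> set (row b) \<Longrightarrow> ?f a = f a" by auto
    then show ?thesis using f[of b] b False by (auto cong: inj_on_cong image_cong)
  next
    case True
    have fA: "f ` ?A \<subseteq> {1..width}" "inj_on f ?A"
      using f[of ?v] A by (auto intro: inj_on_subset)
    show ?thesis
    proof (cases "?v \<in> set (row (Suc ?v))")
      case True
      then have "set (row (Suc ?v)) = insert ?v ?A" by blast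
      moreover have "inj_on ?f (insert ?v ?A)"
        using fA x[OF True] by (auto simp: inj_on_def)
      ultimately show ?thesis using \<open>b = Suc ?v\<close> fA x[OF True] by auto
    next
      case False
      then have "?A = set (row (Suc ?v))" by blast
      moreover have "\<And>a. a \<in> ?A \<Longrightarrow> ?f a = f a" by auto
      ultimately show ?thesis using \<open>b = Suc ?v\<close> fA by (metis (no_types, lifting) inj_on_cong image_cong)
    qed
  qed
  then show ?case by blast
qed

lemma embeds_width: "\<exists>col. embeds width col"
proof -
  obtain f where f: "\<And>b. b \<in> {1..Suc n} \<Longrightarrow> f ` set (row b) \<subseteq> {1..width} \<and> inj_on f (set (row b))"
    using guard_colouring[of n] by blast
  have "embeds width (\<lambda>e. f (fst e))"
    unfolding embeds_def
  proof (intro conjI ballI allI impI)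
    fix e assume e: "e \<in> set pl"
    obtain a b where ab: "e = (a, b)" by fastforce
    with e have "a \<in> set (row b)" "b \<in> {1..Suc n}" using edge_in_row pl_range by fastforce+
    with f[of b] ab show "f (fst e) \<in> {1..width}" by auto
  next
    fix a b c d
    assume *: "(a, b) \<in> set pl \<and> (c, d) \<in> set pl \<and> a < c \<and> c < b \<and> b < d"
    then have "a \<in> set (row b)" "c \<in> set (row b)" "b \<in> {1..Suc n}"
      using edge_in_row pl_range[of a b] set_row_iff[of c b] less_imp_le[of b d] by auto
    with f[of b] * show "f (fst (a, b)) \<noteq> f (fst (c, d))" by (auto simp: inj_on_def)
  qed
  then show ?thesis by blast
qed

section \<open>Correctness of the sweep\<close>

text \<open>
  A state before vertex \<open>b\<close> is the set \<open>H\<close> of pairs \<open>(w, q)\<close> such that page \<open>q\<close> is closed to further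
  edges at the guard \<open>w\<close>, because an edge on that page already passes over \<open>w\<close>; pages are counted
  from 0. A choice \<open>D\<close> lists the pages offered to the edges from the guards to \<open>b\<close>; it may offer
  more than one page, or offer pages to guards that are not adjacent to \<open>b\<close>.
\<close>

definition admissible :: "nat \<Rightarrow> (nat \<times> nat) set \<Rightarrow> (nat \<times> nat) set \<Rightarrow> bool" where
  "admissible b H D \<longleftrightarrow> H \<inter> D = {} \<and> (\<forall>a. (a, b) \<in> set pl \<longrightarrow> (\<exists>q. (a, q) \<in> D))"

text \<open>A guard \<open>w\<close> other than \<open>b\<close> lies to the left of
  \<open>b\<close>, so an edge from \<open>a\<close> to \<open>b\<close> passes over it just when
  \<open>a < w\<close>. The vertex \<open>b\<close> itself starts with all pages open. Guards that
  retire are dropped.\<close>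

definition next_state :: "nat \<Rightarrow> (nat \<times> nat) set \<Rightarrow> (nat \<times> nat) set \<Rightarrow> (nat \<times> nat) set" where
  "next_state b H D =
    {(w, q). w \<in> set (row (Suc b)) \<and> w \<noteq> b \<and> ((w, q) \<in> H \<or> (\<exists>a<w. (a, q) \<in> D))}"

text \<open>Reachability of the end by admissible choices. A derivation records one choice for each
  remaining vertex, and an embedding can be built along it.\<close>

inductive good :: "nat \<Rightarrow> nat \<Rightarrow> (nat \<times> nat) set \<Rightarrow> bool" for k where
  good_end: "n < b \<Longrightarrow> good k b H"
| good_step: "b \<le> n \<Longrightarrow> D \<subseteq> set (row b) \<times> {..<k} \<Longrightarrow> admissible b H D \<Longrightarrow>
    good k (Suc b) (next_state b H D) \<Longrightarrow> good k b H"

text \<open>Given an embedding, the state consists of exactly the pairs closed by edges ending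
  before \<open>b\<close>, and the choice of exactly the pages of the edges ending at
  \<open>b\<close>. These states follow one another under \<open>next_state\<close>, so the
  induction runs back from the last vertex.\<close>

lemma embeds_imp_good:
  assumes emb: "embeds k col" and b: "1 \<le> b" "b \<le> Suc n"
  shows "good k b {(w, q). w \<in> set (row b) \<and>
    (\<exists>a x. (a, x) \<in> set pl \<and> x < b \<and> a < w \<and> w < x \<and> col (a, x) = Suc q)}"
  using b
proof (induction b rule: measure_induct_rule[where f = "\<lambda>b. Suc n - b"])
  case (less b)
  let ?H = "\<lambda>b. {(w, q). w \<in> set (row b) \<and>
    (\<exists>a x. (a, x) \<in> set pl \<and> x < b \<and> a < w \<and> w < x \<and> col (a, x) = Suc q)}"
  let ?D = "{(a, q). (a, b) \<in> set pl \<and> col (a, b) = Suc q}"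
  show ?case
  proof (cases "b \<le> n")
    case True
    have eq: "next_state b (?H b) ?D = ?H (Suc b)"
    proof (rule set_eqI, clarify)
      fix w q
      have "(w, q) \<in> next_state b (?H b) ?D \<longleftrightarrow> w \<in> set (row (Suc b)) \<and> w < b \<and>
          ((\<exists>a x. (a, x) \<in> set pl \<and> x < b \<and> a < w \<and> w < x \<and> col (a, x) = Suc q) \<or>
           (\<exists>a<w. (a, b) \<in> set pl \<and> col (a, b) = Suc q))"
        unfolding next_state_def by (auto simp: set_row)
      also have "\<dots> \<longleftrightarrow> (w, q) \<in> ?H (Suc b)"
        by (auto simp: less_Suc_eq)
      finally show "(w, q) \<in> next_state b (?H b) ?D \<longleftrightarrow> (w, q) \<in> ?H (Suc b)" .
    qed
    have col: "\<And>e. e \<in> set pl \<Longrightarrow> 1 \<le> col e \<and> col e \<le> k"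
      and ncross: "\<And>a b c d. (a, b) \<in> set pl \<Longrightarrow> (c, d) \<in> set pl \<Longrightarrow> a < c \<Longrightarrow> c < b \<Longrightarrow> b < d
        \<Longrightarrow> col (a, b) \<noteq> col (c, d)"
      using emb unfolding embeds_def by auto
    have "?D \<subseteq> set (row b) \<times> {..<k}"
      using edge_in_row col by fastforce
    moreover have "admissible b (?H b) ?D"
      unfolding admissible_def
    proof (intro conjI allI impI)
      \<comment> \<open>A common pair \<open>(w, q)\<close> would give an edge passing over
        \<open>w\<close> and an edge from \<open>w\<close> to \<open>b\<close> on the same page, and
        these cross.\<close>
      show "?H b \<inter> ?D = {}" using ncross by auto metis
    next
      fix a assume "(a, b) \<in> set pl"
      then show "\<exists>q. (a, q) \<in> ?D" using col[of "(a, b)"] by (auto intro: exI[of _ "col (a, b) - 1"])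
    qed
    moreover have "good k (Suc b) (?H (Suc b))"
      using less.IH[of "Suc b"] less.prems True by simp
    ultimately show ?thesis using good_step[OF True, of ?D k "?H b"] eq by simp
  next
    case False
    then show ?thesis by (intro good_end) simp
  qed
qed

lemma embeds_imp_good_start: "embeds k col \<Longrightarrow> good k 1 {}"
  using embeds_imp_good[of k col 1] by (simp add: row_1)

definition embeds_below :: "nat \<Rightarrow> nat \<Rightarrow> (nat \<times> nat \<Rightarrow> nat) \<Rightarrow> (nat \<times> nat) set \<Rightarrow> bool" where
  "embeds_below k b col H \<longleftrightarrow>
     (\<forall>a x. (a, x) \<in> set pl \<and> x < b \<longrightarrow> col (a, x) \<in> {1..k}) \<and>
     (\<forall>a x c y. (a, x) \<in> set pl \<and> (c, y) \<in> set pl \<and> a < c \<and> c < x \<and> x < y \<and> y < b \<longrightarrow>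
        col (a, x) \<noteq> col (c, y)) \<and>
     (\<forall>a x w. (a, x) \<in> set pl \<and> x < b \<and> w \<in> set (row b) \<and> a < w \<and> w < x \<longrightarrow>
        (w, col (a, x) - 1) \<in> H)"

lemma embeds_below_start: "embeds_below k 1 col H"
  unfolding embeds_below_def using pl_range by fastforce

lemma embeds_below_end: "embeds_below k (Suc n) col H \<Longrightarrow> embeds k col"
  unfolding embeds_below_def embeds_def using pl_range by (auto simp: less_Suc_eq_le)

lemma embeds_below_step:
  assumes eb: "embeds_below k b col H" and D: "D \<subseteq> set (row b) \<times> {..<k}"
    and adm: "admissible b H D"
    and old: "\<And>a x. (a, x) \<in> set pl \<Longrightarrow> x < b \<Longrightarrow> col' (a, x) = col (a, x)"
    and new: "\<And>a. (a, b) \<in> set pl \<Longrightarrow> \<exists>q. col' (a, b) = Suc q \<and> (a, q) \<in> D"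
  shows "embeds_below k (Suc b) col' (next_state b H D)"
proof -
  have pages: "\<And>a x. (a, x) \<in> set pl \<Longrightarrow> x < b \<Longrightarrow> col (a, x) \<in> {1..k}"
    and ncross: "\<And>a x c y. (a, x) \<in> set pl \<Longrightarrow> (c, y) \<in> set pl \<Longrightarrow> a < c \<Longrightarrow> c < x \<Longrightarrow> x < y \<Longrightarrow>
      y < b \<Longrightarrow> col (a, x) \<noteq> col (c, y)"
    and hid: "\<And>a x w. (a, x) \<in> set pl \<Longrightarrow> x < b \<Longrightarrow> w \<in> set (row b) \<Longrightarrow> a < w \<Longrightarrow> w < x \<Longrightarrow>
      (w, col (a, x) - 1) \<in> H"
    using eb unfolding embeds_below_def by blast+
  show ?thesis
    unfolding embeds_below_def
  proof (intro conjI allI impI; elim conjE)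
    fix a x assume e: "(a, x) \<in> set pl" "x < Suc b"
    show "col' (a, x) \<in> {1..k}"
    proof (cases "x = b")
      case True
      with new e(1) D show ?thesis by fastforce
    qed (use e old pages in auto)
  next
    fix a x c y
    assume e: "(a, x) \<in> set pl" "(c, y) \<in> set pl" "a < c" "c < x" "x < y" "y < Suc b"
    show "col' (a, x) \<noteq> col' (c, y)"
    proof (cases "y = b")
      case True
      with new e(2) obtain q where q: "col' (c, y) = Suc q" "(c, q) \<in> D" by blast
      \<comment> \<open>The earlier edge passes over \<open>c\<close>, so its page is closed there
        and cannot be the one offered to the edge from \<open>c\<close> to \<open>b\<close>.\<close>
      have "(c, col (a, x) - 1) \<in> H" using hid e True edge_in_row by simp
      with q(2) adm have "col (a, x) \<noteq> Suc q" unfolding admissible_def by auto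
      with q(1) old e True show ?thesis by simp
    qed (use e old ncross in auto)
  next
    fix a x w
    assume e: "(a, x) \<in> set pl" "x < Suc b" "w \<in> set (row (Suc b))" "a < w" "w < x"
    have w: "w \<in> set (row b)" "w \<noteq> b" using e by (auto simp: set_row)
    show "(w, col' (a, x) - 1) \<in> next_state b H D"
    proof (cases "x = b")
      case True
      with new e(1) obtain q where "col' (a, x) = Suc q" "(a, q) \<in> D" by blast
      with e w show ?thesis unfolding next_state_def by auto
    next
      case False
      then have "(w, col' (a, x) - 1) \<in> H" using e w hid old by simp
      with e w show ?thesis unfolding next_state_def by auto
    qed
  qed
qed

end

section \<open>One transition\<close>

text \<open>Symbolic execution of the loop body, done once. Only the two cells of \<open>hf\<close>
  that are read need to be known.\<close>

lemma scan_bit_result: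
  fixes s :: mem
  defines "s' \<equiv> result scan_bit s"
  assumes hf: "s ''hf'' (s ''cr'' 0) = s ''cr'' 0 div 2" "s ''hf'' (s ''dr'' 0) = s ''dr'' 0 div 2"
  defines "keep \<equiv> s ''b'' 0 < s ''last'' (s ''G'' (s ''mul'' (s ''b'' 0) + s ''s'' 0))"
  shows "s' ''cr'' 0 = s ''cr'' 0 div 2" "s' ''dr'' 0 = s ''dr'' 0 div 2"
    "s' ''bad'' 0 = s ''bad'' 0 + (s ''cr'' 0 mod 2 + s ''dr'' 0 mod 2 - 1)"
    "s' ''got'' = (if odd (s ''dr'' 0) then (s ''got'')(s ''s'' 0 := Suc (s ''q'' 0)) else s ''got'')"
    "s' ''cn'' 0 = (if keep \<and> (odd (s ''cr'' 0) \<or> 0 < s ''seen'' 0) then s ''cn'' 0 + s ''w'' 0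
       else s ''cn'' 0)"
    "s' ''w'' 0 = (if keep then 2 * s ''w'' 0 else s ''w'' 0)"
    "s' ''seen'' 0 = s ''seen'' 0 + s ''dr'' 0 mod 2"
    "s' ''s'' 0 = Suc (s ''s'' 0)" "s' ''q'' = s ''q''"
proof -
  have m: "x - (x div 2 + x div 2) = x mod 2" for x :: nat
    by (metis minus_mod_eq_mult_div diff_diff_cancel mod_less_eq_dividend mult_2)
  show "s' ''cr'' 0 = s ''cr'' 0 div 2" "s' ''dr'' 0 = s ''dr'' 0 div 2"
    "s' ''bad'' 0 = s ''bad'' 0 + (s ''cr'' 0 mod 2 + s ''dr'' 0 mod 2 - 1)"
    "s' ''got'' = (if odd (s ''dr'' 0) then (s ''got'')(s ''s'' 0 := Suc (s ''q'' 0)) else s ''got'')"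
    "s' ''cn'' 0 = (if keep \<and> (odd (s ''cr'' 0) \<or> 0 < s ''seen'' 0) then s ''cn'' 0 + s ''w'' 0
       else s ''cn'' 0)"
    "s' ''w'' 0 = (if keep then 2 * s ''w'' 0 else s ''w'' 0)"
    "s' ''seen'' 0 = s ''seen'' 0 + s ''dr'' 0 mod 2"
    "s' ''s'' 0 = Suc (s ''s'' 0)" "s' ''q'' = s ''q''"
    unfolding s'_def keep_def scan_bit_def
    by (simp_all add: hf m odd_iff_mod_2_eq_one mod2_gr_0)
qed

lemma scan_bit_simps:
  "loop_free scan_bit" "cost scan_bit \<le> 200"
  "writes scan_bit = {''cb'', ''cr'', ''db'', ''dr'', ''bad'', ''got'', ''cn'', ''w'', ''seen'', ''s''}"
  unfolding scan_bit_def by auto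


text \<open>Page blocks have equal length, so the bit of guard \<open>j\<close> on page
  \<open>q\<close> is found at index \<open>q * l + j\<close>.\<close>

lemma nth_concat_uniform:
  assumes "\<And>q. q < k \<Longrightarrow> length (f q) = l"
  shows "length (concat (map f [0..<k])) = k * l \<and>
    (\<forall>q<k. \<forall>j<l. concat (map f [0..<k]) ! (q * l + j) = f q ! j)"
  using assms
proof (induction k)
  case (Suc k)
  then have IH: "length (concat (map f [0..<k])) = k * l"
    "\<And>q j. q < k \<Longrightarrow> j < l \<Longrightarrow> concat (map f [0..<k]) ! (q * l + j) = f q ! j"
    by auto
  have "q * l + j < k * l" if "q < k" "j < l" for q j
  proof -
    have "q * l + j < Suc q * l" using that by simp
    also have "\<dots> \<le> k * l" using that by (intro mult_right_mono) auto
    finally show ?thesis .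
  qed
  then show ?case using IH Suc.prems by (auto simp: nth_append less_Suc_eq)
qed simp

text \<open>Uniqueness of quotient and remainder. It separates bit positions within a code as well
  as addresses within a matrix.\<close>

lemma block_index_eq:
  fixes q q' l i j :: nat
  assumes "q' * l + i = q * l + j" "i < l" "j < l"
  shows "i = j \<and> q' = q"
proof -
  have "(i + q' * l) mod l = (j + q * l) mod l" using assms(1) by (simp add: add.commute)
  with assms show ?thesis by auto
qed

text \<open>Selects indices instead of elements, so that the bits belonging to the selected guards
  can be picked along with them.\<close>

lemma filter_conv_nth: "filter P xs = map ((!) xs) (filter (\<lambda>j. P (xs ! j)) [0..<length xs])"
proof -
  have "filter P xs = filter P (map ((!) xs) [0..<length xs])" by (simp add: map_nth)
  then show ?thesis by (simp add: filter_map comp_def)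
qed

definition static_vars :: "string set" where
  "static_vars = {''n'', ''K'', ''mul'', ''last'', ''len'', ''G'', ''adj''}"

context ordered_graph
begin

text \<open>Everything that preprocessing leaves behind and that the later phases only read; it
  survives any code that avoids \<open>static_vars\<close>.\<close>

definition static :: "mem \<Rightarrow> bool" where
  "static s \<longleftrightarrow>
    s ''n'' 0 = n \<and> s ''K'' 0 = width \<and>
    (\<forall>b\<le>n. s ''mul'' b = b * Suc n) \<and>
    (\<forall>a. s ''last'' a = last_nb a) \<and>
    (\<forall>b\<in>{1..Suc n}. s ''len'' b = length (row b)) \<and>
    (\<forall>b\<in>{1..n}. \<forall>j<length (row b). s ''G'' (b * Suc n + j) = row b ! j) \<and>
    (\<forall>i<length pl. s ''adj'' (snd (pl ! i) * Suc n + fst (pl ! i)) = Suc i) \<and>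
    (\<forall>a\<le>n. \<forall>b\<le>n. (a, b) \<notin> set pl \<longrightarrow> s ''adj'' (b * Suc n + a) = 0)"

lemma static_agree:
  assumes "static s" "agree W s s'" "W \<inter> static_vars = {}"
  shows "static s'"
proof -
  have "s' x = s x" if "x \<in> static_vars" for x
    using assms(2,3) that unfolding agree_def by blast
  then have "s' ''n'' = s ''n''" "s' ''K'' = s ''K''" "s' ''mul'' = s ''mul''" "s' ''last'' = s ''last''"
    "s' ''len'' = s ''len''" "s' ''G'' = s ''G''" "s' ''adj'' = s ''adj''"
    by (simp_all add: static_vars_def)
  with assms(1) show ?thesis by (simp add: static_def)
qed

lemma staticD:
  assumes "static s"
  shows "s ''n'' 0 = n" "s ''K'' 0 = width" "b \<le> n \<Longrightarrow> s ''mul'' b = b * Suc n"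
    "s ''last'' a = last_nb a" "1 \<le> b \<Longrightarrow> b \<le> Suc n \<Longrightarrow> s ''len'' b = length (row b)"
    "1 \<le> b \<Longrightarrow> b \<le> n \<Longrightarrow> j < length (row b) \<Longrightarrow> s ''G'' (b * Suc n + j) = row b ! j"
    "i < length pl \<Longrightarrow> pl ! i = (a, b) \<Longrightarrow> s ''adj'' (b * Suc n + a) = Suc i"
    "a \<le> n \<Longrightarrow> b \<le> n \<Longrightarrow> (a, b) \<notin> set pl \<Longrightarrow> s ''adj'' (b * Suc n + a) = 0"
proof -
  show "s ''adj'' (b * Suc n + a) = Suc i" if "i < length pl" "pl ! i = (a, b)"
    using assms[unfolded static_def, THEN conjunct2, THEN conjunct2, THEN conjunct2, THEN conjunct2,
      THEN conjunct2, THEN conjunct2, THEN conjunct1, rule_format, OF that(1)] that(2) by simp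
qed (use assms in \<open>simp_all add: static_def\<close>)

lemma adj_pos_iff:
  assumes "static s" "a \<le> n" "b \<le> n"
  shows "0 < s ''adj'' (b * Suc n + a) \<longleftrightarrow> (a, b) \<in> set pl"
proof (cases "(a, b) \<in> set pl")
  case True
  then obtain i where "i < length pl" "pl ! i = (a, b)" by (auto simp: in_set_conv_nth)
  with True staticD(7)[OF assms(1)] show ?thesis by simp
next
  case False
  with staticD(8)[OF assms] show ?thesis by simp
qed

section \<open>Codes of states and the bits of the next code\<close>

text \<open>The set coded by the number \<open>c\<close>: bit \<open>q * length (row b) + j\<close> stands for the \<open>j\<close>-th guard on page \<open>q\<close>.\<close>

definition coded :: "nat \<Rightarrow> nat \<Rightarrow> nat \<Rightarrow> (nat \<times> nat) set" where
  "coded k b c = {(row b ! j, q) | j q. j < length (row b) \<and> q < k \<and> bit c (q * length (row b) + j)}"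

lemma mem_coded:
  "j < length (row b) \<Longrightarrow> (row b ! j, q) \<in> coded k b c \<longleftrightarrow> q < k \<and> bit c (q * length (row b) + j)"
  unfolding coded_def using nth_eq_iff_index_eq[OF distinct_row] by auto

lemma coded_subset: "coded k b c \<subseteq> set (row b) \<times> {..<k}"
  unfolding coded_def by auto

text \<open>Rows are increasing, so the condition \<open>a < w\<close> of \<open>next_state\<close>
  becomes \<open>i < j\<close> on indices. The bit is defined also for guards about to retire;
  \<open>kept\<close> leaves those out.\<close>

definition new_bit :: "nat \<Rightarrow> nat \<Rightarrow> nat \<Rightarrow> nat \<Rightarrow> nat \<Rightarrow> bool" where
  "new_bit b c d q j \<longleftrightarrow>
     bit c (q * length (row b) + j) \<or> (\<exists>i<j. bit d (q * length (row b) + i))"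

definition kept :: "nat \<Rightarrow> nat \<Rightarrow> nat list" where
  "kept b j = filter (\<lambda>i. b < last_nb (row b ! i)) [0..<j]"

text \<open>The contribution of page \<open>q\<close> to the next code; the final
  \<open>False\<close> belongs to the newcomer \<open>b\<close>.\<close>

definition block :: "nat \<Rightarrow> nat \<Rightarrow> nat \<Rightarrow> nat \<Rightarrow> bool list" where
  "block b c d q = map (new_bit b c d q) (kept b (length (row b))) @
     (if b < last_nb b then [False] else [])"

text \<open>The bits emitted once \<open>q\<close> whole pages and \<open>j\<close> guards of the
  page after them have been scanned.\<close>

definition prefix_bits :: "nat \<Rightarrow> nat \<Rightarrow> nat \<Rightarrow> nat \<Rightarrow> nat \<Rightarrow> bool list" where
  "prefix_bits b c d q j = concat (map (block b c d) [0..<q]) @ map (new_bit b c d q) (kept b j)"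

lemma row_Suc_kept:
  "1 \<le> b \<Longrightarrow> row (Suc b) = map ((!) (row b)) (kept b (length (row b))) @ (if b < last_nb b then [b] else [])"
  unfolding row_Suc kept_def by (subst filter_conv_nth) simp

lemma length_block: "1 \<le> b \<Longrightarrow> length (block b c d q) = length (row (Suc b))"
  unfolding block_def by (simp add: row_Suc_kept)

text \<open>The bits come out in the order that \<open>coded\<close> expects for the next row,
  because \<open>row (Suc b)\<close> and every block are built from the same list of kept indices,
  with one entry appended for \<open>b\<close>.\<close>

lemma coded_new_code:
  fixes b c d k :: nat
  assumes b: "1 \<le> b"
  defines "xs \<equiv> concat (map (block b c d) [0..<k])"
  shows "coded k (Suc b) (horner_sum of_bool 2 xs) = next_state b (coded k b c) (coded k b d)"
proof -
  let ?l = "length (row (Suc b))"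
  have len: "length xs = k * ?l"
    and nth: "\<And>q j. q < k \<Longrightarrow> j < ?l \<Longrightarrow> xs ! (q * ?l + j) = block b c d q ! j"
    unfolding xs_def using nth_concat_uniform[of k "block b c d" ?l] length_block[OF b] by auto
  have idx: "q * ?l + j < length xs" if "q < k" "j < ?l" for q j
  proof -
    have "q * ?l + j < Suc q * ?l" using that by simp
    also have "\<dots> \<le> k * ?l" using that by (intro mult_right_mono) auto
    finally show ?thesis using len by simp
  qed
  have nb: "w \<in> set (row (Suc b)) \<and> w \<noteq> b \<longleftrightarrow> (\<exists>j \<in> set (kept b (length (row b))). w = row b ! j)" for w
  proof -
    have "row b ! j \<noteq> b" if "j < length (row b)" for j
      using nth_mem[OF that] by (auto simp: set_row)
    then show ?thesis unfolding row_Suc_kept[OF b] by (auto simp: kept_def)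
  qed
  have "(w, q) \<in> coded k (Suc b) (horner_sum of_bool 2 xs) \<longleftrightarrow>
      (w, q) \<in> next_state b (coded k b c) (coded k b d)" for w q
  proof -
    have "(w, q) \<in> coded k (Suc b) (horner_sum of_bool 2 xs) \<longleftrightarrow>
        q < k \<and> (\<exists>j<?l. w = row (Suc b) ! j \<and> block b c d q ! j)"
      unfolding coded_def by (auto simp: bit_horner_sum_bit_iff idx nth)
    \<comment> \<open>Zipping guards with bits lets both lists be split at once by
      \<open>row_Suc_kept\<close>; the pair of \<open>b\<close> and \<open>False\<close> then
      disappears.\<close>
    also have "\<dots> \<longleftrightarrow> q < k \<and> (w, True) \<in> set (zip (row (Suc b)) (block b c d q))"
      using length_block[OF b] by (auto simp: in_set_zip)
    also have "\<dots> \<longleftrightarrow> q < k \<and> (\<exists>j\<in>set (kept b (length (row b))). w = row b ! j \<and> new_bit b c d q j)"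
      unfolding row_Suc_kept[OF b] block_def by (auto simp: zip_map_map zip_same_conv_map)
    also have "\<dots> \<longleftrightarrow> w \<in> set (row (Suc b)) \<and> w \<noteq> b \<and>
        ((w, q) \<in> coded k b c \<or> (\<exists>a<w. (a, q) \<in> coded k b d))"
    proof -
      have "(q < k \<and> new_bit b c d q j) \<longleftrightarrow>
          ((row b ! j, q) \<in> coded k b c \<or> (\<exists>a<row b ! j. (a, q) \<in> coded k b d))"
        if j: "j \<in> set (kept b (length (row b)))" for j
      proof -
        have jl: "j < length (row b)" using j by (simp add: kept_def)
        have "(\<exists>a<row b ! j. (a, q) \<in> coded k b d) \<longleftrightarrow>
            (\<exists>i<length (row b). row b ! i < row b ! j \<and> q < k \<and> bit d (q * length (row b) + i))"
          unfolding coded_def by auto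
        also have "\<dots> \<longleftrightarrow> (\<exists>i<j. q < k \<and> bit d (q * length (row b) + i))"
          using row_nth_less_iff[OF _ jl] less_trans[OF _ jl] by blast
        finally show ?thesis unfolding mem_coded[OF jl] new_bit_def by auto
      qed
      then show ?thesis using nb[of w] by auto
    qed
    finally show ?thesis unfolding next_state_def by simp
  qed
  then show ?thesis by auto
qed

lemma new_code_less:
  assumes "1 \<le> b"
  shows "horner_sum of_bool 2 (concat (map (block b c d) [0..<k])) < (2 :: nat) ^ (k * length (row (Suc b)))"
  using horner_sum_of_bool_2_less[of "concat (map (block b c d) [0..<k])", where 'a = nat]
    nth_concat_uniform[of k "block b c d" "length (row (Suc b))"] length_block[OF assms] by simp


text \<open>Describes a cell \<open>g\<close> of \<open>got\<close> after \<open>N\<close> bits of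
  \<open>d\<close>: 0 stands for no offer so far, any other value is 1 plus an offered page. Which
  of several offers is recorded is left open.\<close>

definition offered :: "nat \<Rightarrow> nat \<Rightarrow> nat \<Rightarrow> nat \<Rightarrow> nat \<Rightarrow> nat \<Rightarrow> bool" where
  "offered k b d N j g \<longleftrightarrow>
     (g = 0 \<longrightarrow> (\<forall>q. q * length (row b) + j < N \<longrightarrow> \<not> bit d (q * length (row b) + j))) \<and>
     (\<forall>q. g = Suc q \<longrightarrow> q < k \<and> bit d (q * length (row b) + j))"

definition scanned :: "nat \<Rightarrow> nat \<Rightarrow> nat \<Rightarrow> nat \<Rightarrow> nat \<Rightarrow> bool list \<Rightarrow> mem \<Rightarrow> bool" where
  "scanned k b c d N xs s \<longleftrightarrow>
     s ''cr'' 0 = c div 2 ^ N \<and> s ''dr'' 0 = d div 2 ^ N \<and>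
     (s ''bad'' 0 = 0 \<longleftrightarrow> (\<forall>i<N. \<not> (bit c i \<and> bit d i))) \<and>
     (\<forall>j<length (row b). offered k b d N j (s ''got'' j)) \<and>
     s ''cn'' 0 = horner_sum of_bool 2 xs \<and> s ''w'' 0 = 2 ^ length xs"

definition scan_inv :: "nat \<Rightarrow> nat \<Rightarrow> nat \<Rightarrow> nat \<Rightarrow> nat \<Rightarrow> nat \<Rightarrow> mem \<Rightarrow> bool" where
  "scan_inv k b c d q j s \<longleftrightarrow>
     scanned k b c d (q * length (row b) + j) (prefix_bits b c d q j) s \<and>
     s ''q'' 0 = q \<and> s ''s'' 0 = j \<and>
     (0 < s ''seen'' 0 \<longleftrightarrow> (\<exists>i<j. bit d (q * length (row b) + i)))"

definition ready :: "nat \<Rightarrow> nat \<Rightarrow> nat \<Rightarrow> nat \<Rightarrow> mem \<Rightarrow> bool" where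
  "ready k b c d s \<longleftrightarrow> static s \<and> 1 \<le> b \<and> b \<le> n \<and> s ''b'' 0 = b \<and> s ''k'' 0 = k \<and>
     s ''c'' 0 = c \<and> s ''d'' 0 = d \<and> (\<forall>y\<le>max c d. s ''hf'' y = y div 2)"

lemma ready_agree:
  assumes "ready k b c d s" "agree W s s'"
    "W \<inter> (static_vars \<union> {''b'', ''k'', ''c'', ''d'', ''hf''}) = {}"
  shows "ready k b c d s'"
proof -
  have "static s'" using assms static_agree[of s W s'] unfolding ready_def by blast
  moreover have "s' x = s x" if "x \<in> {''b'', ''k'', ''c'', ''d'', ''hf''}" for x
    using assms(2,3) that unfolding agree_def by blast
  then have "s' ''b'' = s ''b''" "s' ''k'' = s ''k''" "s' ''c'' = s ''c''" "s' ''d'' = s ''d''" "s' ''hf'' = s ''hf''"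
    by simp_all
  ultimately show ?thesis using assms(1) by (simp add: ready_def)
qed

lemma scan_inv_step:
  assumes inv: "scan_inv k b c d q j s" and rd: "ready k b c d s"
    and j: "j < length (row b)" and q: "q < k"
  shows "scan_inv k b c d q (Suc j) (result scan_bit s)"
proof -
  let ?l = "length (row b)"
  let ?N = "q * ?l + j"
  let ?s' = "result scan_bit s"
  have b: "1 \<le> b" "b \<le> n" "s ''b'' 0 = b" "static s" using rd by (auto simp: ready_def)
  have sc: "s ''cr'' 0 = c div 2 ^ ?N" "s ''dr'' 0 = d div 2 ^ ?N"
     "s ''bad'' 0 = 0 \<longleftrightarrow> (\<forall>i<?N. \<not> (bit c i \<and> bit d i))"
     "\<And>i. i < ?l \<Longrightarrow> offered k b d ?N i (s ''got'' i)"
     "s ''cn'' 0 = horner_sum of_bool 2 (prefix_bits b c d q j)" "s ''w'' 0 = 2 ^ length (prefix_bits b c d q j)"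
     "s ''q'' 0 = q" "s ''s'' 0 = j" "0 < s ''seen'' 0 \<longleftrightarrow> (\<exists>i<j. bit d (q * ?l + i))"
    using inv unfolding scan_inv_def scanned_def by auto
  \<comment> \<open>Shifted codes never exceed the original ones, so their halves are
    tabulated.\<close>
  have le: "c div 2 ^ ?N \<le> max c d" "d div 2 ^ ?N \<le> max c d"
    by (meson div_le_dividend le_trans max.cobounded1 max.cobounded2)+
  have hf: "s ''hf'' (s ''cr'' 0) = s ''cr'' 0 div 2" "s ''hf'' (s ''dr'' 0) = s ''dr'' 0 div 2"
    using rd le unfolding ready_def sc by blast+
  note res = scan_bit_result[OF hf]
  have keep: "s ''b'' 0 < s ''last'' (s ''G'' (s ''mul'' (s ''b'' 0) + s ''s'' 0)) \<longleftrightarrow> b < last_nb (row b ! j)"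
    unfolding b(3) sc(8) staticD(3)[OF b(4,2)] staticD(6)[OF b(4,1,2) j] staticD(4)[OF b(4)] ..
  have bits: "odd (s ''cr'' 0) \<longleftrightarrow> bit c ?N" "odd (s ''dr'' 0) \<longleftrightarrow> bit d ?N"
    unfolding sc by (simp_all add: bit_iff_odd)
  have m: "s ''cr'' 0 mod 2 = of_bool (bit c ?N)" "s ''dr'' 0 mod 2 = of_bool (bit d ?N)"
    using bits by (auto simp: odd_iff_mod_2_eq_one)
  have pre: "prefix_bits b c d q (Suc j) = prefix_bits b c d q j @
      (if b < last_nb (row b ! j) then [new_bit b c d q j] else [])"
    unfolding prefix_bits_def kept_def by simp
  have nb: "odd (s ''cr'' 0) \<or> 0 < s ''seen'' 0 \<longleftrightarrow> new_bit b c d q j"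
    unfolding new_bit_def bits sc(9) ..
  have got: "offered k b d (Suc ?N) i (?s' ''got'' i)" if i: "i < ?l" for i
  proof (cases "i = j")
    case True
    show ?thesis
    proof (cases "bit d ?N")
      case True
      then have "?s' ''got'' i = Suc q" using \<open>i = j\<close> unfolding res(4) bits sc(7,8) by simp
      then show ?thesis using True q \<open>i = j\<close> by (simp add: offered_def)
    next
      case False
      then have "?s' ''got'' i = s ''got'' i" unfolding res(4) bits by simp
      then show ?thesis using False sc(4)[OF i] \<open>i = j\<close> by (auto simp: offered_def less_Suc_eq)
    qed
  next
    case False
    then have "?s' ''got'' i = s ''got'' i" unfolding res(4) sc by simp
    \<comment> \<open>Bit \<open>?N\<close> belongs to guard \<open>j\<close>; for any other guard
      nothing new has been scanned.\<close>
    then show ?thesis using sc(4)[OF i] False block_index_eq[OF _ i j]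
      by (auto simp: offered_def less_Suc_eq)
  qed
  have "scanned k b c d (Suc ?N) (prefix_bits b c d q (Suc j)) ?s'"
    unfolding scanned_def
  proof (intro conjI allI impI)
    show "?s' ''cr'' 0 = c div 2 ^ Suc ?N" "?s' ''dr'' 0 = d div 2 ^ Suc ?N"
      by (simp_all only: res sc power_Suc2 div_mult2_eq)
    show "?s' ''bad'' 0 = 0 \<longleftrightarrow> (\<forall>i<Suc ?N. \<not> (bit c i \<and> bit d i))"
      using sc(3) unfolding res m by (auto simp: less_Suc_eq)
    show "?s' ''cn'' 0 = horner_sum of_bool 2 (prefix_bits b c d q (Suc j))"
      unfolding res keep nb sc(5,6) pre by (simp add: horner_sum_append)
    show "?s' ''w'' 0 = 2 ^ length (prefix_bits b c d q (Suc j))"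
      unfolding res keep sc(6) pre by simp
  qed (use got in blast)
  moreover have "0 < ?s' ''seen'' 0 \<longleftrightarrow> (\<exists>i<Suc j. bit d (q * ?l + i))"
    unfolding res m using sc(9) by (auto simp: less_Suc_eq)
  ultimately show ?thesis unfolding scan_inv_def using res(8,9) sc by simp
qed

lemma runs_scan_page:
  assumes sc: "scanned k b c d (q * length (row b)) (concat (map (block b c d) [0..<q])) s"
    and q: "q < k" "s ''q'' 0 = q" and rd: "ready k b c d s"
  shows "runs scan_page s (300 * (width + 1))
    (\<lambda>s'. scanned k b c d (Suc q * length (row b)) (concat (map (block b c d) [0..<Suc q])) s' \<and>
       s' ''q'' 0 = Suc q)"
proof -
  let ?l = "length (row b)"
  have b: "1 \<le> b" "b \<le> n" using rd by (auto simp: ready_def)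
  define s1 where "s1 = result (''seen'' :=\<^sub>r Const 0 ;; ''s'' :=\<^sub>r Const 0) s"
  have s1: "agree {''seen'', ''s''} s s1" unfolding s1_def agree_def by simp
  have rd1: "ready k b c d s1" by (rule ready_agree[OF rd s1]) (simp add: static_vars_def)
  have inv1: "scan_inv k b c d q 0 s1"
    using sc q unfolding scan_inv_def scanned_def s1_def by (simp add: prefix_bits_def kept_def)
  have rd': "ready k b c d s'" if "agree (writes scan_bit) s1 s'" for s'
    by (rule ready_agree[OF rd1 that]) (simp add: scan_bit_simps static_vars_def)
  have bv: "bval (Less (reg ''s'') (Load ''len'' (reg ''b''))) s' \<longleftrightarrow> j < ?l"
    if "scan_inv k b c d q j s'" "agree (writes scan_bit) s1 s'" for j s'
    using rd'[OF that(2)] that(1) b unfolding scan_inv_def ready_def by (auto simp: staticD(5))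
  have "runs (While (Less (reg ''s'') (Load ''len'' (reg ''b''))) scan_bit) s1 (220 * width + 8)
      (\<lambda>s'. scan_inv k b c d q ?l s' \<and> agree (writes scan_bit) s1 s')"
  proof (rule runs_While_agree[where T = 200 and N = ?l and I = "scan_inv k b c d q"])
    fix j s' assume j: "j < ?l" and s': "scan_inv k b c d q j s'" "agree (writes scan_bit) s1 s'"
    have "runs scan_bit s' 200 (scan_inv k b c d q (Suc j))"
      using scan_inv_step[OF s'(1) rd'[OF s'(2)] j q(1)] scan_bit_simps by (intro runs_loop_free)
    then show "bval (Less (reg ''s'') (Load ''len'' (reg ''b''))) s' \<and>
        runs scan_bit s' 200 (scan_inv k b c d q (Suc j))"
      using bv[OF s'] j by blast
  next
    fix s' assume "scan_inv k b c d q ?l s'" "agree (writes scan_bit) s1 s'"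
    from bv[OF this] show "\<not> bval (Less (reg ''s'') (Load ''len'' (reg ''b''))) s'" by blast
  qed (use inv1 length_row_le_width[of b] b in auto)
  note loop = this
  have "runs scan_page s (6 + ((220 * width + 8) + 30))
    (\<lambda>s'. scanned k b c d (Suc q * ?l) (concat (map (block b c d) [0..<Suc q])) s' \<and> s' ''q'' 0 = Suc q)"
    unfolding scan_page_def
  proof (rule runs_Seq[where R = "\<lambda>s'. s' = s1"], goal_cases)
    case 1
    then show ?case by (intro runs_loop_free) (simp_all add: s1_def)
  next
    case (2 s')
    show ?case
    proof (rule runs_Seq)
      show "runs (While (Less (reg ''s'') (Load ''len'' (reg ''b''))) scan_bit) s' (220 * width + 8)
          (\<lambda>s'. scan_inv k b c d q ?l s' \<and> agree (writes scan_bit) s1 s')"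
        using 2 loop by simp
    next
      fix s2 assume s2: "scan_inv k b c d q ?l s2 \<and> agree (writes scan_bit) s1 s2"
      have st: "static s2" "s2 ''b'' 0 = b" using rd'[of s2] s2 by (auto simp: ready_def)
      have bl: "concat (map (block b c d) [0..<Suc q]) =
          prefix_bits b c d q ?l @ (if b < last_nb b then [False] else [])"
        by (simp add: prefix_bits_def block_def)
      show "runs (Cond (Less (reg ''b'') (Load ''last'' (reg ''b'')))
          (''w'' :=\<^sub>r Add (reg ''w'') (reg ''w'')) Skip ;; incr ''q'') s2 30
        (\<lambda>s'. scanned k b c d (Suc q * ?l) (concat (map (block b c d) [0..<Suc q])) s' \<and> s' ''q'' 0 = Suc q)"
        using s2 st unfolding scan_inv_def scanned_def bl
        by (intro runs_loop_free) (auto simp: staticD(4) horner_sum_append add.commute)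
    qed
  qed
  then show ?thesis by (rule runs_mono) auto
qed

lemma runs_clear_pages:
  assumes "static s" "1 \<le> b" "b \<le> n" "s ''b'' 0 = b"
  shows "runs clear_pages s (30 * (width + 1)) (\<lambda>s'. \<forall>j<length (row b). s' ''got'' j = 0)"
proof -
  let ?l = "length (row b)" and ?p = "''got''[reg ''s'']\<^sub>r :=\<^sub>r Const 0 ;; incr ''s''"
  let ?I = "\<lambda>j s'. s' ''s'' 0 = j \<and> (\<forall>i<j. s' ''got'' i = 0)"
  have len: "?l \<le> width" using length_row_le_width assms by simp
  have "runs (''s'' :=\<^sub>r Const 0) s 3 (\<lambda>s'. s' = s(''s'' := (s ''s'')(0 := 0)))"
    by (intro runs_loop_free) simp_all
  then have "runs clear_pages s (3 + (20 * width + 10)) (\<lambda>s'. \<forall>j<?l. s' ''got'' j = 0)"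
    unfolding clear_pages_def
  proof (rule runs_Seq)
    fix s1 assume s1: "s1 = s(''s'' := (s ''s'')(0 := 0))"
    have "runs (While (Less (reg ''s'') (Load ''len'' (reg ''b''))) ?p) s1 (20 * width + 10)
      (\<lambda>s'. ?I ?l s' \<and> agree (writes ?p) s1 s')"
    proof (rule runs_While_agree[where T = 10 and N = ?l and I = ?I])
      fix j s' assume j: "j < ?l" "?I j s'" "agree (writes ?p) s1 s'"
      have "s' ''b'' = s ''b''" "s' ''len'' = s ''len''" using agreeD[OF j(3)] by (simp_all add: s1)
      then have "bval (Less (reg ''s'') (Load ''len'' (reg ''b''))) s'"
        using j assms by (simp add: staticD(5))
      moreover have "runs ?p s' 10 (?I (Suc j))"
        using j(2) by (intro runs_loop_free) (auto simp: less_Suc_eq)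
      ultimately show "bval (Less (reg ''s'') (Load ''len'' (reg ''b''))) s' \<and> runs ?p s' 10 (?I (Suc j))" ..
    next
      fix s' assume j: "?I ?l s'" "agree (writes ?p) s1 s'"
      have "s' ''b'' = s ''b''" "s' ''len'' = s ''len''" using agreeD[OF j(2)] by (simp_all add: s1)
      then show "\<not> bval (Less (reg ''s'') (Load ''len'' (reg ''b''))) s'"
        using j assms by (simp add: staticD(5))
    qed (use len in \<open>auto simp: s1\<close>)
    then show "runs (While (Less (reg ''s'') (Load ''len'' (reg ''b''))) ?p) s1 (20 * width + 10)
       (\<lambda>s'. \<forall>j<?l. s' ''got'' j = 0)"
      by (rule runs_mono) auto
  qed
  then show ?thesis by (rule runs_mono) auto
qed


lemma runs_check_pages:
  assumes st: "static s" "1 \<le> b" "b \<le> n" "s ''b'' 0 = b"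
  shows "runs check_pages s (60 * (width + 1))
    (\<lambda>s'. s' ''bad'' 0 = 0 \<longleftrightarrow>
       s ''bad'' 0 = 0 \<and> (\<forall>j<length (row b). (row b ! j, b) \<in> set pl \<longrightarrow> s ''got'' j \<noteq> 0))"
proof -
  let ?l = "length (row b)"
  let ?p = "pos_if (Load ''adj'' (Add (Load ''mul'' (reg ''b'')) (Load ''G'' guard_addr)))
         (Cond (Less (Load ''got'' (reg ''s'')) (Const 1)) (incr ''bad'') Skip) ;;
       incr ''s''"
  let ?b = "Less (reg ''s'') (Load ''len'' (reg ''b''))"
  let ?I = "\<lambda>j s'. s' ''s'' 0 = j \<and> (s' ''bad'' 0 = 0 \<longleftrightarrow>
       s ''bad'' 0 = 0 \<and> (\<forall>i<j. (row b ! i, b) \<in> set pl \<longrightarrow> s ''got'' i \<noteq> 0))"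
  have len: "?l \<le> width" using length_row_le_width st by simp
  have "runs check_pages s (3 + (50 * width + 10)) (?I ?l)"
    unfolding check_pages_def
  proof (rule runs_Seq)
    show "runs (''s'' :=\<^sub>r Const 0) s 3 (\<lambda>s'. s' = s(''s'' := (s ''s'')(0 := 0)))"
      by (intro runs_loop_free) simp_all
  next
    fix s1 assume s1: "s1 = s(''s'' := (s ''s'')(0 := 0))"
    have fr: "s' ''b'' = s ''b''" "s' ''len'' = s ''len''" "s' ''mul'' = s ''mul''" "s' ''G'' = s ''G''"
      "s' ''adj'' = s ''adj''" "s' ''got'' = s ''got''" if "agree (writes ?p) s1 s'" for s'
      using agreeD[OF that] by (simp_all add: s1)
    have "runs (While ?b ?p) s1 (50 * width + 10) (\<lambda>s'. ?I ?l s' \<and> agree (writes ?p) s1 s')"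
    proof (rule runs_While_agree[where T = 40 and N = ?l and I = ?I])
      fix j s' assume j: "j < ?l" "?I j s'" "agree (writes ?p) s1 s'"
      have "row b ! j \<le> n" using nth_mem[OF j(1)] st by (simp add: set_row)
      then have adj: "0 < s ''adj'' (b * Suc n + row b ! j) \<longleftrightarrow> (row b ! j, b) \<in> set pl"
        using adj_pos_iff[OF st(1) _ st(3)] by blast
      have "bval ?b s'" using j st fr[OF j(3)] by (simp add: staticD(5))
      moreover have "runs ?p s' 40 (?I (Suc j))"
        using j(2) fr[OF j(3)] st j(1) adj staticD(3)[OF st(1,3)] staticD(6)[OF st(1-3) j(1)]
        by (intro runs_loop_free) (auto simp: less_Suc_eq)
      ultimately show "bval ?b s' \<and> runs ?p s' 40 (?I (Suc j))" ..
    next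
      fix s' assume j: "?I ?l s'" "agree (writes ?p) s1 s'"
      show "\<not> bval ?b s'" using j st fr[OF j(2)] by (simp add: staticD(5))
    qed (use len in \<open>auto simp: s1\<close>)
    then show "runs (While ?b ?p) s1 (50 * width + 10) (?I ?l)"
      by (rule runs_mono) auto
  qed
  then show ?thesis by (rule runs_mono) auto
qed

lemma writes_parts:
  "writes scan_page = {''seen'', ''s'', ''cb'', ''cr'', ''db'', ''dr'', ''bad'', ''got'', ''cn'', ''w'', ''q''}"
  "writes clear_pages = {''s'', ''got''}" "writes check_pages = {''s'', ''bad''}"
  "writes transition = {''seen'', ''s'', ''cb'', ''cr'', ''db'', ''dr'', ''bad'', ''got'', ''cn'', ''w'', ''q''}"
  unfolding transition_def scan_page_def clear_pages_def check_pages_def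
  by (auto simp: scan_bit_simps)

text \<open>The bound on \<open>cn\<close> keeps the lookup in the next row of \<open>T\<close>
  within the cells that \<open>row_ok\<close> describes.\<close>

definition stepped :: "nat \<Rightarrow> nat \<Rightarrow> nat \<Rightarrow> nat \<Rightarrow> mem \<Rightarrow> bool" where
  "stepped k b c d s \<longleftrightarrow>
     (s ''bad'' 0 = 0 \<longleftrightarrow> admissible b (coded k b c) (coded k b d)) \<and>
     s ''cn'' 0 < 2 ^ (k * length (row (Suc b))) \<and>
     coded k (Suc b) (s ''cn'' 0) = next_state b (coded k b c) (coded k b d) \<and>
     (\<forall>j<length (row b). (s ''got'' j = 0 \<longrightarrow> (\<forall>q. (row b ! j, q) \<notin> coded k b d)) \<and>
        (\<forall>q. s ''got'' j = Suc q \<longrightarrow> (row b ! j, q) \<in> coded k b d))"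

text \<open>By division with remainder, the indices below \<open>k * length (row b)\<close> are
  exactly those of a guard on one of the \<open>k\<close> pages; an empty row has no such index.
  Hence comparing bits is comparing sets.\<close>

lemma coded_disjoint_iff:
  "coded k b c \<inter> coded k b d = {} \<longleftrightarrow> (\<forall>i<k * length (row b). \<not> (bit c i \<and> bit d i))"
proof
  let ?l = "length (row b)"
  assume dis: "coded k b c \<inter> coded k b d = {}"
  show "\<forall>i<k * ?l. \<not> (bit c i \<and> bit d i)"
  proof (intro allI impI notI)
    fix i assume i: "i < k * ?l" "bit c i \<and> bit d i"
    then have l: "0 < ?l" by (cases ?l) auto
    have "i div ?l < k" using i(1) l by (simp add: less_mult_imp_div_less)
    then have "(row b ! (i mod ?l), i div ?l) \<in> coded k b c \<inter> coded k b d"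
      using i(2) l by (simp add: mem_coded)
    with dis show False by blast
  qed
next
  let ?l = "length (row b)"
  assume nb: "\<forall>i<k * ?l. \<not> (bit c i \<and> bit d i)"
  have "q * ?l + j < k * ?l" if "q < k" "j < ?l" for q j
  proof -
    have "q * ?l + j < Suc q * ?l" using that by simp
    also have "\<dots> \<le> k * ?l" using that by (intro mult_right_mono) auto
    finally show ?thesis .
  qed
  then show "coded k b c \<inter> coded k b d = {}"
    using nb mem_coded unfolding coded_def[of k b c] by fastforce
qed

lemma runs_transition:
  assumes rd: "ready k b c d s"
  shows "runs transition s (500 * (width + 1) * (k + 1)) (stepped k b c d)"
proof -
  let ?l = "length (row b)"
  have st: "static s" "1 \<le> b" "b \<le> n" "s ''b'' 0 = b" using rd by (auto simp: ready_def)
  let ?xs = "\<lambda>q. concat (map (block b c d) [0..<q])"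
  let ?I = "\<lambda>q s'. scanned k b c d (q * ?l) (?xs q) s' \<and> s' ''q'' 0 = q"
  let ?b = "Less (reg ''q'') (reg ''k'')"
  let ?init = "''cr'' :=\<^sub>r reg ''c'' ;; ''dr'' :=\<^sub>r reg ''d'' ;; ''bad'' :=\<^sub>r Const 0 ;;
     ''cn'' :=\<^sub>r Const 0 ;; ''w'' :=\<^sub>r Const 1 ;; ''q'' :=\<^sub>r Const 0"
  have "runs transition s (30 * (width + 1) +
      (20 + ((6 + k * (6 + 300 * (width + 1))) + 60 * (width + 1)))) (stepped k b c d)"
    unfolding transition_def
  proof (rule runs_Seq[OF runs_agree[OF runs_clear_pages[OF st]]], elim conjE)
    fix s1 assume got: "\<forall>j<?l. s1 ''got'' j = 0" and "agree (writes clear_pages) s s1"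
    then have rd1: "ready k b c d s1" using ready_agree[OF rd, of _ s1] by (simp add: writes_parts static_vars_def)
    show "runs (?init ;; While ?b scan_page ;; check_pages) s1
        (20 + ((6 + k * (6 + 300 * (width + 1))) + 60 * (width + 1))) (stepped k b c d)"
    proof (rule runs_Seq[where R = "\<lambda>s2. ready k b c d s2 \<and> ?I 0 s2"])
      have "ready k b c d (result ?init s1)"
        by (rule ready_agree[OF rd1, of "writes ?init"]) (simp_all add: agree_def static_vars_def)
      moreover have "?I 0 (result ?init s1)"
        using rd1 got by (auto simp: scanned_def offered_def ready_def)
      ultimately show "runs ?init s1 20 (\<lambda>s2. ready k b c d s2 \<and> ?I 0 s2)"
        by (intro runs_loop_free) simp_all
    next
      fix s2 assume s2: "ready k b c d s2 \<and> ?I 0 s2"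
      have rd': "ready k b c d s'" if "agree (writes scan_page) s2 s'" for s'
        using ready_agree[OF conjunct1[OF s2] that] by (simp add: writes_parts static_vars_def)
      have "runs (While ?b scan_page) s2 (6 + k * (6 + 300 * (width + 1)))
          (\<lambda>s'. ?I k s' \<and> agree (writes scan_page) s2 s')"
      proof (rule runs_While_agree[where N = k and I = ?I and T = "300 * (width + 1)"])
        fix q s' assume q: "q < k" "?I q s'" "agree (writes scan_page) s2 s'"
        then have "bval ?b s'" using rd'[OF q(3)] by (simp add: ready_def)
        with runs_scan_page[OF _ q(1) _ rd'[OF q(3)]] q(2)
        show "bval ?b s' \<and> runs scan_page s' (300 * (width + 1)) (?I (Suc q))" by blast
      next
        fix s' assume "?I k s'" "agree (writes scan_page) s2 s'"
        then show "\<not> bval ?b s'" using rd'[of s'] by (simp add: ready_def)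
      qed (use s2 in auto)
      then show "runs (While ?b scan_page ;; check_pages) s2
          ((6 + k * (6 + 300 * (width + 1))) + 60 * (width + 1)) (stepped k b c d)"
      proof (rule runs_Seq)
        fix s3 assume s3: "?I k s3 \<and> agree (writes scan_page) s2 s3"
        then have st3: "static s3" "s3 ''b'' 0 = b" using rd'[of s3] by (auto simp: ready_def)
        show "runs check_pages s3 (60 * (width + 1)) (stepped k b c d)"
        proof (rule runs_mono[OF runs_agree[OF runs_check_pages[OF st3(1) st(2,3) st3(2)]]])
          fix s'
          assume s': "(s' ''bad'' 0 = 0 \<longleftrightarrow> s3 ''bad'' 0 = 0 \<and>
              (\<forall>j<?l. (row b ! j, b) \<in> set pl \<longrightarrow> s3 ''got'' j \<noteq> 0)) \<and> agree (writes check_pages) s3 s'"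
          then have eq: "s' ''cn'' = s3 ''cn''" "s' ''got'' = s3 ''got''"
            using agreeD[of "writes check_pages" s3 s'] by (simp_all add: writes_parts)
          have off: "offered k b d (k * ?l) j (s3 ''got'' j)" if "j < ?l" for j
            using s3 that by (simp add: scanned_def)
          have idx: "q * ?l + j < k * ?l" if "q < k" "j < ?l" for q j
          proof -
            have "q * ?l + j < Suc q * ?l" using that by simp
            also have "\<dots> \<le> k * ?l" using that by (intro mult_right_mono) auto
            finally show ?thesis .
          qed
          \<comment> \<open>All bits of pages below \<open>k\<close> have been scanned by now, so a
            zero cell means that there is no offer at all.\<close>
          have got: "(s3 ''got'' j = 0 \<longrightarrow> (\<forall>q. (row b ! j, q) \<notin> coded k b d)) \<and>
            (\<forall>q. s3 ''got'' j = Suc q \<longrightarrow> (row b ! j, q) \<in> coded k b d)" if "j < ?l" for j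
            using off[OF that] idx[OF _ that] unfolding offered_def mem_coded[OF that] by blast
          have "(\<forall>j<?l. (row b ! j, b) \<in> set pl \<longrightarrow> s3 ''got'' j \<noteq> 0) \<longleftrightarrow>
              (\<forall>a. (a, b) \<in> set pl \<longrightarrow> (\<exists>q. (a, q) \<in> coded k b d))"
          proof
            assume *: "\<forall>j<?l. (row b ! j, b) \<in> set pl \<longrightarrow> s3 ''got'' j \<noteq> 0"
            show "\<forall>a. (a, b) \<in> set pl \<longrightarrow> (\<exists>q. (a, q) \<in> coded k b d)"
            proof (intro allI impI)
              fix a assume a: "(a, b) \<in> set pl"
              then obtain j where "j < ?l" "a = row b ! j" using edge_in_row by (metis in_set_conv_nth)
              with * a got[of j] show "\<exists>q. (a, q) \<in> coded k b d" by (metis not0_implies_Suc)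
            qed
          next
            assume *: "\<forall>a. (a, b) \<in> set pl \<longrightarrow> (\<exists>q. (a, q) \<in> coded k b d)"
            then show "\<forall>j<?l. (row b ! j, b) \<in> set pl \<longrightarrow> s3 ''got'' j \<noteq> 0"
              using got by blast
          qed
          moreover have "s3 ''bad'' 0 = 0 \<longleftrightarrow> coded k b c \<inter> coded k b d = {}"
            using s3 by (simp add: scanned_def coded_disjoint_iff)
          ultimately have "s' ''bad'' 0 = 0 \<longleftrightarrow> admissible b (coded k b c) (coded k b d)"
            using s' by (simp add: admissible_def)
          moreover have "s3 ''cn'' 0 = horner_sum of_bool 2 (?xs k)"
            using s3 by (simp add: scanned_def)
          ultimately show "stepped k b c d s'"
            unfolding stepped_def eq using coded_new_code[OF st(2)] new_code_less[OF st(2)] got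
            by simp
        qed simp
      qed
    qed
  qed
  then show ?thesis by (rule runs_mono) (auto simp: algebra_simps)
qed

end

section \<open>The table\<close>

lemma runs_halving_table:
  "runs halving_table s (30 * s ''S'' 0 + 30) (\<lambda>s'. \<forall>y<s ''S'' 0 + 2. s' ''hf'' y = y div 2)"
proof -
  let ?N = "s ''S'' 0" and ?b = "Less (reg ''x'') (reg ''S'')"
  let ?p = "''hf''[Add (reg ''x'') (Const 2)]\<^sub>r :=\<^sub>r Add (Load ''hf'' (reg ''x'')) (Const 1) ;; incr ''x''"
  let ?I = "\<lambda>i s'. s' ''x'' 0 = i \<and> (\<forall>y<i + 2. s' ''hf'' y = y div 2)"
  let ?init = "''hf''[Const 0]\<^sub>r :=\<^sub>r Const 0 ;; ''hf''[Const 1]\<^sub>r :=\<^sub>r Const 0 ;; ''x'' :=\<^sub>r Const 0"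
  have "runs halving_table s (9 + (30 * ?N + 10)) (?I ?N)"
    unfolding halving_table_def
  proof (rule runs_Seq[where R = "\<lambda>s'. s' = result ?init s"])
    show "runs ?init s 9 (\<lambda>s'. s' = result ?init s)" by (intro runs_loop_free) simp_all
  next
    fix s1 assume s1: "s1 = result ?init s"
    have S: "s' ''S'' 0 = ?N" if "agree (writes ?p) s1 s'" for s'
      using agreeD[OF that, of "''S''"] by (simp add: s1)
    have "runs (While ?b ?p) s1 (30 * ?N + 10) (\<lambda>s'. ?I ?N s' \<and> agree (writes ?p) s1 s')"
    proof (rule runs_While_agree[where N = ?N and I = ?I and T = 20])
      fix i s' assume i: "i < ?N" "?I i s'" "agree (writes ?p) s1 s'"
      have "?I (Suc i) (result ?p s')" using i(2) by (auto simp: less_Suc_eq)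
      then have "runs ?p s' 20 (?I (Suc i))" by (intro runs_loop_free, simp, simp)
      with i S[OF i(3)] show "bval ?b s' \<and> runs ?p s' 20 (?I (Suc i))" by simp
    next
      fix s' assume "?I ?N s'" "agree (writes ?p) s1 s'"
      with S[of s'] show "\<not> bval ?b s'" by simp
    qed (auto simp: s1 less_Suc_eq numeral_2_eq_2)
    then show "runs (While ?b ?p) s1 (30 * ?N + 10) (?I ?N)" by (rule runs_mono) auto
  qed
  then show ?thesis by (rule runs_mono) auto
qed

lemma runs_base_table:
  "runs base_table s (30 * s ''n'' 0 + 60) (\<lambda>s'. \<forall>y\<le>Suc (s ''n'' 0). s' ''bs'' y = y * s ''S'' 0)"
proof -
  let ?N = "Suc (s ''n'' 0)" and ?b = "Less (reg ''x'') (Add (reg ''n'') (Const 1))"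
  let ?p = "''bs''[Add (reg ''x'') (Const 1)]\<^sub>r :=\<^sub>r Add (Load ''bs'' (reg ''x'')) (reg ''S'') ;; incr ''x''"
  let ?I = "\<lambda>i s'. s' ''x'' 0 = i \<and> (\<forall>y\<le>i. s' ''bs'' y = y * s ''S'' 0)"
  let ?init = "''bs''[Const 0]\<^sub>r :=\<^sub>r Const 0 ;; ''x'' :=\<^sub>r Const 0"
  have "runs base_table s (6 + (30 * s ''n'' 0 + 40)) (?I ?N)"
    unfolding base_table_def
  proof (rule runs_Seq[where R = "\<lambda>s'. s' = result ?init s"])
    show "runs ?init s 6 (\<lambda>s'. s' = result ?init s)" by (intro runs_loop_free) simp_all
  next
    fix s1 assume s1: "s1 = result ?init s"
    have S: "s' ''S'' = s ''S''" "s' ''n'' = s ''n''" if "agree (writes ?p) s1 s'" for s'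
      using agreeD[OF that, of "''S''"] agreeD[OF that, of "''n''"] by (simp_all add: s1)
    have "runs (While ?b ?p) s1 (30 * s ''n'' 0 + 40) (\<lambda>s'. ?I ?N s' \<and> agree (writes ?p) s1 s')"
    proof (rule runs_While_agree[where N = ?N and I = ?I and T = 20])
      fix i s' assume i: "i < ?N" "?I i s'" "agree (writes ?p) s1 s'"
      have "?I (Suc i) (result ?p s')" using i(2) S[OF i(3)] by (auto simp: le_Suc_eq)
      then have "runs ?p s' 20 (?I (Suc i))" by (intro runs_loop_free, simp, simp)
      with i S[OF i(3)] show "bval ?b s' \<and> runs ?p s' 20 (?I (Suc i))" by simp
    next
      fix s' assume "?I ?N s'" "agree (writes ?p) s1 s'"
      with S[of s'] show "\<not> bval ?b s'" by simp
    qed (auto simp: s1)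
    then show "runs (While ?b ?p) s1 (30 * s ''n'' 0 + 40) (?I ?N)" by (rule runs_mono) auto
  qed
  then show ?thesis by (rule runs_mono) auto
qed

lemma writes_tables:
  "writes halving_table = {''hf'', ''x''}" "writes base_table = {''bs'', ''x''}"
  "writes try_choices = insert ''T'' (insert ''d'' (writes transition))"
  "writes fill_row = insert ''c'' (insert ''T'' (insert ''d'' (writes transition)))"
  "writes fill_table = {''hf'', ''x'', ''bs'', ''b'', ''c'', ''T'', ''d''} \<union> writes transition"
  unfolding halving_table_def base_table_def try_choices_def fill_row_def fill_table_def by auto

context ordered_graph
begin

text \<open>Sized by the largest guard set, so that all rows of \<open>T\<close> have equal length;
  a vertex with fewer guards needs only an initial part of its row.\<close>

definition codes :: "nat \<Rightarrow> nat" where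
  "codes k = 2 ^ (width * k)"

definition tables :: "nat \<Rightarrow> mem \<Rightarrow> bool" where
  "tables k s \<longleftrightarrow> static s \<and> s ''k'' 0 = k \<and> s ''S'' 0 = codes k \<and>
     (\<forall>y<codes k. s ''hf'' y = y div 2) \<and> (\<forall>y\<le>Suc n. s ''bs'' y = y * codes k)"

lemma tables_agree:
  assumes "tables k s" "agree W s s'"
    "W \<inter> (static_vars \<union> {''k'', ''S'', ''hf'', ''bs''}) = {}"
  shows "tables k s'"
proof -
  have "static s'" using assms static_agree[of s W s'] unfolding tables_def by blast
  moreover have "s' x = s x" if "x \<in> {''k'', ''S'', ''hf'', ''bs''}" for x
    using assms(2,3) that unfolding agree_def by blast
  then have "s' ''k'' = s ''k''" "s' ''S'' = s ''S''" "s' ''hf'' = s ''hf''" "s' ''bs'' = s ''bs''"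
    by simp_all
  ultimately show ?thesis using assms(1) by (simp add: tables_def)
qed

section \<open>Meaning of the table entries\<close>

definition works :: "nat \<Rightarrow> nat \<Rightarrow> nat \<Rightarrow> nat \<Rightarrow> bool" where
  "works k b c d \<longleftrightarrow> admissible b (coded k b c) (coded k b d) \<and>
     good k (Suc b) (next_state b (coded k b c) (coded k b d))"

text \<open>An entry \<open>Suc d\<close> stores the choice \<open>d\<close>, and 0 marks a dead
  end. Past the last vertex there is nothing to choose, hence the restriction to
  \<open>b \<le> n\<close>.\<close>

definition entry_ok :: "nat \<Rightarrow> nat \<Rightarrow> nat \<Rightarrow> nat \<Rightarrow> bool" where
  "entry_ok k b c v \<longleftrightarrow> (0 < v \<longleftrightarrow> good k b (coded k b c)) \<and>
     (0 < v \<and> b \<le> n \<longrightarrow> v - 1 < codes k \<and> works k b c (v - 1))"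

text \<open>Only codes for the actual guards of \<open>b\<close> are covered. This matters past the
  last vertex, where a single cell is initialised.\<close>

definition row_ok :: "nat \<Rightarrow> nat \<Rightarrow> mem \<Rightarrow> bool" where
  "row_ok k b s \<longleftrightarrow> (\<forall>c<2 ^ (k * length (row b)). entry_ok k b c (s ''T'' (b * codes k + c)))"

lemma row_codes_le: "1 \<le> b \<Longrightarrow> b \<le> Suc n \<Longrightarrow> 2 ^ (k * length (row b)) \<le> codes k"
  unfolding codes_def using length_row_le_width[of b] by (simp add: mult.commute)

text \<open>With \<open>l\<close> the length of the row, index \<open>i\<close> is read as guard
  \<open>i mod l\<close> on page \<open>i div l\<close>, and membership in \<open>D\<close> gives
  the bits.\<close>

lemma ex_code:
  assumes "D \<subseteq> set (row b) \<times> {..<k}"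
  shows "\<exists>d<2 ^ (k * length (row b)). coded k b d = D"
proof -
  let ?l = "length (row b)"
  define P where "P i \<longleftrightarrow> (row b ! (i mod ?l), i div ?l) \<in> D" for i
  define d :: nat where "d = horner_sum of_bool 2 (map P [0..<k * ?l])"
  have "d < 2 ^ (k * ?l)"
    unfolding d_def using horner_sum_of_bool_2_less[of "map P [0..<k * ?l]", where 'a = nat] by simp
  moreover have "(w, q) \<in> coded k b d \<longleftrightarrow> (w, q) \<in> D" for w q
  proof (cases "w \<in> set (row b)")
    case True
    then obtain j where j: "j < ?l" "w = row b ! j" by (metis in_set_conv_nth)
    have "q * ?l + j < k * ?l" if "q < k"
    proof -
      have "q * ?l + j < Suc q * ?l" using j by simp
      also have "\<dots> \<le> k * ?l" using that by (intro mult_right_mono) auto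
      finally show ?thesis .
    qed
    then have "(w, q) \<in> coded k b d \<longleftrightarrow> q < k \<and> P (q * ?l + j)"
      using j by (auto simp: mem_coded d_def bit_horner_sum_bit_iff)
    also have "P (q * ?l + j) \<longleftrightarrow> (w, q) \<in> D" proof -
      have "row b \<noteq> []" using j(1) by auto
      then show ?thesis unfolding P_def using j by simp
    qed
    finally show ?thesis using assms by auto
  next
    case False
    then show ?thesis using assms coded_subset[of k b d] by auto
  qed
  ultimately show ?thesis by auto
qed

text \<open>Replaces the choice of a set in \<open>good_step\<close> by a search over numbers.
  Numbers that differ only in bits beyond the row code the same set, so running through all of
  \<open>codes k\<close> finds nothing spurious.\<close>

lemma good_coded_iff:
  assumes "1 \<le> b" "b \<le> n"
  shows "good k b (coded k b c) \<longleftrightarrow> (\<exists>d<codes k. works k b c d)"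
proof
  assume "good k b (coded k b c)"
  then show "\<exists>d<codes k. works k b c d"
  proof (cases rule: good.cases)
    case (good_step D)
    from ex_code[OF good_step(2)] obtain d where "d < 2 ^ (k * length (row b))" "coded k b d = D" by blast
    with good_step row_codes_le[of b k] assms show ?thesis unfolding works_def by (metis le_SucI less_le_trans)
  qed (use assms in simp)
next
  assume "\<exists>d<codes k. works k b c d"
  then show "good k b (coded k b c)"
    using good_step[OF assms(2) coded_subset] unfolding works_def by blast
qed

lemma runs_try_choices:
  assumes tb: "tables k s" and b: "1 \<le> b" "b \<le> n" "s ''b'' 0 = b" and c: "s ''c'' 0 = c" "c < codes k"
    and nxt: "row_ok k (Suc b) s"
  shows "runs try_choices s (600 * ((width + 1) * (k + 1)) * codes k)
    (\<lambda>s'. entry_ok k b c (s' ''T'' (b * codes k + c)) \<and>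
       (\<forall>x. x \<noteq> b * codes k + c \<longrightarrow> s' ''T'' x = s ''T'' x))"
proof -
  let ?N = "codes k" and ?b = "Less (reg ''d'') (reg ''S'')" and ?X = "(width + 1) * (k + 1)"
  let ?cell = "b * codes k + c"
  let ?upd = "Cond (And (Less (reg ''bad'') (Const 1))
          (Less (Const 0) (Load ''T''
             (Add (Load ''bs'' (Add (reg ''b'') (Const 1))) (reg ''cn'')))))
         (''T''[entry_addr]\<^sub>r :=\<^sub>r Add (reg ''d'') (Const 1)) Skip ;;
        incr ''d''"
  let ?p = "transition ;; ?upd"
  let ?init = "''T''[entry_addr]\<^sub>r :=\<^sub>r Const 0 ;; ''d'' :=\<^sub>r Const 0"
  let ?I = "\<lambda>d s'. s' ''d'' 0 = d \<and> (\<forall>x. x \<noteq> ?cell \<longrightarrow> s' ''T'' x = s ''T'' x) \<and>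
     (s' ''T'' ?cell = 0 \<longrightarrow> (\<forall>d'<d. \<not> works k b c d')) \<and>
     (0 < s' ''T'' ?cell \<longrightarrow> s' ''T'' ?cell - 1 < ?N \<and> works k b c (s' ''T'' ?cell - 1))"
  have bs: "s ''bs'' b = b * ?N" "s ''bs'' (Suc b) = Suc b * ?N" using tb b by (auto simp: tables_def)
  have "runs try_choices s (12 + (6 + ?N * (6 + (500 * ?X + 50)))) (?I ?N)"
    unfolding try_choices_def
  proof (rule runs_Seq[where R = "\<lambda>s'. s' = result ?init s"])
    show "runs ?init s 12 (\<lambda>s'. s' = result ?init s)" by (intro runs_loop_free) simp_all
  next
    fix s1 assume s1: "s1 = result ?init s"
    have I0: "?I 0 s1" unfolding s1 using b bs c by simp
    have "agree {''T'', ''d''} s s1" unfolding s1 agree_def by simp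
    then have tb1: "tables k s1" by (rule tables_agree[OF tb]) (simp add: static_vars_def)
    have fr: "tables k s'" "s' ''b'' 0 = b" "s' ''c'' 0 = c" "s' ''bs'' b = b * ?N" "s' ''bs'' (Suc b) = Suc b * ?N"
      if ag: "agree (writes ?p) s1 s'" for s'
    proof -
      show "tables k s'" by (rule tables_agree[OF tb1 ag]) (simp add: writes_parts static_vars_def)
      show "s' ''b'' 0 = b" "s' ''c'' 0 = c" "s' ''bs'' b = b * ?N" "s' ''bs'' (Suc b) = Suc b * ?N"
        using agreeD[OF ag, of "''b''"] agreeD[OF ag, of "''c''"] agreeD[OF ag, of "''bs''"] b c bs
        by (simp_all add: writes_parts s1)
    qed
    have "runs (While ?b ?p) s1 (6 + ?N * (6 + (500 * ?X + 50))) (\<lambda>s'. ?I ?N s' \<and> agree (writes ?p) s1 s')"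
    proof (rule runs_While_agree[where N = ?N and I = ?I and T = "500 * ?X + 50"])
      fix d s' assume d: "d < ?N" "?I d s'" "agree (writes ?p) s1 s'"
      note fr' = fr[OF d(3)]
      have rd: "ready k b c d s'" using fr' b d c(2) unfolding ready_def tables_def by auto
      have "runs ?p s' (500 * (width + 1) * (k + 1) + 50) (?I (Suc d))"
      proof (rule runs_Seq[OF runs_agree[OF runs_transition[OF rd]]], elim conjE)
        fix s2 assume st: "stepped k b c d s2" and ag: "agree (writes transition) s' s2"
        have eq: "s2 ''T'' = s' ''T''" "s2 ''b'' 0 = b" "s2 ''c'' 0 = c" "s2 ''d'' 0 = d"
          "s2 ''bs'' b = b * ?N" "s2 ''bs'' (Suc b) = Suc b * ?N"
          using agreeD[OF ag, of "''T''"] agreeD[OF ag, of "''b''"] agreeD[OF ag, of "''c''"]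
            agreeD[OF ag, of "''bs''"] agreeD[OF ag, of "''d''"] fr' d(2) by (simp_all add: writes_parts)
        \<comment> \<open>The row that is consulted lies beyond the cell being written, because
          \<open>c < codes k\<close>.\<close>
        have ne: "Suc b * ?N + x \<noteq> ?cell" for x using c(2) by simp
        have "0 < s ''T'' (Suc b * ?N + s2 ''cn'' 0) \<longleftrightarrow> good k (Suc b) (coded k (Suc b) (s2 ''cn'' 0))"
          using nxt st unfolding row_ok_def entry_ok_def stepped_def by blast
        then have T: "0 < s2 ''T'' (Suc b * ?N + s2 ''cn'' 0) \<longleftrightarrow>
            good k (Suc b) (next_state b (coded k b c) (coded k b d))"
          using st d(2) ne unfolding stepped_def eq by simp
        have test: "s2 ''bad'' 0 < 1 \<and> 0 < s2 ''T'' (Suc b * ?N + s2 ''cn'' 0) \<longleftrightarrow> works k b c d"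
          using st T unfolding works_def stepped_def by simp
        have "?I (Suc d) (result ?upd s2)"
        proof (cases "works k b c d")
          case True
          then have "result ?upd s2 = s2(''T'' := (s2 ''T'')(?cell := Suc d), ''d'' := (s2 ''d'')(0 := Suc d))"
            using test eq by simp
          then show ?thesis using True d eq by simp
        next
          case False
          then have "result ?upd s2 = s2(''d'' := (s2 ''d'')(0 := Suc d))"
            using test eq by auto
          then show ?thesis using False d eq by (auto simp: less_Suc_eq)
        qed
        then show "runs ?upd s2 50 (?I (Suc d))" by (intro runs_loop_free, simp, simp)
      qed
      then have "runs ?p s' (500 * ?X + 50) (?I (Suc d))" by (simp only: mult.assoc)
      moreover have "bval ?b s'" using fr' d by (simp add: tables_def)
      ultimately show "bval ?b s' \<and> runs ?p s' (500 * ?X + 50) (?I (Suc d))" by blast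
    next
      fix s' assume "?I ?N s'" "agree (writes ?p) s1 s'"
      then show "\<not> bval ?b s'" using fr[of s'] by (simp add: tables_def)
    qed (use I0 in auto)
    then show "runs (While ?b ?p) s1 (6 + ?N * (6 + (500 * ?X + 50))) (?I ?N)" by (rule runs_mono) auto
  qed
  then show ?thesis
  proof (rule runs_mono)
    \<comment> \<open>With the positive factors written as successors, the inequality holds
      coefficient by coefficient after expansion.\<close>
    obtain Y where Y: "?X = Suc Y" using not0_implies_Suc[of ?X] by auto
    obtain M where M: "?N = Suc M" using not0_implies_Suc[of ?N] by (auto simp: codes_def)
    show "12 + (6 + ?N * (6 + (500 * ?X + 50))) \<le> 600 * ?X * ?N"
      unfolding Y M by (simp add: algebra_simps)
  next
    fix s' assume "?I ?N s'"
    then show "entry_ok k b c (s' ''T'' ?cell) \<and> (\<forall>x. x \<noteq> ?cell \<longrightarrow> s' ''T'' x = s ''T'' x)"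
      unfolding entry_ok_def good_coded_iff[OF b(1,2)] by auto
  qed
qed


lemma row_ok_cong:
  assumes "row_ok k b s" "\<And>x. b * codes k \<le> x \<Longrightarrow> s' ''T'' x = s ''T'' x"
  shows "row_ok k b s'"
  using assms unfolding row_ok_def by simp

lemma runs_fill_row:
  assumes tb: "tables k s" and b: "1 \<le> b" "b \<le> n" "s ''b'' 0 = b"
    and nxt: "row_ok k (Suc b) s"
  shows "runs fill_row s (700 * ((width + 1) * (k + 1)) * codes k * codes k)
    (\<lambda>s'. row_ok k b s' \<and> (\<forall>x. Suc b * codes k \<le> x \<longrightarrow> s' ''T'' x = s ''T'' x))"
proof -
  let ?N = "codes k" and ?b = "Less (reg ''c'') (reg ''S'')" and ?X = "(width + 1) * (k + 1)"
  let ?p = "try_choices ;; incr ''c''"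
  let ?I = "\<lambda>c s'. s' ''c'' 0 = c \<and> (\<forall>c'<c. entry_ok k b c' (s' ''T'' (b * ?N + c'))) \<and>
     (\<forall>x. Suc b * ?N \<le> x \<longrightarrow> s' ''T'' x = s ''T'' x)"
  have "runs fill_row s (3 + (6 + ?N * (6 + (600 * ?X * ?N + 6)))) (?I ?N)"
    unfolding fill_row_def
  proof (rule runs_Seq)
    show "runs (''c'' :=\<^sub>r Const 0) s 3 (\<lambda>s'. s' = s(''c'' := (s ''c'')(0 := 0)))"
      by (intro runs_loop_free) simp_all
  next
    fix s1 assume s1: "s1 = s(''c'' := (s ''c'')(0 := 0))"
    have "agree {''c''} s s1" unfolding s1 agree_def by simp
    then have tb1: "tables k s1" by (rule tables_agree[OF tb]) (simp add: static_vars_def)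
    have fr: "tables k s'" "s' ''b'' 0 = b" if ag: "agree (writes ?p) s1 s'" for s'
    proof -
      show "tables k s'" by (rule tables_agree[OF tb1 ag]) (simp add: writes_parts writes_tables static_vars_def)
      show "s' ''b'' 0 = b" using agreeD[OF ag, of "''b''"] b by (simp add: writes_parts writes_tables s1)
    qed
    have "runs (While ?b ?p) s1 (6 + ?N * (6 + (600 * ?X * ?N + 6))) (\<lambda>s'. ?I ?N s' \<and> agree (writes ?p) s1 s')"
    proof (rule runs_While_agree[where N = ?N and I = ?I and T = "600 * ?X * ?N + 6"])
      fix c s' assume c: "c < ?N" "?I c s'" "agree (writes ?p) s1 s'"
      have nxt': "row_ok k (Suc b) s'" by (rule row_ok_cong[OF nxt]) (use c(2) in blast)
      have c': "s' ''c'' 0 = c" using c(2) by blast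
      have "runs ?p s' (600 * ?X * ?N + 6) (?I (Suc c))"
      proof (rule runs_Seq[OF runs_agree[OF runs_try_choices[OF fr(1)[OF c(3)] b(1,2) fr(2)[OF c(3)] c' c(1) nxt']]], elim conjE)
        fix s2
        assume e: "entry_ok k b c (s2 ''T'' (b * ?N + c))"
          and o: "\<forall>x. x \<noteq> b * ?N + c \<longrightarrow> s2 ''T'' x = s' ''T'' x"
          and ag: "agree (writes try_choices) s' s2"
        have c2: "s2 ''c'' 0 = c" using agreeD[OF ag, of "''c''"] c(2) by (simp add: writes_tables writes_parts)
        have "?I (Suc c) (result (incr ''c'') s2)"
          using c(1,2) e o c2 by (auto simp: less_Suc_eq)
        then show "runs (incr ''c'') s2 6 (?I (Suc c))" by (intro runs_loop_free, simp, simp)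
      qed
      moreover have "bval ?b s'" using fr(1)[OF c(3)] c by (simp add: tables_def)
      ultimately show "bval ?b s' \<and> runs ?p s' (600 * ?X * ?N + 6) (?I (Suc c))" by blast
    next
      fix s' assume "?I ?N s'" "agree (writes ?p) s1 s'"
      then show "\<not> bval ?b s'" using fr(1)[of s'] by (simp add: tables_def)
    qed (auto simp: s1)
    then show "runs (While ?b ?p) s1 (6 + ?N * (6 + (600 * ?X * ?N + 6))) (?I ?N)" by (rule runs_mono) auto
  qed
  then show ?thesis
  proof (rule runs_mono)
    obtain Y where Y: "?X = Suc Y" using not0_implies_Suc[of ?X] by auto
    obtain M where M: "?N = Suc M" using not0_implies_Suc[of ?N] by (auto simp: codes_def)
    show "3 + (6 + ?N * (6 + (600 * ?X * ?N + 6))) \<le> 700 * ?X * ?N * ?N"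
      unfolding Y M by (simp add: algebra_simps)
  next
    fix s' assume "?I ?N s'"
    then show "row_ok k b s' \<and> (\<forall>x. Suc b * ?N \<le> x \<longrightarrow> s' ''T'' x = s ''T'' x)"
      unfolding row_ok_def using row_codes_le[of b k] b by auto
  qed
qed

definition table_ok :: "nat \<Rightarrow> mem \<Rightarrow> bool" where
  "table_ok k s \<longleftrightarrow> tables k s \<and> (\<forall>b\<in>{1..Suc n}. row_ok k b s)"

lemma runs_fill_table:
  assumes st: "static s" "s ''k'' 0 = k" "s ''S'' 0 = codes k"
  shows "runs fill_table s (900 * ((width + 1) * (k + 1)) * codes k * codes k * (n + 1)) (table_ok k)"
proof -
  let ?N = "codes k" and ?b = "Less (Const 0) (reg ''b'')" and ?X = "(width + 1) * (k + 1)"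
  let ?init = "''T''[Load ''bs'' (Add (reg ''n'') (Const 1))]\<^sub>r :=\<^sub>r Const 1 ;; ''b'' :=\<^sub>r reg ''n''"
  let ?p = "fill_row ;; ''b'' :=\<^sub>r Sub (reg ''b'') (Const 1)"
  let ?R = "700 * ?X * ?N * ?N"
  \<comment> \<open>After \<open>i\<close> rounds the rows of the last \<open>i\<close> vertices and
    the row past the last vertex are finished.\<close>
  let ?I = "\<lambda>i s'. s' ''b'' 0 = n - i \<and> (\<forall>b\<in>{Suc (n - i)..Suc n}. row_ok k b s')"
  have "runs fill_table s ((30 * ?N + 30) + ((30 * n + 60) + (12 + (5 + n * (5 + (?R + 6)))))) (table_ok k)"
    unfolding fill_table_def
  proof (rule runs_Seq)
    show "runs halving_table s (30 * ?N + 30) (\<lambda>s'. (\<forall>y<?N + 2. s' ''hf'' y = y div 2) \<and> agree (writes halving_table) s s')"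
      using runs_agree[OF runs_halving_table[of s]] st by simp
  next
    fix s1 assume s1: "(\<forall>y<?N + 2. s1 ''hf'' y = y div 2) \<and> agree (writes halving_table) s s1"
    then have st1: "static s1" "s1 ''k'' 0 = k" "s1 ''S'' 0 = codes k" "s1 ''n'' 0 = n"
      using static_agree[OF st(1), of "writes halving_table" s1] agreeD[of "writes halving_table" s s1] st staticD(1)[OF st(1)]
      by (simp_all add: writes_tables static_vars_def)
    show "runs (base_table ;; ?init ;; While ?b ?p) s1 ((30 * n + 60) + (12 + (5 + n * (5 + (?R + 6))))) (table_ok k)"
    proof (rule runs_Seq)
      show "runs base_table s1 (30 * n + 60) (\<lambda>s'. (\<forall>y\<le>Suc n. s' ''bs'' y = y * ?N) \<and> agree (writes base_table) s1 s')"
        using runs_agree[OF runs_base_table[of s1]] st1 by simp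
    next
      fix s2 assume s2: "(\<forall>y\<le>Suc n. s2 ''bs'' y = y * ?N) \<and> agree (writes base_table) s1 s2"
      then have "static s2" "s2 ''k'' 0 = k" "s2 ''S'' 0 = codes k" "s2 ''n'' 0 = n" "s2 ''hf'' = s1 ''hf''"
        using static_agree[OF st1(1), of "writes base_table" s2] agreeD[of "writes base_table" s1 s2] st1
        by (simp_all add: writes_tables static_vars_def)
      then have tb2: "tables k s2" and n2: "s2 ''n'' 0 = n" using s1 s2 unfolding tables_def by auto
      show "runs (?init ;; While ?b ?p) s2 (12 + (5 + n * (5 + (?R + 6)))) (table_ok k)"
      proof (rule runs_Seq)
        show "runs ?init s2 12 (\<lambda>s'. s' = result ?init s2)" by (intro runs_loop_free) simp_all
      next
        fix s3 assume s3: "s3 = result ?init s2"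
        have "agree {''T'', ''b''} s2 s3" unfolding s3 agree_def by simp
        then have tb3: "tables k s3" by (rule tables_agree[OF tb2]) (simp add: static_vars_def)
        have "s3 ''T'' (Suc n * ?N) = 1" "s3 ''b'' 0 = n" using tb2 n2 unfolding s3 by (simp_all add: tables_def)
        moreover from this(1) have "row_ok k (Suc n) s3"
          using good_end[of "Suc n"] by (simp add: row_ok_def entry_ok_def row_end)
        ultimately have I0: "?I 0 s3" by simp
        have fr: "tables k s'" if ag: "agree (writes ?p) s3 s'" for s'
          by (rule tables_agree[OF tb3 ag]) (simp add: writes_parts writes_tables static_vars_def)
        have "runs (While ?b ?p) s3 (5 + n * (5 + (?R + 6))) (\<lambda>s'. ?I n s' \<and> agree (writes ?p) s3 s')"
        proof (rule runs_While_agree[where N = n and I = ?I and T = "?R + 6"])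
          fix i s' assume i: "i < n" "?I i s'" "agree (writes ?p) s3 s'"
          let ?bb = "n - i"
          have bb: "1 \<le> ?bb" "?bb \<le> n" using i(1) by auto
          have rows: "\<And>b. b \<in> {Suc ?bb..Suc n} \<Longrightarrow> row_ok k b s'" using i(2) by blast
          have "runs ?p s' (?R + 6) (?I (Suc i))"
          proof (rule runs_Seq[OF runs_agree[OF runs_fill_row[OF fr[OF i(3)] bb]]], goal_cases)
            case (3 s4)
            then have r: "row_ok k ?bb s4" and o: "\<And>x. Suc ?bb * ?N \<le> x \<Longrightarrow> s4 ''T'' x = s' ''T'' x"
              and ag: "agree (writes fill_row) s' s4" by blast+
            have b4: "s4 ''b'' 0 = ?bb" using agreeD[OF ag, of "''b''"] i(2) by (simp add: writes_tables writes_parts)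
            have "row_ok k b s4" if "b \<in> {?bb..Suc n}" for b
            proof (cases "b = ?bb")
              case False
              \<comment> \<open>Finished rows lie beyond the addresses that \<open>fill_row\<close>
                may change.\<close>
              then have b: "Suc ?bb \<le> b" "b \<in> {Suc ?bb..Suc n}" using that by auto
              show ?thesis
              proof (rule row_ok_cong[OF rows[OF b(2)]])
                fix x assume "b * ?N \<le> x"
                with b(1) have "Suc ?bb * ?N \<le> x" by (meson le_trans mult_le_mono1)
                then show "s4 ''T'' x = s' ''T'' x" by (rule o)
              qed
            qed (use r in simp)
            moreover have "Suc (n - Suc i) = ?bb" using i(1) by simp
            ultimately have "?I (Suc i) (result (''b'' :=\<^sub>r Sub (reg ''b'') (Const 1)) s4)"
              using b4 by (auto simp: row_ok_def)
            then show ?case by (intro runs_loop_free, simp, simp)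
          qed (use i(2) rows in auto)
          moreover have "bval ?b s'" using i by simp
          ultimately show "bval ?b s' \<and> runs ?p s' (?R + 6) (?I (Suc i))" by blast
        next
          fix s' assume "?I n s'" "agree (writes ?p) s3 s'"
          then show "\<not> bval ?b s'" by simp
        qed (use I0 in auto)
        then show "runs (While ?b ?p) s3 (5 + n * (5 + (?R + 6))) (table_ok k)"
          by (rule runs_mono) (use fr in \<open>auto simp: table_ok_def\<close>)
      qed
    qed
  qed
  then show ?thesis
  proof (rule runs_mono)
    obtain Y where Y: "?X = Suc Y" using not0_implies_Suc[of ?X] by auto
    obtain M where M: "?N = Suc M" using not0_implies_Suc[of ?N] by (auto simp: codes_def)
    show "(30 * ?N + 30) + ((30 * n + 60) + (12 + (5 + n * (5 + (?R + 6))))) \<le> 900 * ?X * ?N * ?N * (n + 1)"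
      unfolding Y M by (simp add: algebra_simps)
  qed
qed

lemma runs_more_pages:
  assumes st: "static s" "s ''k'' 0 = k" "s ''S'' 0 = codes k"
  shows "runs more_pages s (30 * (width + 1)) (\<lambda>s'. s' ''k'' 0 = Suc k \<and> s' ''S'' 0 = codes (Suc k))"
proof -
  let ?b = "Less (reg ''x'') (reg ''K'')"
  let ?p = "''S'' :=\<^sub>r Add (reg ''S'') (reg ''S'') ;; incr ''x''"
  let ?init = "incr ''k'' ;; ''x'' :=\<^sub>r Const 0"
  let ?I = "\<lambda>i s'. s' ''x'' 0 = i \<and> s' ''S'' 0 = codes k * 2 ^ i"
  have "runs more_pages s (10 + (6 + width * (6 + 14))) (\<lambda>s'. s' ''k'' 0 = Suc k \<and> s' ''S'' 0 = codes (Suc k))"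
    unfolding more_pages_def
  proof (rule runs_Seq)
    show "runs ?init s 10 (\<lambda>s'. s' = result ?init s)" by (intro runs_loop_free) simp_all
  next
    fix s1 assume s1: "s1 = result ?init s"
    have fr: "s' ''K'' 0 = width" "s' ''k'' 0 = Suc k" if "agree (writes ?p) s1 s'" for s'
      using agreeD[OF that, of "''K''"] agreeD[OF that, of "''k''"] st staticD(2)[OF st(1)] by (simp_all add: s1)
    have "runs (While ?b ?p) s1 (6 + width * (6 + 14)) (\<lambda>s'. ?I width s' \<and> agree (writes ?p) s1 s')"
    proof (rule runs_While_agree[where N = width and I = ?I and T = 14])
      fix i s' assume i: "i < width" "?I i s'" "agree (writes ?p) s1 s'"
      have "runs ?p s' 14 (?I (Suc i))" using i(2) by (intro runs_loop_free) simp_all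
      with i fr[OF i(3)] show "bval ?b s' \<and> runs ?p s' 14 (?I (Suc i))" by simp
    next
      fix s' assume "?I width s'" "agree (writes ?p) s1 s'"
      with fr[of s'] show "\<not> bval ?b s'" by simp
    qed (use st in \<open>auto simp: s1\<close>)
    then show "runs (While ?b ?p) s1 (6 + width * (6 + 14)) (\<lambda>s'. s' ''k'' 0 = Suc k \<and> s' ''S'' 0 = codes (Suc k))"
      by (rule runs_mono) (use fr in \<open>auto simp: codes_def power_add\<close>)
  qed
  then show ?thesis by (rule runs_mono) auto
qed

text \<open>A derivation of \<open>good\<close> supplies a choice for every vertex. The colouring is
  extended vertex by vertex, each edge ending at \<open>b\<close> taking any page offered to its
  left endpoint.\<close>

lemma good_imp_embeds:
  "good k b H \<Longrightarrow> 1 \<le> b \<Longrightarrow> b \<le> Suc n \<Longrightarrow> embeds_below k b col H \<Longrightarrow> \<exists>col. embeds k col"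
proof (induction arbitrary: col rule: good.induct)
  case (good_end b H)
  then have "b = Suc n" by simp
  with good_end embeds_below_end show ?case by blast
next
  case (good_step b D H)
  let ?col = "\<lambda>e. if snd e = b then Suc (SOME q. (fst e, q) \<in> D) else col e"
  have "embeds_below k (Suc b) ?col (next_state b H D)"
  proof (rule embeds_below_step[OF good_step.prems(3) good_step.hyps(2,3)])
    fix a assume "(a, b) \<in> set pl"
    then have "\<exists>q. (a, q) \<in> D" using good_step.hyps(3) unfolding admissible_def by blast
    then show "\<exists>q. ?col (a, b) = Suc q \<and> (a, q) \<in> D" by (auto intro: someI)
  qed auto
  with good_step show ?case by simp
qed

lemma good_start_iff: "good k 1 {} \<longleftrightarrow> (\<exists>col. embeds k col)"
  using good_imp_embeds[OF _ _ _ embeds_below_start] embeds_imp_good_start by auto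

end

lemma writes_search:
  "writes more_pages = {''k'', ''x'', ''S''}"
  "writes find_pages = {''k'', ''S'', ''fin'', ''x'', ''hf'', ''bs'', ''b'', ''c'', ''T'', ''d''} \<union> writes transition"
  "writes output_vertex = {''s'', ''e'', ''page''}"
  unfolding more_pages_def find_pages_def output_vertex_def by (auto simp: writes_tables)

context ordered_graph
begin

section \<open>Search for the least number of pages\<close>

definition thickness :: nat where
  "thickness = (LEAST k. \<exists>col. embeds k col)"

lemma thickness_embeds: "\<exists>col. embeds thickness col"
  unfolding thickness_def using embeds_width by (rule LeastI)

lemma thickness_le_width: "thickness \<le> width"
  unfolding thickness_def using embeds_width by (rule Least_le)

lemma less_thickness: "k < thickness \<Longrightarrow> \<not> (\<exists>col. embeds k col)"
  unfolding thickness_def by (rule not_less_Least)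

lemma codes_mono: "k \<le> k' \<Longrightarrow> codes k \<le> codes k'"
  unfolding codes_def by simp

text \<open>The first vertex has no guards, so its only code is 0, which stands for the empty
  state.\<close>

lemma table_ok_start_iff:
  assumes "table_ok k s"
  shows "0 < s ''T'' (s ''bs'' 1) \<longleftrightarrow> (\<exists>col. embeds k col)"
proof -
  have "row_ok k 1 s" "s ''bs'' 1 = codes k" using assms by (auto simp: table_ok_def tables_def)
  then have "0 < s ''T'' (s ''bs'' 1) \<longleftrightarrow> good k 1 (coded k 1 0)"
    unfolding row_ok_def entry_ok_def by (simp add: row_1)
  also have "coded k 1 0 = {}" by (simp add: coded_def)
  finally show ?thesis by (simp only: good_start_iff)
qed

text \<open>There are \<open>thickness + 1\<close> rounds, each charged as if \<open>k\<close> were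
  \<open>width\<close>. This yields one factor \<open>width + 1\<close> beside the two of a single
  transition, which scans guards on pages; the square of \<open>codes\<close> counts states times
  choices.\<close>

lemma runs_find_pages:
  assumes st: "static s"
  shows "runs find_pages s (1000 * ((width + 1) ^ 3 * codes width ^ 2 * (n + 1))) (table_ok thickness)"
proof -
  let ?f = thickness and ?b = "Less (reg ''fin'') (Const 1)"
  let ?c = "Less (Const 0) (Load ''T'' (Load ''bs'' (Const 1)))"
  let ?fin = "Cond ?c (''fin'' :=\<^sub>r Const 1) more_pages"
  let ?p = "fill_table ;; ?fin"
  let ?init = "''k'' :=\<^sub>r Const 0 ;; ''S'' :=\<^sub>r Const 1 ;; ''fin'' :=\<^sub>r Const 0"
  let ?F = "900 * ((width + 1) * (width + 1)) * codes width * codes width * (n + 1)"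
  \<comment> \<open>Up to round \<open>?f\<close> the test of \<open>i\<close> pages is still ahead;
    after it, the finished table for \<open>?f\<close> pages is in memory.\<close>
  let ?I = "\<lambda>i s'. if i \<le> ?f then static s' \<and> s' ''fin'' 0 = 0 \<and> s' ''k'' 0 = i \<and> s' ''S'' 0 = codes i
      else s' ''fin'' 0 = 1 \<and> table_ok ?f s'"
  have "runs find_pages s (9 + (5 + Suc ?f * (5 + (?F + (6 + 30 * (width + 1)))))) (?I (Suc ?f))"
    unfolding find_pages_def
  proof (rule runs_Seq)
    show "runs ?init s 9 (\<lambda>s'. s' = result ?init s)" by (intro runs_loop_free) simp_all
  next
    fix s1 assume s1: "s1 = result ?init s"
    have "agree {''k'', ''S'', ''fin''} s s1" unfolding s1 agree_def by simp
    then have st1: "static s1" by (rule static_agree[OF st]) (simp add: static_vars_def)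
    have I0: "?I 0 s1" using st1 unfolding s1 by (simp add: codes_def)
    have "runs (While ?b ?p) s1 (5 + Suc ?f * (5 + (?F + (6 + 30 * (width + 1)))))
        (\<lambda>s'. ?I (Suc ?f) s' \<and> agree (writes ?p) s1 s')"
    proof (rule runs_While_agree[where N = "Suc ?f" and I = ?I and T = "?F + (6 + 30 * (width + 1))"])
      fix i s' assume "i < Suc ?f" and I: "?I i s'"
      then have i: "i \<le> ?f" by simp
      then have s': "static s'" "s' ''fin'' 0 = 0" "s' ''k'' 0 = i" "s' ''S'' 0 = codes i" using I by auto
      have iw: "i \<le> width" using i thickness_le_width by simp
      have F: "900 * ((width + 1) * (i + 1)) * codes i * codes i * (n + 1) \<le> ?F"
        using iw codes_mono[OF iw] by (intro mult_le_mono) auto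
      have "runs ?p s' (?F + (6 + 30 * (width + 1))) (?I (Suc i))"
      proof (rule runs_Seq[OF runs_agree[OF runs_mono[OF runs_fill_table[OF s'(1,3,4)] F]]])
        fix s2 assume "table_ok i s2 \<and> agree (writes fill_table) s' s2"
        then have s2: "table_ok i s2" "static s2" "s2 ''k'' 0 = i" "s2 ''S'' 0 = codes i" "s2 ''fin'' 0 = 0"
          using s'(2) agreeD[of "writes fill_table" s' s2 "''fin''"]
          by (auto simp: table_ok_def tables_def writes_tables writes_parts)
        have "runs ?fin s2 (1 + bcost ?c + 30 * (width + 1)) (?I (Suc i))"
        proof (rule runs_Cond)
          assume "bval ?c s2"
          then have "\<exists>col. embeds i col" using table_ok_start_iff[OF s2(1)] by simp
          with less_thickness i have idx: "i = ?f" by (metis le_neq_implies_less)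
          let ?s3 = "result (''fin'' :=\<^sub>r Const 1) s2"
          have ag: "agree {''fin''} s2 ?s3" by (simp add: agree_def)
          have "tables i ?s3" by (rule tables_agree[OF _ ag]) (use s2(1) in \<open>auto simp: table_ok_def static_vars_def\<close>)
          then have "table_ok i ?s3" using s2(1) by (simp add: table_ok_def row_ok_def)
          then have "?I (Suc i) ?s3" using idx by simp
          then show "runs (''fin'' :=\<^sub>r Const 1) s2 (30 * (width + 1)) (?I (Suc i))"
            by (intro runs_loop_free, simp, simp)
        next
          assume "\<not> bval ?c s2"
          then have "\<not> (\<exists>col. embeds i col)" using table_ok_start_iff[OF s2(1)] by simp
          with thickness_embeds i have idx: "Suc i \<le> ?f" by (metis Suc_leI le_neq_implies_less)
          show "runs more_pages s2 (30 * (width + 1)) (?I (Suc i))"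
          proof (rule runs_mono[OF runs_agree[OF runs_more_pages[OF s2(2-4)]]])
            fix s3 assume s3: "(s3 ''k'' 0 = Suc i \<and> s3 ''S'' 0 = codes (Suc i)) \<and> agree (writes more_pages) s2 s3"
            then have "static s3" "s3 ''fin'' 0 = 0"
              using static_agree[OF s2(2), of "writes more_pages" s3] agreeD[of "writes more_pages" s2 s3 "''fin''"] s2(5)
              by (auto simp: writes_search static_vars_def)
            with s3 idx show "?I (Suc i) s3" by simp
          qed simp
        qed
        then show "runs ?fin s2 (6 + 30 * (width + 1)) (?I (Suc i))" by simp
      qed simp
      moreover have "bval ?b s'" using s' by simp
      ultimately show "bval ?b s' \<and> runs ?p s' (?F + (6 + 30 * (width + 1))) (?I (Suc i))" by blast
    next
      fix s' assume "?I (Suc ?f) s'"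
      then show "\<not> bval ?b s'" by simp
    qed (use I0 in auto)
    then show "runs (While ?b ?p) s1 (5 + Suc ?f * (5 + (?F + (6 + 30 * (width + 1))))) (?I (Suc ?f))"
      by (rule runs_mono) auto
  qed
  then show ?thesis
  proof (rule runs_mono)
    obtain M where M: "codes width = Suc M" using not0_implies_Suc[of "codes width"] by (auto simp: codes_def)
    have "9 + (5 + Suc ?f * (5 + (?F + (6 + 30 * (width + 1))))) \<le>
        14 + Suc width * (5 + (?F + (6 + 30 * (width + 1))))"
      using thickness_le_width by (simp add: mult_le_mono)
    also have "\<dots> \<le> 1000 * ((width + 1) ^ 3 * codes width ^ 2 * (n + 1))"
      unfolding M by (simp add: algebra_simps power2_eq_square power3_eq_cube)
    finally show "9 + (5 + Suc ?f * (5 + (?F + (6 + 30 * (width + 1))))) \<le>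
        1000 * ((width + 1) ^ 3 * codes width ^ 2 * (n + 1))" .
  qed simp
qed

section \<open>Writing the pages to memory\<close>

lemma runs_output_vertex:
  assumes st: "static s" "1 \<le> b" "b \<le> n" "s ''b'' 0 = b"
  shows "runs output_vertex s (50 * (width + 1))
    (\<lambda>s'. (\<forall>i<length pl. snd (pl ! i) \<noteq> b \<longrightarrow> s' ''page'' i = s ''page'' i) \<and>
       (\<forall>j<length (row b). \<forall>i<length pl. pl ! i = (row b ! j, b) \<longrightarrow> s' ''page'' i = s ''got'' j))"
proof -
  let ?l = "length (row b)" and ?m = "length pl"
  let ?p = "''e'' :=\<^sub>r Load ''adj'' (Add (Load ''mul'' (reg ''b'')) (Load ''G'' guard_addr)) ;;
       pos_if (reg ''e'') (''page''[Sub (reg ''e'') (Const 1)]\<^sub>r :=\<^sub>r Load ''got'' (reg ''s'')) ;;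
       incr ''s''"
  let ?b = "Less (reg ''s'') (Load ''len'' (reg ''b''))"
  let ?I = "\<lambda>j s'. s' ''s'' 0 = j \<and> (\<forall>i<?m. snd (pl ! i) \<noteq> b \<longrightarrow> s' ''page'' i = s ''page'' i) \<and>
       (\<forall>j'<j. \<forall>i<?m. pl ! i = (row b ! j', b) \<longrightarrow> s' ''page'' i = s ''got'' j')"
  have len: "?l \<le> width" using length_row_le_width st by simp
  have "runs output_vertex s (3 + (45 * width + 10)) (?I ?l)"
    unfolding output_vertex_def
  proof (rule runs_Seq)
    show "runs (''s'' :=\<^sub>r Const 0) s 3 (\<lambda>s'. s' = s(''s'' := (s ''s'')(0 := 0)))"
      by (intro runs_loop_free) simp_all
  next
    fix s1 assume s1: "s1 = s(''s'' := (s ''s'')(0 := 0))"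
    have fr: "s' ''b'' = s ''b''" "s' ''len'' = s ''len''" "s' ''mul'' = s ''mul''" "s' ''G'' = s ''G''"
      "s' ''adj'' = s ''adj''" "s' ''got'' = s ''got''" if "agree (writes ?p) s1 s'" for s'
      using agreeD[OF that] by (simp_all add: s1)
    have "runs (While ?b ?p) s1 (45 * width + 10) (\<lambda>s'. ?I ?l s' \<and> agree (writes ?p) s1 s')"
    proof (rule runs_While_agree[where T = 38 and N = ?l and I = ?I])
      fix j s' assume j: "j < ?l" "?I j s'" "agree (writes ?p) s1 s'"
      let ?e = "s ''adj'' (b * Suc n + row b ! j)"
      have rn: "row b ! j \<le> n" using nth_mem[OF j(1)] st by (simp add: set_row)
      have s'j: "s' ''s'' 0 = j" using j(2) by blast
      have r: "result ?p s' = (if 0 < ?e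
          then s'(''e'' := (s' ''e'')(0 := ?e), ''page'' := (s' ''page'')(?e - 1 := s ''got'' j),
            ''s'' := (s' ''s'')(0 := Suc j))
          else s'(''e'' := (s' ''e'')(0 := ?e), ''s'' := (s' ''s'')(0 := Suc j)))"
        using fr[OF j(3)] st s'j staticD(3)[OF st(1,3)] staticD(6)[OF st(1-3) j(1)] by simp
      have "?I (Suc j) (result ?p s')"
      proof (cases "(row b ! j, b) \<in> set pl")
        case True
        then obtain i0 where i0: "i0 < ?m" "pl ! i0 = (row b ! j, b)" by (metis in_set_conv_nth)
        have e: "?e = Suc i0" using staticD(7)[OF st(1) i0] .
        let ?pg = "(s' ''page'')(i0 := s ''got'' j)"
        have "?pg i = s ''page'' i" if "i < ?m" "snd (pl ! i) \<noteq> b" for i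
          using that j(2) i0(2) by (cases "i = i0") simp_all
        moreover have "?pg i = s ''got'' j'" if "j' < Suc j" "i < ?m" "pl ! i = (row b ! j', b)" for i j'
        proof (cases "j' = j")
          case True
          then have "i = i0" using that i0 nth_eq_iff_index_eq[OF distinct_pl] by metis
          with True show ?thesis by simp
        next
          case False
          then have "j' < j" using that(1) by simp
          then have "row b ! j' \<noteq> row b ! j"
            using j(1) nth_eq_iff_index_eq[OF distinct_row, of j' b j] by simp
          then have "i \<noteq> i0" using that(3) i0(2) by auto
          then show ?thesis using j(2) \<open>j' < j\<close> that(2,3) by simp
        qed
        ultimately show ?thesis unfolding r e by simp
      next
        case False
        then have e: "?e = 0" using staticD(8)[OF st(1) rn st(3)] by simp
        have "pl ! i \<noteq> (row b ! j, b)" if "i < ?m" for i using that False nth_mem by metis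
        then have "s' ''page'' i = s ''got'' j'" if "j' < Suc j" "i < ?m" "pl ! i = (row b ! j', b)" for i j'
          using that j(2) by (cases "j' = j") simp_all
        then show ?thesis using j(2) unfolding r e by simp
      qed
      then have "runs ?p s' 38 (?I (Suc j))" by (intro runs_loop_free, simp, simp)
      moreover have "bval ?b s'" using j st fr[OF j(3)] by (simp add: staticD(5))
      ultimately show "bval ?b s' \<and> runs ?p s' 38 (?I (Suc j))" by blast
    next
      fix s' assume j: "?I ?l s'" "agree (writes ?p) s1 s'"
      then show "\<not> bval ?b s'" using st fr[OF j(2)] by (simp add: staticD(5))
    qed (use len in \<open>auto simp: s1\<close>)
    then show "runs (While ?b ?p) s1 (45 * width + 10) (?I ?l)"
      by (rule runs_mono) auto
  qed
  then show ?thesis by (rule runs_mono) auto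
qed

text \<open>Reads the output as a colouring of pairs of positions; the index of an edge in
  \<open>pl\<close> is unique since \<open>pl\<close> is distinct.\<close>

definition page_of :: "mem \<Rightarrow> nat \<times> nat \<Rightarrow> nat" where
  "page_of s e = s ''page'' (SOME i. i < length pl \<and> pl ! i = e)"

lemma page_of_nth: "i < length pl \<Longrightarrow> page_of s (pl ! i) = s ''page'' i"
  unfolding page_of_def
  by (subst some_equality[of _ i]) (auto simp: nth_eq_iff_index_eq[OF distinct_pl])

text \<open>The invariant couples two facts about the current state: it is \<open>good\<close>, so
  the table holds a usable choice for it, and it satisfies \<open>embeds_below\<close> with the
  pages written so far. Each vertex then costs one transition and no search.\<close>

lemma runs_output_pages:
  assumes tk: "table_ok k s" and ex: "\<exists>col. embeds k col"
  shows "runs output_pages s (700 * ((width + 1) * (k + 1)) * (n + 1)) (\<lambda>s'. embeds k (page_of s'))"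
proof -
  let ?b = "Less (reg ''b'') (Add (reg ''n'') (Const 1))" and ?X = "(width + 1) * (k + 1)"
  let ?get = "''d'' :=\<^sub>r Sub (Load ''T'' entry_addr) (Const 1)"
  let ?fin = "''c'' :=\<^sub>r reg ''cn'' ;; incr ''b''"
  let ?p = "?get ;; transition ;; output_vertex ;; ?fin"
  let ?init = "''c'' :=\<^sub>r Const 0 ;; ''b'' :=\<^sub>r Const 1"
  let ?I = "\<lambda>i s'. s' ''b'' 0 = Suc i \<and> s' ''c'' 0 < 2 ^ (k * length (row (Suc i))) \<and>
     good k (Suc i) (coded k (Suc i) (s' ''c'' 0)) \<and>
     embeds_below k (Suc i) (page_of s') (coded k (Suc i) (s' ''c'' 0))"
  have tb: "tables k s" and rows: "\<And>b. b \<in> {1..Suc n} \<Longrightarrow> row_ok k b s"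
    using tk by (auto simp: table_ok_def)
  have "runs output_pages s (6 + (8 + n * (8 + (12 + (500 * (width + 1) * (k + 1) + (50 * (width + 1) + 12)))))) (?I n)"
    unfolding output_pages_def
  proof (rule runs_Seq)
    show "runs ?init s 6 (\<lambda>s'. s' = result ?init s)" by (intro runs_loop_free) simp_all
  next
    fix s1 assume s1: "s1 = result ?init s"
    have "coded k (Suc 0) 0 = {}" by (simp add: coded_def)
    then have I0: "?I 0 s1" using ex good_start_iff[of k] embeds_below_start[of k] unfolding s1 by (simp add: row_1)
    have "agree {''b'', ''c''} s s1" unfolding s1 agree_def by simp
    then have tb1: "tables k s1" by (rule tables_agree[OF tb]) (simp add: static_vars_def)
    have fr: "tables k s'" "s' ''T'' = s ''T''" if ag: "agree (writes ?p) s1 s'" for s'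
    proof -
      show "tables k s'" by (rule tables_agree[OF tb1 ag]) (simp add: writes_parts writes_search static_vars_def)
      show "s' ''T'' = s ''T''" using agreeD[OF ag, of "''T''"] by (simp add: writes_parts writes_search s1)
    qed
    have "runs (While ?b ?p) s1 (8 + n * (8 + (12 + (500 * (width + 1) * (k + 1) + (50 * (width + 1) + 12)))))
      (\<lambda>s'. ?I n s' \<and> agree (writes ?p) s1 s')"
    proof (rule runs_While_agree[where N = n and I = ?I and T = "12 + (500 * (width + 1) * (k + 1) + (50 * (width + 1) + 12))"])
      fix i s' assume i: "i < n" "?I i s'" "agree (writes ?p) s1 s'"
      let ?bb = "Suc i"
      define c where "c = s' ''c'' 0"
      define d where "d = s ''T'' (?bb * codes k + c) - 1"
      have b: "1 \<le> ?bb" "?bb \<le> n" using i(1) by auto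
      have s': "s' ''b'' 0 = ?bb" "c < 2 ^ (k * length (row ?bb))" "good k ?bb (coded k ?bb c)"
        "embeds_below k ?bb (page_of s') (coded k ?bb c)" using i(2) unfolding c_def by auto
      note fr' = fr[OF i(3)]
      have cN: "c < codes k" using s'(2) row_codes_le[of ?bb k] b by simp
      have "entry_ok k ?bb c (s ''T'' (?bb * codes k + c))"
        using rows[of ?bb] b s'(2) unfolding row_ok_def by simp
      then have d: "d < codes k" "works k ?bb c d"
        using s'(3) b(2) unfolding entry_ok_def d_def by auto
      have bs: "s' ''bs'' ?bb = ?bb * codes k" using fr'(1) b by (simp add: tables_def)
      have "runs ?p s' (12 + (500 * (width + 1) * (k + 1) + (50 * (width + 1) + 12))) (?I (Suc i))"
      proof (rule runs_Seq)
        have "result ?get s' = s'(''d'' := (s' ''d'')(0 := d))"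
          using s'(1) fr'(2) bs by (simp add: d_def c_def)
        then show "runs ?get s' 12 (\<lambda>s''. s'' = s'(''d'' := (s' ''d'')(0 := d)))"
          by (intro runs_loop_free, simp, simp)
      next
        fix s2 assume s2: "s2 = s'(''d'' := (s' ''d'')(0 := d))"
        have "agree {''d''} s' s2" unfolding s2 agree_def by simp
        then have tb2: "tables k s2" by (rule tables_agree[OF fr'(1)]) (simp add: static_vars_def)
        have rd: "ready k ?bb c d s2"
          using tb2 b s'(1) cN d(1) unfolding ready_def tables_def by (auto simp: s2 c_def)
        show "runs (transition ;; output_vertex ;; ?fin) s2
            (500 * (width + 1) * (k + 1) + (50 * (width + 1) + 12)) (?I (Suc i))"
        proof (rule runs_Seq[OF runs_agree[OF runs_transition[OF rd]]], elim conjE)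
          fix s3 assume sp: "stepped k ?bb c d s3" and ag3: "agree (writes transition) s2 s3"
          have "ready k ?bb c d s3" using ready_agree[OF rd ag3] by (simp add: writes_parts static_vars_def)
          then have st3: "static s3" "s3 ''b'' 0 = ?bb" by (auto simp: ready_def)
          have pg: "s3 ''page'' = s' ''page''" using agreeD[OF ag3, of "''page''"] by (simp add: writes_parts s2)
          show "runs (output_vertex ;; ?fin) s3 (50 * (width + 1) + 12) (?I (Suc i))"
          proof (rule runs_Seq[OF runs_agree[OF runs_output_vertex[OF st3(1) b st3(2)]]], elim conjE)
            fix s4
            assume old: "\<forall>i<length pl. snd (pl ! i) \<noteq> ?bb \<longrightarrow> s4 ''page'' i = s3 ''page'' i"
              and new: "\<forall>j<length (row ?bb). \<forall>i<length pl. pl ! i = (row ?bb ! j, ?bb) \<longrightarrow> s4 ''page'' i = s3 ''got'' j"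
              and ag4: "agree (writes output_vertex) s3 s4"
            have eq4: "s4 ''cn'' = s3 ''cn''" "s4 ''b'' = s3 ''b''"
              using agreeD[OF ag4, of "''cn''"] agreeD[OF ag4, of "''b''"] by (simp_all add: writes_search)
            let ?D = "coded k ?bb d" and ?H = "coded k ?bb c"
            have adm: "admissible ?bb ?H ?D" using d(2) unfolding works_def by blast
            have "embeds_below k (Suc ?bb) (page_of s4) (next_state ?bb ?H ?D)"
            proof (rule embeds_below_step[OF s'(4) coded_subset adm])
              fix a x assume e: "(a, x) \<in> set pl" "x < ?bb"
              then obtain i where "i < length pl" "pl ! i = (a, x)" by (metis in_set_conv_nth)
              then show "page_of s4 (a, x) = page_of s' (a, x)"
                using old pg e(2) page_of_nth[of i s4] page_of_nth[of i s'] by auto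
            next
              fix a assume e: "(a, ?bb) \<in> set pl"
              then obtain i where i: "i < length pl" "pl ! i = (a, ?bb)" by (metis in_set_conv_nth)
              obtain j where j: "j < length (row ?bb)" "row ?bb ! j = a"
                using edge_in_row[OF e] by (metis in_set_conv_nth)
              have p: "page_of s4 (a, ?bb) = s3 ''got'' j" using new i j page_of_nth[OF i(1), of s4] by simp
              have g: "s3 ''got'' j = 0 \<longrightarrow> (\<forall>q. (a, q) \<notin> ?D)" "\<And>q. s3 ''got'' j = Suc q \<Longrightarrow> (a, q) \<in> ?D"
                using sp j unfolding stepped_def by auto
              have "\<exists>q. (a, q) \<in> ?D" using adm e unfolding admissible_def by blast
              with g(1) obtain q where "s3 ''got'' j = Suc q" by (metis not0_implies_Suc)
              with p g(2) show "\<exists>q. page_of s4 (a, ?bb) = Suc q \<and> (a, q) \<in> ?D" by auto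
            qed
            moreover have "page_of (result ?fin s4) = page_of s4" by (simp add: page_of_def fun_eq_iff)
            ultimately have "?I (Suc i) (result ?fin s4)"
              using sp d(2) st3(2) eq4 unfolding stepped_def works_def by simp
            then show "runs ?fin s4 12 (?I (Suc i))" by (intro runs_loop_free, simp, simp)
          qed
        qed
      qed
      moreover have "bval ?b s'" using s'(1) i(1) fr'(1) by (simp add: tables_def staticD(1))
      ultimately show "bval ?b s' \<and> runs ?p s' (12 + (500 * (width + 1) * (k + 1) + (50 * (width + 1) + 12))) (?I (Suc i))"
        by blast
    next
      fix s' assume I: "?I n s'" "agree (writes ?p) s1 s'"
      then show "\<not> bval ?b s'" using fr(1)[OF I(2)] by (simp add: tables_def staticD(1))
    qed (use I0 in auto)
    then show "runs (While ?b ?p) s1 (8 + n * (8 + (12 + (500 * (width + 1) * (k + 1) + (50 * (width + 1) + 12))))) (?I n)"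
      by (rule runs_mono) auto
  qed
  then show ?thesis
  proof (rule runs_mono)
    show "6 + (8 + n * (8 + (12 + (500 * (width + 1) * (k + 1) + (50 * (width + 1) + 12))))) \<le> 700 * ?X * (n + 1)"
      by (simp add: algebra_simps)
  qed (use embeds_below_end in blast)
qed

end

section \<open>Preprocessing\<close>

lemma runs_number_vertices:
  assumes "distinct vs" "s ''n'' 0 = length vs" "\<And>i. i < length vs \<Longrightarrow> s ''order'' i = vs ! i"
    "s ''i'' 0 = 0" "s ''mul'' 0 = 0"
  shows "runs number_vertices s (40 * (length vs + 1))
    (\<lambda>s'. (\<forall>i<length vs. s' ''pos'' (vs ! i) = Suc i) \<and>
       (\<forall>b\<le>length vs. s' ''mul'' b = b * Suc (length vs)))"
proof -
  let ?n = "length vs" and ?b = "Less (reg ''i'') (reg ''n'')"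
  let ?p = "''pos''[Load ''order'' (reg ''i'')]\<^sub>r :=\<^sub>r Add (reg ''i'') (Const 1) ;;
       ''mul''[Add (reg ''i'') (Const 1)]\<^sub>r :=\<^sub>r
         Add (Load ''mul'' (reg ''i'')) (Add (reg ''n'') (Const 1)) ;;
       incr ''i''"
  let ?I = "\<lambda>i s'. s' ''i'' 0 = i \<and> (\<forall>j<i. s' ''pos'' (vs ! j) = Suc j) \<and>
       (\<forall>b\<le>i. s' ''mul'' b = b * Suc ?n)"
  have fr: "s' ''n'' 0 = ?n" "s' ''order'' = s ''order''" if "agree (writes ?p) s s'" for s'
    using agreeD[OF that, of "''n''"] agreeD[OF that, of "''order''"] assms by simp_all
  have "runs (While ?b ?p) s (6 + ?n * (6 + 30)) (\<lambda>s'. ?I ?n s' \<and> agree (writes ?p) s s')"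
  proof (rule runs_While_agree[where N = ?n and I = ?I and T = 30])
    fix i s' assume i: "i < ?n" "?I i s'" "agree (writes ?p) s s'"
    have o: "s' ''order'' i = vs ! i" using fr(2)[OF i(3)] assms(3) i(1) by simp
    have i': "s' ''i'' 0 = i" using i(2) by blast
    have ne: "vs ! j \<noteq> vs ! i" if "j < i" for j
      using that i(1) nth_eq_iff_index_eq[OF assms(1), of j i] by simp
    have r: "result ?p s' = s'(''pos'' := (s' ''pos'')(vs ! i := Suc i),
        ''mul'' := (s' ''mul'')(Suc i := s' ''mul'' i + Suc ?n), ''i'' := (s' ''i'')(0 := Suc i))"
      using i' o fr(1)[OF i(3)] by simp
    have "?I (Suc i) (result ?p s')"
      using i(2) ne unfolding r by (simp add: less_Suc_eq le_Suc_eq)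
    then have "runs ?p s' 30 (?I (Suc i))" by (intro runs_loop_free, simp, simp)
    with i i' fr[OF i(3)] show "bval ?b s' \<and> runs ?p s' 30 (?I (Suc i))" by simp
  next
    fix s' assume "?I ?n s'" "agree (writes ?p) s s'"
    with fr[of s'] show "\<not> bval ?b s'" by simp
  qed (use assms in auto)
  then show ?thesis unfolding number_vertices_def by (rule runs_mono) auto
qed

context ordered_graph
begin

section \<open>Adjacency matrix and guard lists\<close>

definition edges_entered :: "mem \<Rightarrow> bool" where
  "edges_entered s \<longleftrightarrow>
    (\<forall>a. s ''last'' a = last_nb a) \<and>
    (\<forall>i<length pl. s ''adj'' (snd (pl ! i) * Suc n + fst (pl ! i)) = Suc i) \<and>
    (\<forall>a\<le>n. \<forall>b\<le>n. (a, b) \<notin> set pl \<longrightarrow> s ''adj'' (b * Suc n + a) = 0)"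

lemma runs_enter_edges:
  assumes len: "length es = length pl" and m: "s ''m'' 0 = length es"
    and pos: "\<And>i. i < length es \<Longrightarrow>
      pl ! i = (min (s ''pos'' (s ''src'' i)) (s ''pos'' (s ''dst'' i)), max (s ''pos'' (s ''src'' i)) (s ''pos'' (s ''dst'' i)))"
    and mul: "\<And>b. b \<le> n \<Longrightarrow> s ''mul'' b = b * Suc n"
    and zero: "s ''e'' 0 = 0" "\<And>x. s ''adj'' x = 0" "\<And>x. s ''last'' x = 0"
  shows "runs enter_edges s (100 * (length es + 1)) edges_entered"
proof -
  let ?m = "length pl" and ?b = "Less (reg ''e'') (reg ''m'')"
  let ?p = "''a'' :=\<^sub>r Load ''pos'' (Load ''src'' (reg ''e'')) ;;
       ''b'' :=\<^sub>r Load ''pos'' (Load ''dst'' (reg ''e'')) ;;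
       Cond (Less (reg ''b'') (reg ''a''))
         (''x'' :=\<^sub>r reg ''a'' ;; ''a'' :=\<^sub>r reg ''b'' ;; ''b'' :=\<^sub>r reg ''x'') Skip ;;
       ''adj''[Add (Load ''mul'' (reg ''b'')) (reg ''a'')]\<^sub>r :=\<^sub>r Add (reg ''e'') (Const 1) ;;
       Cond (Less (Load ''last'' (reg ''a'')) (reg ''b''))
         (''last''[reg ''a'']\<^sub>r :=\<^sub>r reg ''b'') Skip ;;
       incr ''e''"
  let ?I = "\<lambda>e s'. s' ''e'' 0 = e \<and>
    (\<forall>a. s' ''last'' a = Max (insert 0 {b. (a, b) \<in> set (take e pl)})) \<and>
    (\<forall>i<e. s' ''adj'' (snd (pl ! i) * Suc n + fst (pl ! i)) = Suc i) \<and>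
    (\<forall>a\<le>n. \<forall>b\<le>n. (a, b) \<notin> set (take e pl) \<longrightarrow> s' ''adj'' (b * Suc n + a) = 0)"
  have fr: "s' ''m'' 0 = ?m" "s' ''pos'' = s ''pos''" "s' ''src'' = s ''src''" "s' ''dst'' = s ''dst''" "s' ''mul'' = s ''mul''"
    if "agree (writes ?p) s s'" for s'
    using agreeD[OF that, of "''m''"] agreeD[OF that, of "''pos''"] agreeD[OF that, of "''src''"]
      agreeD[OF that, of "''dst''"] agreeD[OF that, of "''mul''"] m len by simp_all
  have fin: "finite {b. (a, b) \<in> set (take e pl)}" for a e
    by (rule finite_subset[of _ "snd ` set pl"]) (force dest: in_set_takeD)+
  have "runs (While ?b ?p) s (6 + ?m * (6 + 90)) (\<lambda>s'. ?I ?m s' \<and> agree (writes ?p) s s')"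
  proof (rule runs_While_agree[where N = ?m and I = ?I and T = 90])
    fix e s' assume e: "e < ?m" "?I e s'" "agree (writes ?p) s s'"
    note fr' = fr[OF e(3)]
    obtain a b where ab: "pl ! e = (a, b)" by fastforce
    have rg: "1 \<le> a" "a < b" "b \<le> n" using pl_range[of a b] nth_mem[OF e(1)] ab by auto
    let ?x = "s ''pos'' (s ''src'' e)" and ?y = "s ''pos'' (s ''dst'' e)"
    have xy: "a = min ?x ?y" "b = max ?x ?y" using pos[of e] e(1) len ab by auto
    have e': "s' ''e'' 0 = e" using e(2) by blast
    define s2 where "s2 = result ?p s'"
    have r: "s2 ''adj'' = (s' ''adj'')(b * Suc n + a := Suc e)"
      "s2 ''last'' = (s' ''last'')(a := max (s' ''last'' a) b)" "s2 ''e'' 0 = Suc e"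
    proof -
      have mb: "s ''mul'' b = b * Suc n" using mul rg(3) by simp
      consider "?y < ?x" "a = ?y" "b = ?x" | "\<not> ?y < ?x" "a = ?x" "b = ?y" using xy by linarith
      then show "s2 ''adj'' = (s' ''adj'')(b * Suc n + a := Suc e)"
        "s2 ''last'' = (s' ''last'')(a := max (s' ''last'' a) b)" "s2 ''e'' 0 = Suc e"
        unfolding s2_def by (cases; insert mb; simp add: e' fr' max_def)+
    qed
    \<comment> \<open>Columns run from 0 to \<open>n\<close>, so the stride \<open>Suc n\<close>
      keeps different pairs in different cells and no earlier entry is overwritten.\<close>
    have inj: "b' * Suc n + a' \<noteq> b * Suc n + a" if "(a', b') \<noteq> (a, b)" "a' \<le> n" for a' b'
      using block_index_eq[of b' "Suc n" a' b a] that rg by auto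
    have tk: "set (take (Suc e) pl) = insert (a, b) (set (take e pl))"
      using e(1) ab by (simp add: take_Suc_conv_app_nth)
    have "?I (Suc e) s2"
    proof (intro conjI allI impI)
      show "s2 ''e'' 0 = Suc e" by (rule r)
    next
      fix a'
      have "{b'. (a, b') \<in> set (take (Suc e) pl)} = insert b {b'. (a, b') \<in> set (take e pl)}"
        unfolding tk by auto
      moreover have "{b'. (a', b') \<in> set (take (Suc e) pl)} = {b'. (a', b') \<in> set (take e pl)}" if "a' \<noteq> a"
        unfolding tk using that by auto
      moreover have "s' ''last'' a' = Max (insert 0 {b. (a', b) \<in> set (take e pl)})" using e(2) by blast
      moreover have "Max (insert 0 (insert b A)) = max (Max (insert 0 A)) b" if "finite A" for A :: "nat set"
        using that by (simp add: insert_commute[of 0 b] max.commute)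
      ultimately show "s2 ''last'' a' = Max (insert 0 {b. (a', b) \<in> set (take (Suc e) pl)})"
        unfolding r using fin[of a e] by (cases "a' = a") simp_all
    next
      fix i assume i: "i < Suc e"
      show "s2 ''adj'' (snd (pl ! i) * Suc n + fst (pl ! i)) = Suc i"
      proof (cases "i = e")
        case False
        then have "pl ! i \<noteq> pl ! e" using i e(1) nth_eq_iff_index_eq[OF distinct_pl, of i e] by simp
        moreover have "fst (pl ! i) \<le> n"
          using pl_range[of "fst (pl ! i)" "snd (pl ! i)"] nth_mem[of i pl] i e(1) by simp
        ultimately have "snd (pl ! i) * Suc n + fst (pl ! i) \<noteq> b * Suc n + a"
          using inj[of "fst (pl ! i)" "snd (pl ! i)"] ab by simp
        moreover have "s' ''adj'' (snd (pl ! i) * Suc n + fst (pl ! i)) = Suc i"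
          using e(2) i False by simp
        ultimately show ?thesis unfolding r by simp
      qed (use ab r in simp)
    next
      fix a' b' assume *: "a' \<le> n" "b' \<le> n" "(a', b') \<notin> set (take (Suc e) pl)"
      then have "(a', b') \<noteq> (a, b)" "s' ''adj'' (b' * Suc n + a') = 0" using e(2) unfolding tk by auto
      with inj[of a' b'] *(1) show "s2 ''adj'' (b' * Suc n + a') = 0" unfolding r by simp
    qed
    then have "runs ?p s' 90 (?I (Suc e))" unfolding s2_def by (intro runs_loop_free, simp, simp)
    moreover have "bval ?b s'" using e e' fr' by simp
    ultimately show "bval ?b s' \<and> runs ?p s' 90 (?I (Suc e))" by blast
  next
    fix s' assume "?I ?m s'" "agree (writes ?p) s s'"
    with fr[of s'] show "\<not> bval ?b s'" by simp
  qed (use zero in simp_all)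
  then show ?thesis unfolding enter_edges_def
  proof (rule runs_mono)
    fix s' assume "?I ?m s' \<and> agree (writes ?p) s s'"
    then show "edges_entered s'" unfolding edges_entered_def last_nb_def by simp
  qed (use len in simp)
qed

lemma runs_filter_guards:
  assumes b: "1 \<le> b" "b \<le> n" and s: "s ''b'' 0 = b" "s ''n'' 0 = n" "s ''s'' 0 = 0" "s ''t'' 0 = 0"
    "s ''mul'' b = b * Suc n" "\<And>a. s ''last'' a = last_nb a" "s ''len'' b = length (row b)"
    "\<And>j. j < length (row b) \<Longrightarrow> s ''G'' (b * Suc n + j) = row b ! j"
  defines "xs \<equiv> filter (\<lambda>a. b < last_nb a) (row b)"
  shows "runs filter_guards s (60 * (width + 1))
    (\<lambda>s'. s' ''t'' 0 = length xs \<and> (\<forall>i<length xs. s' ''G'' (Suc b * Suc n + i) = xs ! i) \<and>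
       (\<forall>x<Suc b * Suc n. s' ''G'' x = s ''G'' x))"
proof -
  let ?l = "length (row b)" and ?b = "Less (reg ''s'') (Load ''len'' (reg ''b''))"
  let ?p = "Cond (Less (reg ''b'') (Load ''last'' (Load ''G'' guard_addr)))
         (''G''[Add (Add (Load ''mul'' (reg ''b'')) (Add (reg ''n'') (Const 1))) (reg ''t'')]\<^sub>r :=\<^sub>r
            Load ''G'' guard_addr ;;
          incr ''t'') Skip ;;
       incr ''s''"
  let ?xs = "\<lambda>j. filter (\<lambda>a. b < last_nb a) (take j (row b))"
  let ?I = "\<lambda>j s'. s' ''s'' 0 = j \<and> s' ''t'' 0 = length (?xs j) \<and>
      (\<forall>i<length (?xs j). s' ''G'' (Suc b * Suc n + i) = ?xs j ! i) \<and>
      (\<forall>x<Suc b * Suc n. s' ''G'' x = s ''G'' x)"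
  have fr: "s' ''b'' 0 = b" "s' ''n'' 0 = n" "s' ''mul'' b = b * Suc n" "s' ''last'' = s ''last''" "s' ''len'' b = ?l"
    if "agree (writes ?p) s s'" for s'
    using agreeD[OF that, of "''b''"] agreeD[OF that, of "''n''"] agreeD[OF that, of "''mul''"]
      agreeD[OF that, of "''last''"] agreeD[OF that, of "''len''"] s by simp_all
  have len: "?l \<le> width" using length_row_le_width b by simp
  have "runs (While ?b ?p) s (7 + ?l * (7 + 48)) (\<lambda>s'. ?I ?l s' \<and> agree (writes ?p) s s')"
  proof (rule runs_While_agree[where N = ?l and I = ?I and T = 48])
    fix j s' assume j: "j < ?l" "?I j s'" "agree (writes ?p) s s'"
    note fr' = fr[OF j(3)]
    have jn: "j < Suc n" using j(1) length_row_less[of b] b by simp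
    have j': "s' ''s'' 0 = j" "s' ''t'' 0 = length (?xs j)" using j(2) by blast+
    have G: "s' ''G'' (b * Suc n + j) = row b ! j"
    proof -
      \<comment> \<open>Row \<open>b\<close> is read while row \<open>Suc b\<close> is being
        written; it is short enough to end before the written addresses begin.\<close>
      have "b * Suc n + j < Suc b * Suc n" using jn by simp
      then show ?thesis using j(2) s(8)[OF j(1)] by simp
    qed
    have tk: "?xs (Suc j) = ?xs j @ (if b < last_nb (row b ! j) then [row b ! j] else [])"
      using j(1) by (simp add: take_Suc_conv_app_nth)
    have "?I (Suc j) (result ?p s')"
    proof (cases "b < last_nb (row b ! j)")
      case True
      have r: "result ?p s' = s'(''G'' := (s' ''G'')(Suc b * Suc n + length (?xs j) := row b ! j),
          ''t'' := (s' ''t'')(0 := Suc (length (?xs j))), ''s'' := (s' ''s'')(0 := Suc j))"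
        using True fr' j' G s(6) by (simp add: ac_simps)
      show ?thesis using j(2) True unfolding r tk by (simp add: nth_append less_Suc_eq)
    next
      case False
      have r: "result ?p s' = s'(''s'' := (s' ''s'')(0 := Suc j))"
        using False fr' j' G s(6) by simp
      show ?thesis using j(2) False unfolding r tk by simp
    qed
    then have "runs ?p s' 48 (?I (Suc j))" by (intro runs_loop_free, simp, simp)
    moreover have "bval ?b s'" using j j' fr' by simp
    ultimately show "bval ?b s' \<and> runs ?p s' 48 (?I (Suc j))" by blast
  next
    fix s' assume "?I ?l s'" "agree (writes ?p) s s'"
    with fr[of s'] show "\<not> bval ?b s'" by simp
  qed (use s in simp_all)
  then show ?thesis unfolding filter_guards_def xs_def
    by (rule runs_mono) (use len in auto)
qed


lemma runs_list_guards:
  assumes s: "s ''n'' 0 = n" "\<And>b. b \<le> n \<Longrightarrow> s ''mul'' b = b * Suc n" "edges_entered s"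
    and zero: "s ''K'' 0 = 0" "s ''len'' 1 = 0"
  shows "runs list_guards s (200 * ((width + 1) * (n + 1))) static"
proof -
  let ?b = "Less (reg ''b'') (Add (reg ''n'') (Const 1))"
  let ?init = "''s'' :=\<^sub>r Const 0 ;; ''t'' :=\<^sub>r Const 0"
  let ?fin = "Cond (Less (reg ''b'') (Load ''last'' (reg ''b'')))
         (''G''[Add (Add (Load ''mul'' (reg ''b'')) (Add (reg ''n'') (Const 1))) (reg ''t'')]\<^sub>r :=\<^sub>r
            reg ''b'' ;;
          incr ''t'') Skip ;;
        ''len''[Add (reg ''b'') (Const 1)]\<^sub>r :=\<^sub>r reg ''t'' ;;
        Cond (Less (reg ''K'') (reg ''t'')) (''K'' :=\<^sub>r reg ''t'') Skip ;;
        incr ''b''"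
  let ?p = "?init ;; filter_guards ;; ?fin"
  let ?W = "\<lambda>i. Max ((\<lambda>b. length (row b)) ` {1..Suc i})"
  let ?I = "\<lambda>i s'. s' ''b'' 0 = Suc i \<and> s' ''K'' 0 = ?W i \<and>
     (\<forall>b\<in>{1..Suc i}. s' ''len'' b = length (row b)) \<and>
     (\<forall>b\<in>{1..Suc i}. \<forall>j<length (row b). s' ''G'' (b * Suc n + j) = row b ! j)"
  have wf: "writes filter_guards = {''G'', ''t'', ''s''}" unfolding filter_guards_def by auto
  have "runs list_guards s (3 + (8 + n * (8 + (6 + (60 * (width + 1) + 80))))) static"
    unfolding list_guards_def
  proof (rule runs_Seq)
    show "runs (''b'' :=\<^sub>r Const 1) s 3 (\<lambda>s'. s' = s(''b'' := (s ''b'')(0 := 1)))"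
      by (intro runs_loop_free) simp_all
  next
    fix s1 assume s1: "s1 = s(''b'' := (s ''b'')(0 := 1))"
    \<comment> \<open>The row of position 1 is empty, and its length is never stored: the initial
      zero of \<open>len\<close> serves.\<close>
    have I0: "?I 0 s1" using zero unfolding s1 by (simp add: row_1)
    have fr: "s' ''n'' 0 = n" "s' ''mul'' = s ''mul''" "s' ''last'' = s ''last''" "s' ''adj'' = s ''adj''"
      if "agree (writes ?p) s1 s'" for s'
      using agreeD[OF that, of "''n''"] agreeD[OF that, of "''mul''"] agreeD[OF that, of "''last''"]
        agreeD[OF that, of "''adj''"] s by (simp_all add: s1 wf)
    have last: "\<And>a. s ''last'' a = last_nb a" using s(3) by (simp add: edges_entered_def)
    have "runs (While ?b ?p) s1 (8 + n * (8 + (6 + (60 * (width + 1) + 80)))) (\<lambda>s'. ?I n s' \<and> agree (writes ?p) s1 s')"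
    proof (rule runs_While_agree[where N = n and I = ?I and T = "6 + (60 * (width + 1) + 80)"])
      fix i s' assume i: "i < n" "?I i s'" "agree (writes ?p) s1 s'"
      note fr' = fr[OF i(3)]
      let ?bb = "Suc i"
      have b: "1 \<le> ?bb" "?bb \<le> n" using i(1) by auto
      have s': "s' ''b'' 0 = ?bb" "s' ''K'' 0 = ?W i" "\<And>b. b \<in> {1..?bb} \<Longrightarrow> s' ''len'' b = length (row b)"
        "\<And>b j. b \<in> {1..?bb} \<Longrightarrow> j < length (row b) \<Longrightarrow> s' ''G'' (b * Suc n + j) = row b ! j"
        using i(2) by blast+
      have mul: "s ''mul'' ?bb = ?bb * Suc n" using s(2) b by blast
      have "runs ?p s' (6 + (60 * (width + 1) + 80)) (?I (Suc i))"
      proof (rule runs_Seq)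
        show "runs ?init s' 6 (\<lambda>s''. s'' = result ?init s')" by (intro runs_loop_free) simp_all
      next
        fix s2 assume s2: "s2 = result ?init s'"
        have eq2: "s2 ''b'' = s' ''b''" "s2 ''n'' = s' ''n''" "s2 ''s'' 0 = 0" "s2 ''t'' 0 = 0"
          "s2 ''mul'' = s' ''mul''" "s2 ''last'' = s' ''last''" "s2 ''len'' = s' ''len''" "s2 ''G'' = s' ''G''"
          "s2 ''K'' = s' ''K''"
          unfolding s2 by simp_all
        let ?xs = "filter (\<lambda>a. ?bb < last_nb a) (row ?bb)"
        have "runs filter_guards s2 (60 * (width + 1))
          (\<lambda>s'. (s' ''t'' 0 = length ?xs \<and> (\<forall>i<length ?xs. s' ''G'' (Suc ?bb * Suc n + i) = ?xs ! i) \<and>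
             (\<forall>x<Suc ?bb * Suc n. s' ''G'' x = s2 ''G'' x)) \<and> agree (writes filter_guards) s2 s')"
        proof (rule runs_agree[OF runs_filter_guards[OF b]])
          show "s2 ''b'' 0 = ?bb" "s2 ''n'' 0 = n" "s2 ''s'' 0 = 0" "s2 ''t'' 0 = 0"
            "s2 ''mul'' ?bb = ?bb * Suc n" "s2 ''len'' ?bb = length (row ?bb)"
            unfolding eq2 fr' by (rule s'(1) refl mul s'(3))+ simp
          show "s2 ''last'' a = last_nb a" for a unfolding eq2 fr' by (rule last)
          show "s2 ''G'' (?bb * Suc n + j) = row ?bb ! j" if "j < length (row ?bb)" for j
            unfolding eq2 by (rule s'(4)[OF _ that]) simp
        qed
        then show "runs (filter_guards ;; ?fin) s2 (60 * (width + 1) + 80) (?I (Suc i))"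
        proof (rule runs_Seq, elim conjE)
          fix s3
          assume t: "s3 ''t'' 0 = length ?xs" and G: "\<forall>i<length ?xs. s3 ''G'' (Suc ?bb * Suc n + i) = ?xs ! i"
            and old: "\<forall>x<Suc ?bb * Suc n. s3 ''G'' x = s2 ''G'' x" and ag: "agree (writes filter_guards) s2 s3"
          define M where "M = ?W i"
          have eq3: "s3 ''b'' 0 = ?bb" "s3 ''n'' 0 = n" "s3 ''mul'' ?bb = ?bb * Suc n" "s3 ''last'' = last_nb"
            "s3 ''len'' = s' ''len''" "s3 ''K'' 0 = M"
            using agreeD[OF ag, of "''b''"] agreeD[OF ag, of "''n''"] agreeD[OF ag, of "''mul''"]
              agreeD[OF ag, of "''last''"] agreeD[OF ag, of "''len''"] agreeD[OF ag, of "''K''"] eq2 s' fr' mul last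
            by (simp_all add: wf fun_eq_iff M_def)
          have row: "row (Suc ?bb) = ?xs @ (if ?bb < last_nb ?bb then [?bb] else [])"
            using row_Suc[OF b(1)] .
          let ?s4 = "result ?fin s3"
          define Gn where "Gn = (if ?bb < last_nb ?bb then (s3 ''G'')(Suc ?bb * Suc n + length ?xs := ?bb) else s3 ''G'')"
          have r: "?s4 ''b'' 0 = Suc ?bb" "?s4 ''G'' = Gn"
            "?s4 ''len'' = (s' ''len'')(Suc ?bb := length (row (Suc ?bb)))"
            "?s4 ''K'' 0 = max M (length (row (Suc ?bb)))"
            using eq3 t by (simp_all add: Gn_def row max_def ac_simps)
          have Wm: "?W (Suc i) = max M (length (row (Suc ?bb)))"
          proof -
            have "{1..Suc ?bb} = insert (Suc ?bb) {1..?bb}" by auto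
            then show ?thesis by (simp add: max.commute M_def)
          qed
          have Gold: "Gn (b' * Suc n + j) = row b' ! j" if b': "b' \<in> {1..?bb}" and j: "j < length (row b')" for b' j
          proof -
            have "j < Suc n" using length_row_less[of b'] b' j b by simp
            then have "b' * Suc n + j < Suc b' * Suc n" by simp
            also have "\<dots> \<le> Suc ?bb * Suc n" using b' by (intro mult_le_mono1) auto
            finally have lt: "b' * Suc n + j < Suc ?bb * Suc n" .
            then have "Gn (b' * Suc n + j) = s3 ''G'' (b' * Suc n + j)" unfolding Gn_def by auto
            also have "\<dots> = row b' ! j" using old lt s'(4)[OF b' j] eq2 by simp
            finally show ?thesis .
          qed
          have Gnew: "Gn (Suc ?bb * Suc n + j) = row (Suc ?bb) ! j" if "j < length (row (Suc ?bb))" for j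
            using that G unfolding row Gn_def by (auto simp: nth_append)
          have "?I (Suc i) ?s4"
            unfolding r Wm
          proof (intro conjI ballI allI impI refl)
            fix b' assume b': "b' \<in> {1..Suc ?bb}"
            show "((s' ''len'')(Suc ?bb := length (row (Suc ?bb)))) b' = length (row b')"
              using s'(3)[of b'] b' by (cases "b' = Suc ?bb") simp_all
            fix j assume j: "j < length (row b')"
            show "Gn (b' * Suc n + j) = row b' ! j"
            proof (cases "b' = Suc ?bb")
              case True
              with Gnew j show ?thesis by blast
            next
              case False
              with b' have "b' \<in> {1..?bb}" by simp
              with Gold j show ?thesis by blast
            qed
          qed
          then show "runs ?fin s3 80 (?I (Suc i))" by (intro runs_loop_free, simp, simp)
        qed
      qed
      moreover have "bval ?b s'" using i s' fr' by simp
      ultimately show "bval ?b s' \<and> runs ?p s' (6 + (60 * (width + 1) + 80)) (?I (Suc i))" by blast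
    next
      fix s' assume "?I n s'" "agree (writes ?p) s1 s'"
      with fr[of s'] show "\<not> bval ?b s'" by simp
    qed (use I0 in simp_all)
    then show "runs (While ?b ?p) s1 (8 + n * (8 + (6 + (60 * (width + 1) + 80)))) static"
    proof (rule runs_mono)
      fix s' assume s': "?I n s' \<and> agree (writes ?p) s1 s'"
      note fr' = fr[OF conjunct2[OF s']]
      show "static s'" unfolding static_def
      proof (intro conjI)
        show "s' ''K'' 0 = width" using s' by (simp add: width_def)
        show "\<forall>b\<le>n. s' ''mul'' b = b * Suc n" using s(2) fr'(2) by simp
        show "\<forall>b\<in>{1..Suc n}. s' ''len'' b = length (row b)" using s' by blast
        show "\<forall>b\<in>{1..n}. \<forall>j<length (row b). s' ''G'' (b * Suc n + j) = row b ! j" using s' by auto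
      qed (use s(3) fr' in \<open>simp_all add: edges_entered_def\<close>)
    qed simp
  qed
  then show ?thesis by (rule runs_mono) (simp_all add: algebra_simps)
qed

lemma runs_book_program:
  assumes vs: "distinct vs" "length vs = n" and len: "length es = length pl"
    and pos: "\<And>i. i < n \<Longrightarrow> pos (vs ! i) = Suc i"
    and es: "\<And>i. i < length es \<Longrightarrow> fst (es ! i) \<in> set vs \<and> snd (es ! i) \<in> set vs \<and>
      pl ! i = (min (pos (fst (es ! i))) (pos (snd (es ! i))), max (pos (fst (es ! i))) (pos (snd (es ! i))))"
  shows "runs book_program (input_mem vs es) (3000 * ((width + 1) ^ 3 * codes width ^ 2 * (n + 1)))
    (\<lambda>s. embeds thickness (page_of s))"
proof -
  define s0 where "s0 = input_mem vs es"
  have in0: "s0 ''n'' 0 = n" "\<And>i. i < n \<Longrightarrow> s0 ''order'' i = vs ! i" "s0 ''m'' 0 = length es"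
    "\<And>i. i < length es \<Longrightarrow> s0 ''src'' i = fst (es ! i)" "\<And>i. i < length es \<Longrightarrow> s0 ''dst'' i = snd (es ! i)"
    using vs(2) unfolding s0_def input_mem_def array_def by auto
  have z0: "s0 ''i'' 0 = 0" "s0 ''mul'' 0 = 0" "s0 ''e'' 0 = 0" "\<And>x. s0 ''adj'' x = 0" "\<And>x. s0 ''last'' x = 0"
    "s0 ''K'' 0 = 0" "s0 ''len'' 1 = 0"
    unfolding s0_def input_mem_def by auto
  have w: "writes number_vertices = {''pos'', ''mul'', ''i''}"
    "writes enter_edges = {''a'', ''b'', ''x'', ''adj'', ''last'', ''e''}"
    unfolding number_vertices_def enter_edges_def by auto
  have "runs book_program s0 (40 * (n + 1) + (100 * (length es + 1) + (200 * ((width + 1) * (n + 1)) +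
     (1000 * ((width + 1) ^ 3 * codes width ^ 2 * (n + 1)) + 700 * ((width + 1) * (thickness + 1)) * (n + 1)))))
     (\<lambda>s. embeds thickness (page_of s))"
    unfolding book_program_def
  proof (rule runs_Seq)
    show "runs number_vertices s0 (40 * (n + 1)) (\<lambda>s'. ((\<forall>i<n. s' ''pos'' (vs ! i) = Suc i) \<and>
       (\<forall>b\<le>n. s' ''mul'' b = b * Suc n)) \<and> agree (writes number_vertices) s0 s')"
      using runs_agree[OF runs_number_vertices[of vs s0]] vs in0 z0 by simp
  next
    fix s1
    assume "((\<forall>i<n. s1 ''pos'' (vs ! i) = Suc i) \<and> (\<forall>b\<le>n. s1 ''mul'' b = b * Suc n)) \<and>
      agree (writes number_vertices) s0 s1"
    then have p1: "\<And>i. i < n \<Longrightarrow> s1 ''pos'' (vs ! i) = Suc i" and m1: "\<And>b. b \<le> n \<Longrightarrow> s1 ''mul'' b = b * Suc n"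
      and ag1: "agree (writes number_vertices) s0 s1" by blast+
    have eq1: "s1 x = s0 x" if "x \<notin> {''pos'', ''mul'', ''i''}" for x using agreeD[OF ag1] that by (simp add: w)
    have P: "s1 ''pos'' v = pos v" if "v \<in> set vs" for v
      using that p1 pos vs(2) by (metis in_set_conv_nth)
    have "runs enter_edges s1 (100 * (length es + 1)) (\<lambda>s'. edges_entered s' \<and> agree (writes enter_edges) s1 s')"
    proof (rule runs_agree[OF runs_enter_edges[OF len]])
      fix i assume i: "i < length es"
      then have "s1 ''src'' i = fst (es ! i)" "s1 ''dst'' i = snd (es ! i)" using in0 eq1 by simp_all
      with es[OF i] P show "pl ! i = (min (s1 ''pos'' (s1 ''src'' i)) (s1 ''pos'' (s1 ''dst'' i)),
         max (s1 ''pos'' (s1 ''src'' i)) (s1 ''pos'' (s1 ''dst'' i)))" by simp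
    qed (use m1 in0 z0 eq1 in auto)
    then show "runs (enter_edges ;; list_guards ;; find_pages ;; output_pages) s1
      (100 * (length es + 1) + (200 * ((width + 1) * (n + 1)) +
     (1000 * ((width + 1) ^ 3 * codes width ^ 2 * (n + 1)) + 700 * ((width + 1) * (thickness + 1)) * (n + 1))))
     (\<lambda>s. embeds thickness (page_of s))"
    proof (rule runs_Seq)
      fix s2 assume s2: "edges_entered s2 \<and> agree (writes enter_edges) s1 s2"
      have eq2: "s2 x = s1 x" if "x \<notin> {''a'', ''b'', ''x'', ''adj'', ''last'', ''e''}" for x
        using agreeD[OF conjunct2[OF s2]] that by (simp add: w)
      have "runs list_guards s2 (200 * ((width + 1) * (n + 1))) static"
        by (rule runs_list_guards) (use s2 eq2 eq1 in0 z0 m1 in auto)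
      then show "runs (list_guards ;; find_pages ;; output_pages) s2 (200 * ((width + 1) * (n + 1)) +
         (1000 * ((width + 1) ^ 3 * codes width ^ 2 * (n + 1)) + 700 * ((width + 1) * (thickness + 1)) * (n + 1)))
         (\<lambda>s. embeds thickness (page_of s))"
        by (rule runs_Seq) (rule runs_Seq[OF runs_find_pages runs_output_pages[OF _ thickness_embeds]])
    qed
  qed
  then show ?thesis unfolding s0_def
  proof (rule runs_mono)
    obtain M where M: "codes width = Suc M" using not0_implies_Suc[of "codes width"] by (auto simp: codes_def)
    \<comment> \<open>Replacing the number of edges by \<open>n * width\<close> and the number of
      pages by \<open>width\<close> leaves a bound linear in \<open>n\<close>.\<close>
    have "40 * (n + 1) + (100 * (length es + 1) + (200 * ((width + 1) * (n + 1)) +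
       (1000 * ((width + 1) ^ 3 * codes width ^ 2 * (n + 1)) + 700 * ((width + 1) * (thickness + 1)) * (n + 1)))) \<le>
       40 * (n + 1) + (100 * (n * width + 1) + (200 * ((width + 1) * (n + 1)) +
       (1000 * ((width + 1) ^ 3 * codes width ^ 2 * (n + 1)) + 700 * ((width + 1) * (width + 1)) * (n + 1))))"
      using length_pl_le len thickness_le_width
      by (intro add_mono mult_le_mono le_refl) auto
    also have "\<dots> \<le> 3000 * ((width + 1) ^ 3 * codes width ^ 2 * (n + 1))"
      unfolding M by (simp add: algebra_simps power2_eq_square power3_eq_cube)
    finally show "40 * (n + 1) + (100 * (length es + 1) + (200 * ((width + 1) * (n + 1)) +
       (1000 * ((width + 1) ^ 3 * codes width ^ 2 * (n + 1)) + 700 * ((width + 1) * (thickness + 1)) * (n + 1)))) \<le>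
       3000 * ((width + 1) ^ 3 * codes width ^ 2 * (n + 1))" .
  qed simp
qed

end

section \<open>From positions to vertices\<close>

locale presented_graph =
  fixes V :: "nat set" and E :: "nat set set" and r :: "nat rel" and vs :: "nat list"
    and es :: "(nat \<times> nat) list"
  assumes graph: "simple_graph V E" and order: "strict_linear_order_on V r"
    and pres: "presents vs es V E r"
begin

definition pos :: "nat \<Rightarrow> nat" where
  "pos v = Suc (SOME i. i < length vs \<and> vs ! i = v)"

definition positions :: "nat \<times> nat \<Rightarrow> nat \<times> nat" where
  "positions e = (min (pos (fst e)) (pos (snd e)), max (pos (fst e)) (pos (snd e)))"

definition vertex :: "nat \<Rightarrow> nat" where
  "vertex a = vs ! (a - 1)"

lemma set_vs: "set vs = V" and sorted_vs: "sorted_wrt (\<lambda>u v. (u, v) \<in> r) vs"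
  and edges_es: "edge ` set es = E" and distinct_edges: "distinct (map edge es)"
  using pres by (auto simp: presents_def)

lemma r_trans: "(u, v) \<in> r \<Longrightarrow> (v, w) \<in> r \<Longrightarrow> (u, w) \<in> r" and r_irrefl: "(u, u) \<notin> r"
  using order by (auto simp: strict_linear_order_on_def irrefl_def dest: transD)

lemma distinct_vs: "distinct vs"
  unfolding distinct_conv_nth using sorted_wrt_nth_less[OF sorted_vs] r_irrefl
  by (metis linorder_neqE_nat)

lemma pos_nth: "i < length vs \<Longrightarrow> pos (vs ! i) = Suc i"
  unfolding pos_def by (subst some_equality[of _ i]) (auto simp: nth_eq_iff_index_eq[OF distinct_vs])

lemma pos_cases:
  assumes "v \<in> V"
  obtains i where "i < length vs" "v = vs ! i" "pos v = Suc i"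
  using assms set_vs pos_nth by (metis in_set_conv_nth)

lemma pos_range: "v \<in> V \<Longrightarrow> 1 \<le> pos v \<and> pos v \<le> length vs"
  by (erule pos_cases) auto

lemma vertex_pos: "v \<in> V \<Longrightarrow> vertex (pos v) = v"
  by (erule pos_cases) (simp add: vertex_def)

lemma pos_vertex: "1 \<le> a \<Longrightarrow> a \<le> length vs \<Longrightarrow> pos (vertex a) = a \<and> vertex a \<in> V"
  unfolding vertex_def using pos_nth[of "a - 1"] nth_mem[of "a - 1" vs] set_vs by simp

lemma pos_inj: "u \<in> V \<Longrightarrow> v \<in> V \<Longrightarrow> pos u = pos v \<longleftrightarrow> u = v"
  using vertex_pos by metis

text \<open>Sortedness of \<open>vs\<close> gives one direction. The other follows because positions
  are comparable and \<open>r\<close> is transitive and irreflexive.\<close>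

lemma r_iff_pos:
  assumes "u \<in> V" "v \<in> V"
  shows "(u, v) \<in> r \<longleftrightarrow> pos u < pos v"
proof -
  have *: "(x, y) \<in> r" if "x \<in> V" "y \<in> V" "pos x < pos y" for x y
    using that sorted_wrt_nth_less[OF sorted_vs] by (auto elim!: pos_cases)
  show ?thesis
  proof
    assume uv: "(u, v) \<in> r"
    show "pos u < pos v"
    proof (rule ccontr)
      assume "\<not> pos u < pos v"
      then consider "pos u = pos v" | "pos v < pos u" by linarith
      then show False
      proof cases
        case 1
        with uv r_irrefl pos_inj[OF assms] show False by simp
      next
        case 2
        with * assms uv r_trans r_irrefl show False by blast
      qed
    qed
  qed (use * assms in blast)
qed

lemma edge_in_V:
  assumes "{u, v} \<in> E"
  shows "u \<in> V" "v \<in> V" "u \<noteq> v"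
proof -
  have "{u, v} \<subseteq> V" "card {u, v} = 2" using assms graph by (auto simp: simple_graph_def)
  then show "u \<in> V" "v \<in> V" "u \<noteq> v" by auto
qed

lemma es_in_V:
  assumes "e \<in> set es"
  shows "fst e \<in> V" "snd e \<in> V" "fst e \<noteq> snd e"
proof -
  have "{fst e, snd e} \<in> E" using assms edges_es unfolding edge_def by blast
  from edge_in_V[OF this] show "fst e \<in> V" "snd e \<in> V" "fst e \<noteq> snd e" by blast+
qed

lemma edge_positions:
  assumes "e \<in> set es"
  shows "edge e = {vertex (fst (positions e)), vertex (snd (positions e))}"
  using es_in_V[OF assms] vertex_pos unfolding edge_def positions_def by (auto simp: min_def max_def)

sublocale ordered_graph "length vs" "map positions es"
proof
  \<comment> \<open>An edge can be recovered from its pair of positions, so distinct edges force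
    distinct pairs.\<close>
  have "map edge es = map (\<lambda>p. {vertex (fst p), vertex (snd p)}) (map positions es)"
    using edge_positions by simp
  with distinct_edges show "distinct (map positions es)" by (metis distinct_map)
next
  fix a b assume "(a, b) \<in> set (map positions es)"
  then obtain e where e: "e \<in> set es" "positions e = (a, b)" by auto
  have "pos (fst e) \<noteq> pos (snd e)" using es_in_V[OF e(1)] pos_inj by blast
  moreover have "1 \<le> pos (fst e) \<and> pos (fst e) \<le> length vs" "1 \<le> pos (snd e) \<and> pos (snd e) \<le> length vs"
    using es_in_V[OF e(1)] pos_range by blast+
  ultimately show "1 \<le> a \<and> a < b \<and> b \<le> length vs"
    using e(2) unfolding positions_def by (auto simp: min_def max_def split: if_splits)
qed

lemma edge_iff:
  assumes "u \<in> V" "v \<in> V" "pos u < pos v"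
  shows "{u, v} \<in> E \<longleftrightarrow> (pos u, pos v) \<in> set (map positions es)"
proof
  assume "{u, v} \<in> E"
  then obtain e where e: "e \<in> set es" "{fst e, snd e} = {u, v}" using edges_es unfolding edge_def by blast
  then have "positions e = (pos u, pos v)"
    using assms(3) unfolding positions_def doubleton_eq_iff by auto
  with e(1) show "(pos u, pos v) \<in> set (map positions es)" by force
next
  assume "(pos u, pos v) \<in> set (map positions es)"
  then obtain e where e: "e \<in> set es" "positions e = (pos u, pos v)" by auto
  then have "edge e = {u, v}" using edge_positions[OF e(1)] vertex_pos assms by simp
  with e(1) edges_es show "{u, v} \<in> E" by blast
qed

lemma edge_cases:
  assumes "e \<in> E"
  obtains u v where "e = {u, v}" "u \<in> V" "v \<in> V" "pos u < pos v" "(pos u, pos v) \<in> set (map positions es)"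
proof -
  obtain x y where xy: "e = {x, y}" using assms edges_es unfolding edge_def by blast
  have *: "x \<in> V" "y \<in> V" "x \<noteq> y" using edge_in_V[of x y] assms xy by auto
  then have "pos x \<noteq> pos y" using pos_inj by blast
  then consider "pos x < pos y" | "pos y < pos x" by linarith
  then show ?thesis
  proof cases
    case 1
    with that[of x y] xy * assms edge_iff[of x y] show ?thesis by simp
  next
    case 2
    with that[of y x] xy * assms edge_iff[of y x] show ?thesis by (simp add: insert_commute)
  qed
qed

section \<open>Translation between page assignments on positions and book embeddings\<close>

lemma embeds_if_book_embedding:
  assumes "book_embedding k V E r \<sigma>"
  shows "embeds k (\<lambda>(a, b). \<sigma> {vertex a, vertex b})"
proof -
  have be: "\<And>e. e \<in> E \<Longrightarrow> \<sigma> e \<in> {1..k}"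
    "\<And>u v w x. {u, v} \<in> E \<Longrightarrow> {w, x} \<in> E \<Longrightarrow> (u, w) \<in> r \<Longrightarrow> (w, v) \<in> r \<Longrightarrow> (v, x) \<in> r \<Longrightarrow> \<sigma> {u, v} \<noteq> \<sigma> {w, x}"
    using assms unfolding book_embedding_def by blast+
  have V: "vertex a \<in> V \<and> vertex b \<in> V \<and> pos (vertex a) = a \<and> pos (vertex b) = b \<and> {vertex a, vertex b} \<in> E"
    if "(a, b) \<in> set (map positions es)" for a b
  proof -
    have "1 \<le> a \<and> a < b \<and> b \<le> length vs" using pl_range[OF that] .
    then have *: "pos (vertex a) = a" "pos (vertex b) = b" "vertex a \<in> V" "vertex b \<in> V" "a < b"
      using pos_vertex[of a] pos_vertex[of b] by auto
    with edge_iff[of "vertex a" "vertex b"] that show ?thesis by simp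
  qed
  show ?thesis unfolding embeds_def
  proof (intro conjI ballI allI impI)
    fix e assume e: "e \<in> set (map positions es)"
    obtain a b where ab: "e = (a, b)" by fastforce
    with e V[of a b] be(1) show "(case e of (a, b) \<Rightarrow> \<sigma> {vertex a, vertex b}) \<in> {1..k}" by simp
  next
    fix a b c d
    assume *: "(a, b) \<in> set (map positions es) \<and> (c, d) \<in> set (map positions es) \<and> a < c \<and> c < b \<and> b < d"
    then have 1: "vertex a \<in> V" "vertex b \<in> V" "pos (vertex a) = a" "pos (vertex b) = b" "{vertex a, vertex b} \<in> E"
      and 2: "vertex c \<in> V" "vertex d \<in> V" "pos (vertex c) = c" "pos (vertex d) = d" "{vertex c, vertex d} \<in> E"
      using V by blast+
    have "\<sigma> {vertex a, vertex b} \<noteq> \<sigma> {vertex c, vertex d}"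
      by (rule be(2)) (use * 1 2 in \<open>simp_all add: r_iff_pos\<close>)
    then show "(case (a, b) of (a, b) \<Rightarrow> \<sigma> {vertex a, vertex b}) \<noteq> (case (c, d) of (a, b) \<Rightarrow> \<sigma> {vertex a, vertex b})"
      by simp
  qed
qed

text \<open>An edge is an unordered set while \<open>col\<close> expects the left position first;
  \<open>Min\<close> and \<open>Max\<close> sort the endpoints.\<close>

definition colour :: "(nat \<times> nat \<Rightarrow> nat) \<Rightarrow> nat set \<Rightarrow> nat" where
  "colour col e = col (Min (pos ` e), Max (pos ` e))"

lemma colour_edge: "colour col {u, v} = col (min (pos u) (pos v), max (pos u) (pos v))"
  unfolding colour_def by simp

lemma book_embedding_if_embeds:
  assumes "embeds k col"
  shows "book_embedding k V E r (colour col)"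
proof -
  have em: "\<And>e. e \<in> set (map positions es) \<Longrightarrow> col e \<in> {1..k}"
    "\<And>a b c d. (a, b) \<in> set (map positions es) \<Longrightarrow> (c, d) \<in> set (map positions es) \<Longrightarrow> a < c \<Longrightarrow> c < b \<Longrightarrow> b < d
      \<Longrightarrow> col (a, b) \<noteq> col (c, d)"
    using assms unfolding embeds_def by blast+
  show ?thesis unfolding book_embedding_def
  proof (intro conjI ballI notI; (elim exE conjE)?)
    show "strict_linear_order_on V r" by (rule order)
  next
    fix e assume "e \<in> E"
    then obtain u v where "e = {u, v}" "pos u < pos v" "(pos u, pos v) \<in> set (map positions es)"
      by (rule edge_cases)
    with em(1) show "colour col e \<in> {1..k}" by (simp add: colour_edge min_def max_def)
  next
    fix u v w x
    assume e: "{u, v} \<in> E" "{w, x} \<in> E" and c: "colour col {u, v} = colour col {w, x}"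
      and rs: "(u, w) \<in> r" "(w, v) \<in> r" "(v, x) \<in> r"
    note V = edge_in_V[OF e(1)] edge_in_V[OF e(2)]
    have p: "pos u < pos w" "pos w < pos v" "pos v < pos x" using rs V r_iff_pos by blast+
    then have "(pos u, pos v) \<in> set (map positions es)" "(pos w, pos x) \<in> set (map positions es)"
      using edge_iff[of u v] edge_iff[of w x] V e by auto
    with em(2) p have "col (pos u, pos v) \<noteq> col (pos w, pos x)" by blast
    with c p show False by (simp add: colour_edge min_def max_def)
  qed
qed

text \<open>The translations in both directions keep the number of pages, so the two minima range
  over the same set.\<close>

lemma fobt_eq_thickness: "fobt V E r = thickness"
proof -
  have "(\<exists>\<sigma>. book_embedding k V E r \<sigma>) \<longleftrightarrow> (\<exists>col. embeds k col)" for k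
    using embeds_if_book_embedding book_embedding_if_embeds by blast
  then show ?thesis unfolding fobt_def thickness_def by simp
qed

lemma colour_es:
  assumes "i < length es"
  shows "colour col (edge (es ! i)) = col (positions (es ! i))"
  unfolding edge_def colour_edge positions_def ..

section \<open>Guard sets and pathwidth\<close>

lemma guard_set_eq:
  assumes "v \<in> V"
  shows "guard_set V E r v = vertex ` set (row (pos v))"
proof (intro equalityI subsetI)
  fix u assume "u \<in> guard_set V E r v"
  then obtain w where u: "u \<in> V" "(u, v) \<in> r" "w \<in> V" "w = v \<or> (v, w) \<in> r" "{u, w} \<in> E"
    unfolding guard_set_def by blast
  then have "pos u < pos v" "pos v \<le> pos w" using assms r_iff_pos by auto
  moreover from this have "(pos u, pos w) \<in> set (map positions es)" using edge_iff[of u w] u by simp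
  ultimately have "pos u \<in> set (row (pos v))" unfolding set_row_iff by blast
  then show "u \<in> vertex ` set (row (pos v))" using vertex_pos[OF u(1)] by (metis imageI)
next
  fix u assume "u \<in> vertex ` set (row (pos v))"
  then obtain a where a: "u = vertex a" "a \<in> set (row (pos v))" by blast
  then obtain b where b: "a < pos v" "pos v \<le> b" "(a, b) \<in> set (map positions es)"
    unfolding set_row_iff by blast
  then have "1 \<le> a \<and> a < b \<and> b \<le> length vs" using pl_range by blast
  then have *: "pos u = a" "u \<in> V" "pos (vertex b) = b" "vertex b \<in> V" "a < b"
    using pos_vertex[of a] pos_vertex[of b] a(1) by auto
  have "{u, vertex b} \<in> E" using edge_iff[of u "vertex b"] * b(3) by simp
  moreover have "(u, v) \<in> r" using r_iff_pos[of u v] * assms b by simp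
  moreover have "vertex b = v \<or> (v, vertex b) \<in> r"
    using r_iff_pos[of v "vertex b"] pos_inj[of v "vertex b"] * assms b(2) by auto
  ultimately show "u \<in> guard_set V E r v" unfolding guard_set_def using * by blast
qed

lemma card_guard_set:
  assumes "v \<in> V"
  shows "card (guard_set V E r v) = length (row (pos v))"
proof -
  have "inj_on vertex (set (row (pos v)))"
  proof (rule inj_onI)
    fix a b assume ab: "a \<in> set (row (pos v))" "b \<in> set (row (pos v))" "vertex a = vertex b"
    have "pos v \<le> length vs" using pos_range[OF assms] by simp
    with ab have "1 \<le> a \<and> a \<le> length vs" "1 \<le> b \<and> b \<le> length vs" by (auto simp: set_row)
    then have "pos (vertex a) = a" "pos (vertex b) = b" using pos_vertex by blast+
    with ab(3) show "a = b" by metis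
  qed
  then show ?thesis unfolding guard_set_eq[OF assms] by (simp add: card_image distinct_card[OF distinct_row])
qed

lemma pathwidth_eq_width:
  assumes "V \<noteq> {}"
  shows "pathwidth V E r = width"
proof -
  have pos_V: "pos ` V = {1..length vs}"
  proof (intro equalityI subsetI)
    fix a assume "a \<in> {1..length vs}"
    then show "a \<in> pos ` V" using pos_vertex[of a] by (metis atLeastAtMost_iff imageI)
  qed (use pos_range in auto)
  then have ne: "{1..length vs} \<noteq> {}" using assms by auto
  have "(\<lambda>v. card (guard_set V E r v)) ` V = (\<lambda>b. length (row b)) ` pos ` V"
    by (auto simp: card_guard_set image_iff)
  then have "pathwidth V E r = Max ((\<lambda>b. length (row b)) ` {1..length vs})"
    unfolding pathwidth_def pos_V by simp
  \<comment> \<open>The maximum defining \<open>width\<close> has one index more, whose row is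
    empty.\<close>
  moreover have "{1..Suc (length vs)} = insert (Suc (length vs)) {1..length vs}" by auto
  then have "width = max (length (row (Suc (length vs)))) (Max ((\<lambda>b. length (row b)) ` {1..length vs}))"
    unfolding width_def using ne by simp
  ultimately show ?thesis by (simp add: row_end)
qed

lemma book_program_correct:
  "runs book_program (input_mem vs es) (3000 * ((width + 1) ^ 3 * codes width ^ 2 * (length vs + 1)))
    (\<lambda>s. \<exists>\<sigma>. (\<forall>i<length es. s ''page'' i = \<sigma> (edge (es ! i))) \<and> book_embedding (fobt V E r) V E r \<sigma>)"
proof (rule runs_mono[OF runs_book_program[where pos = pos]])
  fix i assume "i < length es"
  then show "fst (es ! i) \<in> set vs \<and> snd (es ! i) \<in> set vs \<and> map positions es ! i =
      (min (pos (fst (es ! i))) (pos (snd (es ! i))), max (pos (fst (es ! i))) (pos (snd (es ! i))))"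
    using es_in_V[of "es ! i"] set_vs by (simp add: positions_def)
next
  fix s assume "embeds thickness (page_of s)"
  then have "book_embedding (fobt V E r) V E r (colour (page_of s))"
    unfolding fobt_eq_thickness by (rule book_embedding_if_embeds)
  moreover have "s ''page'' i = colour (page_of s) (edge (es ! i))" if "i < length es" for i
    using page_of_nth[of i s] that by (simp add: colour_es)
  ultimately show "\<exists>\<sigma>. (\<forall>i<length es. s ''page'' i = \<sigma> (edge (es ! i))) \<and> book_embedding (fobt V E r) V E r \<sigma>"
    by blast
qed (use distinct_vs pos_nth in auto)

lemma card_V: "card V = length vs"
  using distinct_card[OF distinct_vs] set_vs by simp

end

text \<open>For \<open>w \<ge> 2\<close>, the inequality \<open>w + 1 \<le> w\<^sup>2\<close> bounds
  the cube by \<open>w ^ 6\<close>, and the base 2 is replaced by \<open>w\<close>; the exponents 6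
  and 2 add up to 8. For \<open>w \<le> 1\<close> the power on the right is 1, by
  \<open>0 ^ 0 = 1\<close> in case \<open>w = 0\<close>, and \<open>w = 1\<close> makes the left
  factor \<open>8 * 4\<close>, the origin of 32. Finally 192000 is \<open>3000 * 32 * 2\<close>,
  where the 2 comes from \<open>n + 1 \<le> 2 * n\<close>.\<close>

lemma time_bound:
  fixes w n :: nat
  assumes "1 \<le> n"
  shows "3000 * ((w + 1) ^ 3 * (2 ^ (w * w)) ^ 2 * (n + 1)) \<le> 192000 * n * w ^ (8 * w\<^sup>2)"
proof -
  have key: "(w + 1) ^ 3 * (2 ^ (w * w)) ^ 2 \<le> 32 * w ^ (8 * w\<^sup>2)"
  proof (cases "w \<le> 1")
    case True
    then consider "w = 0" | "w = 1" by linarith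
    then show ?thesis by cases (simp_all add: eval_nat_numeral)
  next
    case False
    then have w: "2 \<le> w" by simp
    have "2 * w \<le> w * w" using w by simp
    then have "w + 1 \<le> w ^ 2" using w unfolding power2_eq_square by linarith
    then have "(w + 1) ^ 3 \<le> (w ^ 2) ^ 3" by (rule power_mono) simp
    also have "\<dots> = w ^ 6" by (simp flip: power_mult)
    also have "\<dots> \<le> w ^ (6 * w\<^sup>2)" using w by (intro power_increasing) auto
    finally have 1: "(w + 1) ^ 3 \<le> w ^ (6 * w\<^sup>2)" .
    have "((2::nat) ^ (w * w)) ^ 2 = 2 ^ (2 * w\<^sup>2)"
      by (simp add: power2_eq_square mult_2 power_add)
    also have "\<dots> \<le> w ^ (2 * w\<^sup>2)" using w by (intro power_mono) auto
    finally have "(w + 1) ^ 3 * (2 ^ (w * w)) ^ 2 \<le> w ^ (6 * w\<^sup>2) * w ^ (2 * w\<^sup>2)"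
      using 1 by (rule mult_le_mono[rotated])
    also have "\<dots> = w ^ (8 * w\<^sup>2)" by (simp flip: power_add)
    finally show ?thesis by simp
  qed
  have "3000 * ((w + 1) ^ 3 * (2 ^ (w * w)) ^ 2 * (n + 1)) \<le> 3000 * (32 * w ^ (8 * w\<^sup>2) * (2 * n))"
    by (rule mult_le_mono[OF le_refl mult_le_mono[OF key]]) (use assms in simp)
  also have "\<dots> = 192000 * n * w ^ (8 * w\<^sup>2)" by simp
  finally show ?thesis .
qed

theorem theorem2:
  shows "\<exists>(P :: com) (a :: nat) (c :: nat).
    \<forall>(V :: nat set) (E :: nat set set) (r :: nat rel) (vs :: nat list) (es :: (nat \<times> nat) list).
      simple_graph V E \<and> strict_linear_order_on V r \<and> presents vs es V E r \<longrightarrow>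
      (\<exists>t s \<sigma>. exec P (input_mem vs es) t s \<and>
         (\<forall>i < length es. s ''page'' i = \<sigma> (edge (es ! i))) \<and>
         book_embedding (fobt V E r) V E r \<sigma> \<and>
         (V \<noteq> {} \<longrightarrow>
            t \<le> a * card V * pathwidth V E r ^ (c * (pathwidth V E r)\<^sup>2)))"
proof (rule exI[of _ book_program], rule exI[of _ 192000], rule exI[of _ 8], intro allI impI)
  fix V :: "nat set" and E :: "nat set set" and r :: "nat rel" and vs :: "nat list" and es :: "(nat \<times> nat) list"
  assume "simple_graph V E \<and> strict_linear_order_on V r \<and> presents vs es V E r"
  then interpret presented_graph V E r vs es by unfold_locales auto
  from book_program_correct obtain t s \<sigma> where *: "exec book_program (input_mem vs es) t s"
    "t \<le> 3000 * ((width + 1) ^ 3 * codes width ^ 2 * (length vs + 1))"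
    "\<forall>i<length es. s ''page'' i = \<sigma> (edge (es ! i))" "book_embedding (fobt V E r) V E r \<sigma>"
    unfolding runs_def by blast
  have "t \<le> 192000 * card V * pathwidth V E r ^ (8 * (pathwidth V E r)\<^sup>2)" if "V \<noteq> {}"
  proof -
    have "1 \<le> length vs" using that set_vs by (cases vs) auto
    from le_trans[OF *(2)[unfolded codes_def] time_bound[OF this]] show ?thesis
      unfolding pathwidth_eq_width[OF that] card_V .
  qed
  with * show "\<exists>t s \<sigma>. exec book_program (input_mem vs es) t s \<and>
      (\<forall>i<length es. s ''page'' i = \<sigma> (edge (es ! i))) \<and> book_embedding (fobt V E r) V E r \<sigma> \<and>
      (V \<noteq> {} \<longrightarrow> t \<le> 192000 * card V * pathwidth V E r ^ (8 * (pathwidth V E r)\<^sup>2))"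
    by blast
qed

end
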